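(* Assume that $0<\lambda<\mu^*$, where $\mu^*=B\log_2\bigl(1+\frac1{1+\xi_N}\bigr)$. Then the McKean–Vlasov process $Q^{(MF1,1)}=(q_i^{(MF1,1)})_{1\le i\le N}$ admits a unique stationary distribution, and it is the product measure on $\mathbb N^N$ whose $N$ marginals are all equal to $\pi_\lambda^{MF1}=\mathrm{Geom}(1-x^*(\lambda))$, where $x^*(\lambda)$ is the unique solution in $[0,1]$ of $$\frac{\lambda}{x}=B\log_2\Bigl(1+\frac{1}{1+x\,\xi_N}\Bigr).$$
   Context: $\mathbb N=\{0,1,2,\dots\}$. Fix an integer $N\ge2$ and constants $B,\lambda>0$. There are $N$ queue positions $1,\dots,N$ on a discrete torus; $d(i,j)=\min(|i-j|,N-|i-j|)$. The path-loss function $l$ is one of $\ell_1(r)=(A\max(r,r_0))^{-C}$, $\ell_2(r)=(1+Ar)^{-C}$, $\ell_3(r)=Ae^{-Cr}$ with $A,C,r_0>0$, and $\xi_N=\sum_{j\ne i}l(d(i,j))$ (independent of $i$). For $1\le i\le N$ let $A_{1,i}$ be Poisson point processes on $\mathbb R_+$ of intensity $\lambda\,\mathrm dx$ and $D_{1,i}$ Poisson random measures on $\mathbb R_+\times\mathbb R_+$ of intensity $\mathrm du\,\mathrm dz$, all mutually independent and independent of the initial condition. The process $Q^{(MF1,1)}$ solves the McKean–Vlasov equation $$q_i^{(MF1,1)}(t)=q_i^{(MF1,1)}(0)+A_{1,i}[0,t]-\int_0^t\int_{\mathbb R_+}\mathbf 1_{\{q_i^{(MF1,1)}(z^-)>0\}}\mathbf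 1_{\{u\le\mu^{MF1}(z^-)\}}D_{1,i}(\mathrm du,\mathrm dz),$$ with $\mu^{MF1}(z)=B\log_2\Bigl(1+\frac{1}{1+\mathbb P(q_1^{(MF1,1)}(z)>0)\,\xi_N}\Bigr)$, where the law of the initial condition $(q_i^{(MF1,1)}(0))_{1\le i\le N}$ is assumed invariant under translations of the index $i$ modulo $N$. The equation has a pathwise unique strong solution. A stationary distribution is a probability measure $\pi$ on $\mathbb N^N$ (an admissible initial law) such that if $Q^{(MF1,1)}(0)\sim\pi$ then $Q^{(MF1,1)}(t)\sim\pi$ for all $t\ge0$. $\mathrm{Geom}(1-x)$ is the law on $\mathbb N$ with mass $(1-x)x^k$ at $k\ge0$. *)

theory Defs
  imports "HOL-Probability.Probability"
begin

section \<open>Interference on the discrete torus\<close>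

definition torus_dist :: "nat \<Rightarrow> nat \<Rightarrow> nat \<Rightarrow> nat" where
  "torus_dist N i j = (let k = nat \<bar>int i - int j\<bar> in min k (N - k))"

definition path_loss :: "(real \<Rightarrow> real) \<Rightarrow> bool" where
  "path_loss l \<longleftrightarrow> (\<exists>a c r0. 0 < a \<and> 0 < c \<and> 0 < r0 \<and>
     (l = (\<lambda>r. (a * max r r0) powr (- c)) \<or>
      l = (\<lambda>r. (1 + a * r) powr (- c)) \<or>
      l = (\<lambda>r. a * exp (- c * r))))"

definition interference_at :: "(real \<Rightarrow> real) \<Rightarrow> nat \<Rightarrow> nat \<Rightarrow> real" where
  "interference_at l N i = (\<Sum>j\<in>{1..N} - {i}. l (real (torus_dist N i j)))"

text \<open>The total path loss seen from position \<open>1\<close>; by \<open>interference_at_eq_xi\<close> below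
  every other position gives the same value.\<close>

definition xi :: "(real \<Rightarrow> real) \<Rightarrow> nat \<Rightarrow> real" where
  "xi l N = interference_at l N 1"

lemma interference_at_eq:
  assumes i: "i \<in> {1..N}"
  shows "interference_at l N i = (\<Sum>r\<in>{1..<N}. l (real (min r (N - r))))"
  unfolding interference_at_def
proof (rule sum.reindex_bij_witness
    [where i = "\<lambda>r. if i + r \<le> N then i + r else i + r - N"
      and j = "\<lambda>j. if i < j then j - i else j + N - i"])
  fix j assume "j \<in> {1..N} - {i}"
  then have j: "1 \<le> j" "j \<le> N" "j \<noteq> i" by auto
  let ?r = "if i < j then j - i else j + N - i"
  have "min ?r (N - ?r) = torus_dist N i j"
    using i j unfolding torus_dist_def Let_def by (cases "i < j") (auto simp: min_def)
  then show "l (real (min ?r (N - ?r))) = l (real (torus_dist N i j))" by simp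
qed (use i in \<open>auto split: if_splits\<close>)

lemma interference_at_eq_xi:
  assumes "i \<in> {1..N}"
  shows "interference_at l N i = xi l N"
proof -
  from assms have "1 \<in> {1..N}" by auto
  from interference_at_eq[OF assms] interference_at_eq[OF this]
  show ?thesis by (simp add: xi_def)
qed


section \<open>Poisson random measures\<close>

text \<open>A Poisson random measure with intensity \<open>\<nu>\<close>: an integer-valued random measure
  with Poisson counts on the sets of finite intensity and independent counts on disjoint sets.
  The Poisson weights are written out because \<open>poisson_pmf\<close> excludes the mean \<open>0\<close>.\<close>

definition poisson_random_measure ::
  "'w measure \<Rightarrow> 'x measure \<Rightarrow> ('w \<Rightarrow> 'x measure) \<Rightarrow> bool" where
  "poisson_random_measure M \<nu> X \<longleftrightarrow>
     (\<forall>\<omega>\<in>space M. sets (X \<omega>) = sets \<nu>) \<and>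
     (\<forall>\<omega>\<in>space M. \<forall>S\<in>sets \<nu>. emeasure (X \<omega>) S \<in> insert \<infinity> (range of_nat)) \<and>
     (\<forall>S\<in>sets \<nu>. (\<lambda>\<omega>. emeasure (X \<omega>) S) \<in> borel_measurable M) \<and>
     (\<forall>S\<in>sets \<nu>. emeasure \<nu> S < \<infinity> \<longrightarrow>
        (\<forall>k. measure M {\<omega>\<in>space M. emeasure (X \<omega>) S = of_nat k}
               = measure \<nu> S ^ k / fact k * exp (- measure \<nu> S))) \<and>
     (\<forall>F. finite F \<and> F \<subseteq> sets \<nu> \<and> disjoint F \<longrightarrow>
        prob_space.indep_vars M (\<lambda>_. borel) (\<lambda>S \<omega>. emeasure (X \<omega>) S) F)"

definition random_measure_events ::
  "'w measure \<Rightarrow> 'x measure \<Rightarrow> ('w \<Rightarrow> 'x measure) \<Rightarrow> 'w set set" where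
  "random_measure_events M \<nu> X =
     sigma_sets (space M)
       {(\<lambda>\<omega>. emeasure (X \<omega>) S) -` T \<inter> space M | S T. S \<in> sets \<nu> \<and> T \<in> sets borel}"

definition arrival_intensity :: "real \<Rightarrow> real measure" where
  "arrival_intensity lam = scale_measure (ennreal lam) (restrict_space lborel {0..})"

definition departure_intensity :: "(real \<times> real) measure" where
  "departure_intensity = restrict_space lborel ({0..} \<times> {0..})"

definition driving_noise ::
  "'w measure \<Rightarrow> nat \<Rightarrow> real \<Rightarrow> (nat \<Rightarrow> 'w \<Rightarrow> real measure)
     \<Rightarrow> (nat \<Rightarrow> 'w \<Rightarrow> (real \<times> real) measure) \<Rightarrow> bool" where
  "driving_noise M N lam A D \<longleftrightarrow>
     prob_space M \<and>
     (\<forall>i\<in>{1..N}. poisson_random_measure M (arrival_intensity lam) (A i)) \<and>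
     (\<forall>i\<in>{1..N}. poisson_random_measure M departure_intensity (D i)) \<and>
     prob_space.indep_sets M
       (case_sum (\<lambda>i. random_measure_events M (arrival_intensity lam) (A i))
                 (\<lambda>i. random_measure_events M departure_intensity (D i)))
       ({1..N} <+> {1..N})"

definition noise_events ::
  "'w measure \<Rightarrow> nat \<Rightarrow> real \<Rightarrow> (nat \<Rightarrow> 'w \<Rightarrow> real measure)
     \<Rightarrow> (nat \<Rightarrow> 'w \<Rightarrow> (real \<times> real) measure) \<Rightarrow> 'w set set" where
  "noise_events M N lam A D =
     sigma_sets (space M)
       (\<Union>i\<in>{1..N}. random_measure_events M (arrival_intensity lam) (A i)
                    \<union> random_measure_events M departure_intensity (D i))"


section \<open>The McKean--Vlasov process\<close>

abbreviation state_space :: "nat \<Rightarrow> (nat \<Rightarrow> nat) measure" where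
  "state_space N \<equiv> Pi\<^sub>M {1..N} (\<lambda>_. count_space UNIV)"

definition translate :: "nat \<Rightarrow> nat \<Rightarrow> (nat \<Rightarrow> nat) \<Rightarrow> nat \<Rightarrow> nat" where
  "translate N k x = (\<lambda>i\<in>{1..N}. x ((i - 1 + k) mod N + 1))"

definition translation_invariant :: "nat \<Rightarrow> (nat \<Rightarrow> nat) measure \<Rightarrow> bool" where
  "translation_invariant N \<pi> \<longleftrightarrow>
     (\<forall>k. distr \<pi> (state_space N) (translate N k) = \<pi>)"

text \<open>\<open>q i t \<omega>\<close> is the length of queue \<open>i\<close> at time \<open>t\<close>.  Only \<open>i \<in> {1..N}\<close> and \<open>t \<ge> 0\<close>
  matter, which is why the left limit at time \<open>0\<close> is set to the initial value.\<close>

definition left_lim :: "(real \<Rightarrow> 'a::t2_space) \<Rightarrow> real \<Rightarrow> 'a" where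
  "left_lim f z = (if 0 < z then Lim (at_left z) f else f 0)"

definition cadlag :: "(real \<Rightarrow> 'a::topological_space) \<Rightarrow> bool" where
  "cadlag f \<longleftrightarrow> (\<forall>t\<ge>0. (f \<longlongrightarrow> f t) (at_right t)) \<and>
                 (\<forall>t>0. \<exists>x. (f \<longlongrightarrow> x) (at_left t))"

definition queue_state :: "nat \<Rightarrow> (nat \<Rightarrow> real \<Rightarrow> 'w \<Rightarrow> nat) \<Rightarrow> real \<Rightarrow> 'w \<Rightarrow> (nat \<Rightarrow> nat)" where
  "queue_state N q t \<omega> = (\<lambda>i\<in>{1..N}. q i t \<omega>)"

definition mf_rate ::
  "'w measure \<Rightarrow> real \<Rightarrow> real \<Rightarrow> (nat \<Rightarrow> real \<Rightarrow> 'w \<Rightarrow> nat) \<Rightarrow> real \<Rightarrow> real" where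
  "mf_rate M B \<xi> q z =
     B * log 2 (1 + 1 / (1 + measure M {\<omega>\<in>space M. q 1 z \<omega> > 0} * \<xi>))"

text \<open>In \<open>D\<close> the first coordinate is the mark \<open>u\<close> and the second one the time \<open>z\<close>.\<close>

definition MF1_equation ::
  "'w measure \<Rightarrow> real \<Rightarrow> real \<Rightarrow> (nat \<Rightarrow> 'w \<Rightarrow> real measure)
     \<Rightarrow> (nat \<Rightarrow> 'w \<Rightarrow> (real \<times> real) measure) \<Rightarrow> (nat \<Rightarrow> real \<Rightarrow> 'w \<Rightarrow> nat)
     \<Rightarrow> nat \<Rightarrow> real \<Rightarrow> 'w \<Rightarrow> bool" where
  "MF1_equation M B \<xi> A D q i t \<omega> \<longleftrightarrow>
     real (q i t \<omega>) = real (q i 0 \<omega>) + measure (A i \<omega>) {0..t}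
       - (\<integral>(u, z). indicat_real {0..t} z
             * of_bool (left_lim (\<lambda>s. q i s \<omega>) z > 0)
             * of_bool (u \<le> left_lim (mf_rate M B \<xi> q) z) \<partial>D i \<omega>)"

definition MF1_solution ::
  "'w measure \<Rightarrow> nat \<Rightarrow> real \<Rightarrow> real \<Rightarrow> real \<Rightarrow> (nat \<Rightarrow> 'w \<Rightarrow> real measure)
     \<Rightarrow> (nat \<Rightarrow> 'w \<Rightarrow> (real \<times> real) measure) \<Rightarrow> (nat \<Rightarrow> real \<Rightarrow> 'w \<Rightarrow> nat) \<Rightarrow> bool" where
  "MF1_solution M N lam B \<xi> A D q \<longleftrightarrow>
     driving_noise M N lam A D \<and>
     (\<forall>i\<in>{1..N}. \<forall>t\<ge>0. q i t \<in> M \<rightarrow>\<^sub>M count_space UNIV) \<and>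
     prob_space.indep_set M
       {queue_state N q 0 -` S \<inter> space M | S. S \<in> sets (state_space N)}
       (noise_events M N lam A D) \<and>
     translation_invariant N (distr M (state_space N) (queue_state N q 0)) \<and>
     (AE \<omega> in M. \<forall>i\<in>{1..N}. cadlag (\<lambda>t. q i t \<omega>) \<and>
        (\<forall>t\<ge>0. MF1_equation M B \<xi> A D q i t \<omega>))"

text \<open>The probability space \<open>M\<close> carries only the driving noise, so the process with initial law
  \<open>\<pi>\<close> is considered on \<open>\<pi> \<Otimes>\<^sub>M M\<close>, which also carries an independent initial condition.
  The existence clause excludes a vacuous reading of the condition on all solutions.\<close>

definition MF1_stationary ::
  "'w measure \<Rightarrow> nat \<Rightarrow> real \<Rightarrow> real \<Rightarrow> real \<Rightarrow> (nat \<Rightarrow> 'w \<Rightarrow> real measure)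
     \<Rightarrow> (nat \<Rightarrow> 'w \<Rightarrow> (real \<times> real) measure) \<Rightarrow> (nat \<Rightarrow> nat) measure \<Rightarrow> bool" where
  "MF1_stationary M N lam B \<xi> A D \<pi> \<longleftrightarrow>
     prob_space \<pi> \<and> sets \<pi> = sets (state_space N) \<and> translation_invariant N \<pi> \<and>
     (let E = \<pi> \<Otimes>\<^sub>M M;
          solves_from_\<pi> = (\<lambda>q.
            MF1_solution E N lam B \<xi> (\<lambda>i \<omega>. A i (snd \<omega>)) (\<lambda>i \<omega>. D i (snd \<omega>)) q \<and>
            distr E (state_space N) (queue_state N q 0) = \<pi>)
      in (\<exists>q. solves_from_\<pi> q) \<and>
         (\<forall>q. solves_from_\<pi> q \<longrightarrow>
            (\<forall>t\<ge>0. distr E (state_space N) (queue_state N q t) = \<pi>)))"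


section \<open>The load equation\<close>

text \<open>With the convention \<open>lam / 0 = 0\<close> the point \<open>x = 0\<close> is not a solution when \<open>B > 0\<close>,
  the right-hand side there being \<open>B\<close>.\<close>

definition load_equation :: "real \<Rightarrow> real \<Rightarrow> real \<Rightarrow> real \<Rightarrow> bool" where
  "load_equation lam B \<xi> x \<longleftrightarrow> lam / x = B * log 2 (1 + 1 / (1 + x * \<xi>))"

definition x_star :: "real \<Rightarrow> real \<Rightarrow> real \<Rightarrow> real" where
  "x_star lam B \<xi> = (THE x. x \<in> {0..1} \<and> load_equation lam B \<xi> x)"

text \<open>\<open>geometric_pmf (1 - x)\<close> has mass \<open>x ^ k * (1 - x)\<close> at \<open>k\<close>.\<close>

definition geom_product :: "nat \<Rightarrow> real \<Rightarrow> (nat \<Rightarrow> nat) measure" where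
  "geom_product N x = Pi\<^sub>M {1..N} (\<lambda>_. measure_pmf (geometric_pmf (1 - x)))"

end

theory Submission
  imports Defs
begin

text \<open>
In a stationary regime the busy probability \<open>p\<close> of a queue does not change, so the McKean--Vlasov
rate is a constant \<open>r = service_rate B \<xi> p\<close> and the positions become independent M/M/1 queues with
arrival rate \<open>lam\<close> and service rate \<open>r\<close>.  Since \<open>r \<ge> service_rate B \<xi> 1 > lam\<close>, such a queue has
the law \<open>Geom(1 - lam / r)\<close> as its only stationary law; this law gives \<open>p = lam / r\<close>, which is the load
equation, and \<open>x * service_rate B \<xi> x\<close> is strictly increasing, so the load equation has one solution.
The proof needs three things: the M/M/1 facts, the converse that every solution started from the
geometric product law has constant rate, and one solution.

The M/M/1 facts are obtained from a grid.  Divide \<open>[0, t]\<close> into \<open>n\<close> cells.  Outside an event of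
probability \<open>O(t\<^sup>2 / n)\<close> no cell contains two points of the noise, and then the queue at time \<open>t\<close> is the
end point of a random walk that reads only the Poisson counts of the cells
(\<open>queue_path_eq_walk\<close>, \<open>law_close_to_walk_law\<close>).  No fine structure of the point measures is used:
only counts on finitely many disjoint sets.  The step of the walk ignores cells with two or more points.
With this convention the geometric law is exactly invariant for every \<open>n\<close> (\<open>geometric_invariant\<close>),
so it is invariant for the queue by \<open>n \<longlongrightarrow> \<infinity>\<close>.  Two walks that read the same cells coalesce
exponentially fast (\<open>walk_pair_contraction\<close>), so any stationary law equals the geometric one
(\<open>stationary_law_geometric\<close>).

For the converse, compare a solution with rate \<open>\<rho>\<close> with the walk of constant rate \<open>r\<close> driven by the
same noise.  They can only differ when a service mark falls between \<open>\<rho>\<close> and \<open>r\<close>, and the probability of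
this is at most the area of a rectangle around the gap.  The rate is a Lipschitz function of the busy probability, so this is a Gronwall
estimate for \<open>\<bar>p(t) - x\<bar>\<close>; it is run on short time intervals (\<open>busy_constant\<close>).

A solution is the M/M/1 queue with the constant rate \<open>r\<close>, written by Skorokhod reflection
(\<open>reflected_queue_path\<close>); by the invariance just described its busy probability is constant,
so it satisfies the McKean--Vlasov equation (\<open>MF1_solution_exists\<close>).
\<close>

section \<open>The load equation\<close>

definition service_rate :: "real \<Rightarrow> real \<Rightarrow> real \<Rightarrow> real" where
  "service_rate B \<xi> p = B * log 2 (1 + 1 / (1 + p * \<xi>))"

lemma service_rate_eq_ln:
  assumes "0 \<le> \<xi>" "0 \<le> p"
  shows "service_rate B \<xi> p = B / ln 2 * (ln (2 + p * \<xi>) - ln (1 + p * \<xi>))"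
proof -
  have pos: "0 \<le> p * \<xi>" using assms by simp
  have "1 + 1 / (1 + p * \<xi>) = (2 + p * \<xi>) / (1 + p * \<xi>)"
    using pos by (simp add: field_simps)
  then show ?thesis
    using pos by (simp add: service_rate_def log_def ln_div)
qed

lemma service_rate_pos:
  assumes "0 < B" "0 \<le> \<xi>" "0 \<le> p"
  shows "0 < service_rate B \<xi> p"
proof -
  have "0 \<le> p * \<xi>" using assms by simp
  then have "1 < 1 + 1 / (1 + p * \<xi>)" by simp
  then have "0 < log 2 (1 + 1 / (1 + p * \<xi>))"
    using zero_less_log_cancel_iff[of 2 "1 + 1 / (1 + p * \<xi>)"] by linarith
  then show ?thesis unfolding service_rate_def using assms by simp
qed

lemma service_rate_antimono:
  assumes "0 < B" "0 \<le> \<xi>" "0 \<le> p" "p \<le> q"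
  shows "service_rate B \<xi> q \<le> service_rate B \<xi> p"
proof -
  have "0 \<le> p * \<xi>" "p * \<xi> \<le> q * \<xi>" using assms by (auto intro: mult_right_mono)
  then have "1 + 1 / (1 + q * \<xi>) \<le> 1 + 1 / (1 + p * \<xi>)" "0 < 1 + 1 / (1 + q * \<xi>)"
    by (auto intro!: divide_left_mono add_pos_nonneg)
  then show ?thesis
    using assms(1) by (auto simp: service_rate_def intro!: mult_left_mono)
qed

lemma service_rate_le:
  assumes "0 < B" "0 \<le> \<xi>" "0 \<le> p"
  shows "service_rate B \<xi> p \<le> B"
  using service_rate_antimono[of B \<xi> 0 p] assms by (simp add: service_rate_def)

text \<open>An error in the busy probability becomes a comparable error of the rate; this closes the
  Gronwall estimate in \<open>busy_constant\<close>.\<close>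

lemma service_rate_lipschitz:
  assumes "0 < B" "0 \<le> \<xi>" "0 \<le> p" "0 \<le> q"
  shows "\<bar>service_rate B \<xi> p - service_rate B \<xi> q\<bar> \<le> 2 * B * \<xi> / ln 2 * \<bar>p - q\<bar>"
proof -
  have ln_lip: "\<bar>ln a - ln b\<bar> \<le> \<bar>a - b\<bar>" if "1 \<le> a" "1 \<le> b" for a b :: real
  proof -
    have *: "ln x - ln y \<le> x - y" if "1 \<le> y" "y \<le> x" for x y :: real
    proof -
      have "ln x - ln y = ln (x / y)" using that by (simp add: ln_div)
      also have "\<dots> \<le> x / y - 1" using that by (intro ln_le_minus_one) auto
      also have "\<dots> = (x - y) / y" using that by (simp add: field_simps)
      also have "\<dots> \<le> x - y" using that by (auto simp: divide_le_eq intro: mult_left_mono[of 1 y "x - y", simplified])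
      finally show ?thesis .
    qed
    show ?thesis
      using *[of a b] *[of b a] that ln_mono[of a b] ln_mono[of b a] by (cases "a \<le> b") auto
  qed
  have pos: "0 \<le> p * \<xi>" "0 \<le> q * \<xi>" using assms by simp_all
  have "\<bar>(ln (2 + p * \<xi>) - ln (1 + p * \<xi>)) - (ln (2 + q * \<xi>) - ln (1 + q * \<xi>))\<bar>
      \<le> \<bar>ln (2 + p * \<xi>) - ln (2 + q * \<xi>)\<bar> + \<bar>ln (1 + p * \<xi>) - ln (1 + q * \<xi>)\<bar>"
    by linarith
  also have "\<dots> \<le> 2 * \<bar>p * \<xi> - q * \<xi>\<bar>"
    using ln_lip[of "2 + p * \<xi>" "2 + q * \<xi>"] ln_lip[of "1 + p * \<xi>" "1 + q * \<xi>"] pos by simp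
  also have "\<dots> = 2 * (\<xi> * \<bar>p - q\<bar>)"
    using assms by (simp add: left_diff_distrib[symmetric] abs_mult)
  finally have main: "\<bar>(ln (2 + p * \<xi>) - ln (1 + p * \<xi>)) - (ln (2 + q * \<xi>) - ln (1 + q * \<xi>))\<bar>
      \<le> 2 * (\<xi> * \<bar>p - q\<bar>)" .
  have "\<bar>service_rate B \<xi> p - service_rate B \<xi> q\<bar>
     = B / ln 2 * \<bar>(ln (2 + p * \<xi>) - ln (1 + p * \<xi>)) - (ln (2 + q * \<xi>) - ln (1 + q * \<xi>))\<bar>"
    using assms by (simp only: service_rate_eq_ln right_diff_distrib[symmetric] abs_mult) simp
  also have "\<dots> \<le> B / ln 2 * (2 * (\<xi> * \<bar>p - q\<bar>))"
    using assms by (intro mult_left_mono main) auto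
  finally show ?thesis by (simp add: mult_ac)
qed

text \<open>The derivative of \<open>x (ln (2 + x \<xi>) - ln (1 + x \<xi>))\<close> is positive: the difference of logarithms is at
  least \<open>1 / (2 + x \<xi>)\<close>, and the negative term is this number times \<open>x \<xi> / (1 + x \<xi>) < 1\<close>.\<close>

lemma load_strict_mono:
  assumes "0 < B" "0 \<le> \<xi>" "0 \<le> x" "x < y"
  shows "x * service_rate B \<xi> x < y * service_rate B \<xi> y"
proof -
  define h where "h = (\<lambda>x. x * (ln (2 + x * \<xi>) - ln (1 + x * \<xi>)))"
  have "h x < h y"
  proof (rule DERIV_pos_imp_increasing[OF assms(4)])
    fix z assume "x \<le> z" "z \<le> y"
    then have z: "0 \<le> z * \<xi>" using assms by simp
    have der: "(h has_real_derivative
        ln (2 + z * \<xi>) - ln (1 + z * \<xi>) + z * (\<xi> / (2 + z * \<xi>) - \<xi> / (1 + z * \<xi>))) (at z)"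
      unfolding h_def using z by (auto intro!: derivative_eq_intros simp: divide_inverse mult_ac)
    have "ln ((1 + z * \<xi>) / (2 + z * \<xi>)) \<le> (1 + z * \<xi>) / (2 + z * \<xi>) - 1"
      using z by (intro ln_le_minus_one) auto
    also have "\<dots> = - (1 / (2 + z * \<xi>))" using z by (simp add: field_simps)
    finally have "1 / (2 + z * \<xi>) \<le> ln (2 + z * \<xi>) - ln (1 + z * \<xi>)"
      using z by (simp add: ln_div)
    moreover have "z * (\<xi> / (2 + z * \<xi>) - \<xi> / (1 + z * \<xi>))
        = - (z * \<xi> / (1 + z * \<xi>) * (1 / (2 + z * \<xi>)))"
      using z by (simp add: divide_simps) (simp add: algebra_simps)
    moreover have "z * \<xi> / (1 + z * \<xi>) * (1 / (2 + z * \<xi>)) < 1 / (2 + z * \<xi>)"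
      using z by (intro mult_less_cancel_right2[THEN iffD2]) auto
    ultimately show "\<exists>d. (h has_real_derivative d) (at z) \<and> 0 < d"
      using der by (intro exI[of _ "ln (2 + z * \<xi>) - ln (1 + z * \<xi>)
          + z * (\<xi> / (2 + z * \<xi>) - \<xi> / (1 + z * \<xi>))"] conjI) linarith+
  qed
  then show ?thesis
    using assms by (simp add: service_rate_eq_ln h_def mult_ac divide_strict_right_mono)
qed

lemma load_equation_iff:
  assumes "0 < B" "0 \<le> \<xi>" "0 < lam" "0 \<le> x"
  shows "load_equation lam B \<xi> x \<longleftrightarrow> x * service_rate B \<xi> x = lam"
  using service_rate_pos[OF assms(1,2,4)] assms
  by (cases "x = 0") (auto simp: load_equation_def service_rate_def field_simps)

lemma ex1_load_equation:
  assumes B: "0 < B" and xi: "0 \<le> \<xi>" and lam: "0 < lam" "lam < service_rate B \<xi> 1"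
  shows "\<exists>!x. x \<in> {0..1} \<and> load_equation lam B \<xi> x"
proof -
  have "continuous_on {0..1} (\<lambda>x. x * service_rate B \<xi> x)"
    unfolding service_rate_def log_def
    using xi by (intro continuous_intros ballI) 
      (auto simp: add_nonneg_eq_0_iff add_pos_nonneg intro!: less_imp_neq[THEN not_sym])
  then obtain x where x: "0 \<le> x" "x \<le> 1" "x * service_rate B \<xi> x = lam"
    using IVT'[of "\<lambda>x. x * service_rate B \<xi> x" 0 lam 1] lam by auto
  show ?thesis
  proof (rule ex1I[of _ x])
    show "x \<in> {0..1} \<and> load_equation lam B \<xi> x"
      using x by (simp add: load_equation_iff B xi lam)
    fix y assume "y \<in> {0..1} \<and> load_equation lam B \<xi> y"
    then have "0 \<le> y" "y * service_rate B \<xi> y = lam"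
      by (auto simp: load_equation_iff B xi lam)
    then show "y = x"
      using load_strict_mono[OF B xi, of x y] load_strict_mono[OF B xi, of y x] x
      by (cases x y rule: linorder_cases) auto
  qed
qed

lemma xi_nonneg:
  assumes "path_loss l"
  shows "0 \<le> xi l N"
  using assms unfolding xi_def interference_at_def path_loss_def
  by (auto intro!: sum_nonneg)

section \<open>A birth-death walk driven by cells of a grid\<close>

text \<open>A pair counts the arrivals and the service marks of one grid cell.  Cells with several points are rare
  on a fine grid, so their effect may be chosen freely; leaving the queue unchanged makes the ratio of
  the up and the down probability equal to the ratio of the two Poisson means.\<close>

definition queue_step :: "nat \<Rightarrow> nat \<times> nat \<Rightarrow> nat" where
  "queue_step x c = (if c = (1, 0) then x + 1 else if c = (0, 1) then x - 1 else x)"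

primrec walk :: "nat \<Rightarrow> (nat \<Rightarrow> nat \<times> nat) \<Rightarrow> nat \<Rightarrow> nat" where
  "walk x v 0 = x"
| "walk x v (Suc k) = queue_step (walk x v k) (v k)"

definition cell_pmf :: "real \<Rightarrow> real \<Rightarrow> (nat \<times> nat) pmf" where
  "cell_pmf a b = pair_pmf (poisson_pmf a) (poisson_pmf b)"

abbreviation cells_pmf :: "nat \<Rightarrow> real \<Rightarrow> real \<Rightarrow> (nat \<Rightarrow> nat \<times> nat) pmf" where
  "cells_pmf n a b \<equiv> Pi_pmf {..<n} undefined (\<lambda>_. cell_pmf a b)"

lemma walk_cong: "(\<And>k. k < n \<Longrightarrow> v k = w k) \<Longrightarrow> walk x v n = walk x w n"
  by (induction n) auto

lemma pmf_cell:
  assumes "0 < a" "0 < b"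
  shows "pmf (cell_pmf a b) (1, 0) = a * exp (- (a + b))"
    and "pmf (cell_pmf a b) (0, 1) = b * exp (- (a + b))"
  using assms by (simp_all add: cell_pmf_def pmf_pair exp_add[symmetric] exp_minus divide_simps exp_diff)

lemma integral_two_point_exception:
  fixes p :: "'a pmf" and g0 g1 g2 :: real
  assumes "c1 \<noteq> c2"
  shows "measure_pmf.expectation p (\<lambda>c. if c = c1 then g1 else if c = c2 then g2 else g0)
    = pmf p c1 * g1 + pmf p c2 * g2 + (1 - pmf p c1 - pmf p c2) * g0"
proof -
  have "(\<lambda>c. if c = c1 then g1 else if c = c2 then g2 else g0)
      = (\<lambda>c. g0 + (g1 - g0) * indicator {c1} c + (g2 - g0) * indicator {c2} c)"
    using assms by (auto simp: fun_eq_iff indicator_def)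
  moreover have "measure_pmf.expectation p
      (\<lambda>c. g0 + (g1 - g0) * indicator {c1} c + (g2 - g0) * indicator {c2} c)
    = g0 + (g1 - g0) * pmf p c1 + (g2 - g0) * pmf p c2"
    by (simp add: measure_pmf_single measure_pmf.integrable_const_bound[where B = 1])
  ultimately show ?thesis by (simp add: algebra_simps)
qed

text \<open>Detailed balance: the up and down probabilities are \<open>a exp (-(a + b))\<close> and \<open>b exp (-(a + b))\<close>, with
  ratio \<open>a / b\<close>, the ratio of consecutive geometric weights.\<close>

lemma geometric_invariant:
  assumes ab: "0 < a" "a < b"
  shows "bind_pmf (geometric_pmf (1 - a / b)) (\<lambda>x. map_pmf (queue_step x) (cell_pmf a b))
    = geometric_pmf (1 - a / b)" (is "?L = ?G")
proof (rule pmf_eqI)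
  fix y
  let ?r = "a / b"
  let ?up = "pmf (cell_pmf a b) (1, 0)" and ?dn = "pmf (cell_pmf a b) (0, 1)"
  have r: "0 < 1 - ?r" "1 - ?r \<le> 1" using ab by auto
  note G = pmf_geometric[OF r]
  have bal: "?up = ?r * ?dn" using ab by (simp add: pmf_cell[unfolded One_nat_def])
  have one: "pmf (map_pmf (queue_step x) (cell_pmf a b)) y
      = ?up * indicator {x. x + 1 = y} x + ?dn * indicator {x. x - 1 = y} x
        + (1 - ?up - ?dn) * indicator {y} x" for x
  proof -
    have "pmf (map_pmf (queue_step x) (cell_pmf a b)) y
      = measure_pmf.expectation (cell_pmf a b) (indicator (queue_step x -` {y}))"
      by (simp add: pmf_map)
    also have "indicator (queue_step x -` {y}) = (\<lambda>c. if c = (1, 0) then of_bool (x + 1 = y)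
        else if c = (0, 1) then of_bool (x - 1 = y) else of_bool (x = y) :: real)"
      by (auto simp: fun_eq_iff indicator_def queue_step_def)
    also have "measure_pmf.expectation (cell_pmf a b) \<dots>
        = ?up * of_bool (x + 1 = y) + ?dn * of_bool (x - 1 = y) + (1 - ?up - ?dn) * of_bool (x = y)"
      by (rule integral_two_point_exception) simp
    finally show ?thesis by (simp add: indicator_def)
  qed
  have "pmf ?L y = ?up * measure_pmf.prob ?G {x. x + 1 = y} + ?dn * measure_pmf.prob ?G {x. x - 1 = y}
        + (1 - ?up - ?dn) * measure_pmf.prob ?G {y}"
    unfolding pmf_bind one by (simp add: measure_pmf.integrable_const_bound[where B = 1])
  also have "measure_pmf.prob ?G {x. x + 1 = y} = (if y = 0 then 0 else pmf ?G (y - 1))"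
  proof -
    have "{x. x + 1 = y} = (if y = 0 then {} else {y - 1})" by auto
    then show ?thesis by (simp add: measure_pmf_single)
  qed
  also have "measure_pmf.prob ?G {x. x - 1 = y} = pmf ?G (y + 1) + (if y = 0 then pmf ?G 0 else 0)"
  proof -
    have "{x. x - 1 = y} = (if y = 0 then {0, 1} else {y + 1})" by auto
    then show ?thesis by (simp add: measure_pmf_single measure_measure_pmf_finite)
  qed
  also have "measure_pmf.prob ?G {y} = pmf ?G y" by (simp add: measure_pmf_single)
  finally have L: "pmf ?L y = ?r * ?dn * (if y = 0 then 0 else pmf ?G (y - 1))
      + ?dn * (pmf ?G (y + 1) + (if y = 0 then pmf ?G 0 else 0))
      + (1 - ?r * ?dn - ?dn) * pmf ?G y"
    unfolding bal .
  have "s * d * (if y = 0 then 0 else (1 - (1 - s)) ^ (y - 1) * (1 - s))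
      + d * ((1 - (1 - s)) ^ (y + 1) * (1 - s) + (if y = 0 then (1 - (1 - s)) ^ 0 * (1 - s) else 0))
      + (1 - s * d - d) * ((1 - (1 - s)) ^ y * (1 - s)) = (1 - (1 - s)) ^ y * (1 - s)" for s d :: real
    by (cases y) (simp_all add: algebra_simps)
  then show "pmf ?L y = pmf ?G y" unfolding L G .
qed

text \<open>The last cell is independent of the earlier ones, so the walk is a Markov chain.\<close>

lemma walk_law_Suc:
  "map_pmf (\<lambda>v. walk x v (Suc n)) (cells_pmf (Suc n) a b)
    = bind_pmf (map_pmf (\<lambda>v. walk x v n) (cells_pmf n a b))
        (\<lambda>z. map_pmf (queue_step z) (cell_pmf a b))"
proof -
  have w: "walk x (v(n := c)) n = walk x v n" for v c by (rule walk_cong) auto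
  have "map_pmf (\<lambda>v. walk x v (Suc n)) (cells_pmf (Suc n) a b)
    = bind_pmf (cell_pmf a b) (\<lambda>c. bind_pmf (cells_pmf n a b)
        (\<lambda>v. return_pmf (queue_step (walk x v n) c)))"
    by (simp add: lessThan_Suc Pi_pmf_insert' map_bind_pmf w)
  also have "\<dots> = bind_pmf (cells_pmf n a b) (\<lambda>v. bind_pmf (cell_pmf a b)
        (\<lambda>c. return_pmf (queue_step (walk x v n) c)))"
    by (rule bind_commute_pmf)
  finally show ?thesis by (simp add: map_pmf_def bind_assoc_pmf bind_return_pmf)
qed

lemma walk_geometric_invariant:
  assumes ab: "0 < a" "a < b"
  shows "bind_pmf (geometric_pmf (1 - a / b)) (\<lambda>x. map_pmf (\<lambda>v. walk x v n) (cells_pmf n a b))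
    = geometric_pmf (1 - a / b)"
proof (induction n)
  case 0
  then show ?case by (simp add: bind_return_pmf')
next
  case (Suc n)
  show ?case
    by (simp only: walk_law_Suc bind_assoc_pmf[symmetric] Suc geometric_invariant[OF ab])
qed

text \<open>Two walks reading the same cells move in parallel until the lower one is held back at \<open>0\<close>; once
  equal they stay equal.  So \<open>th ^ max x y\<close>, set to \<open>0\<close> when the walks agree, is multiplied
  on average by at most the mean of \<open>th ^ increment\<close> in each step, and it is at least \<open>1\<close> as long as they differ.\<close>

lemma walk_pair_contraction:
  fixes th :: real
  assumes ab: "0 < a" "0 < b" and th: "1 \<le> th"
  shows "measure_pmf.prob (cells_pmf n a b) {v. walk x v n \<noteq> walk y v n}
    \<le> th ^ max x y * (1 + exp (- (a + b)) * (a * (th - 1) + b * (1 / th - 1))) ^ n"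
proof -
  let ?up = "pmf (cell_pmf a b) (1, 0)" and ?dn = "pmf (cell_pmf a b) (0, 1)"
  define \<kappa> where "\<kappa> = 1 + exp (- (a + b)) * (a * (th - 1) + b * (1 / th - 1))"
  define \<phi> where "\<phi> = (\<lambda>x y::nat. if x = y then 0 else ennreal (th ^ max x y))"
  have kap: "\<kappa> = ?up * th + ?dn / th + (1 - ?up - ?dn)"
    using ab by (simp add: \<kappa>_def pmf_cell[unfolded One_nat_def] algebra_simps)
  have sum_le: "?up + ?dn \<le> 1"
  proof -
    have "?up + ?dn = measure_pmf.prob (cell_pmf a b) {(1, 0), (0, 1)}"
      by (subst measure_measure_pmf_finite) auto
    then show ?thesis by simp
  qed
  have kap0: "0 \<le> \<kappa>" unfolding kap using th sum_le by simp
  have step: "(\<integral>\<^sup>+c. \<phi> (queue_step x c) (queue_step y c) \<partial>cell_pmf a b) \<le> ennreal \<kappa> * \<phi> x y" for x y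
  proof (cases "x = y")
    case False
    then obtain m where m: "max x y = Suc m" by (cases "max x y") auto
    define g where "g = (\<lambda>c. if c = (1::nat, 0::nat) then th ^ (m + 2)
        else if c = (0, 1) then th ^ m else th ^ Suc m)"
    have le: "\<phi> (queue_step x c) (queue_step y c) \<le> ennreal (g c)" for c
      using False m th by (auto simp: \<phi>_def g_def queue_step_def intro!: ennreal_leI
          power_increasing split: if_splits)
    have "(\<integral>\<^sup>+c. \<phi> (queue_step x c) (queue_step y c) \<partial>cell_pmf a b)
        \<le> (\<integral>\<^sup>+c. ennreal (g c) \<partial>cell_pmf a b)"
      by (intro nn_integral_mono le)
    also have "\<dots> = ennreal (measure_pmf.expectation (cell_pmf a b) g)"
      using th mult_mono[of 1 th 1 th] by (intro nn_integral_eq_integral measure_pmf.integrable_const_bound[where B = "th ^ (m + 2)"])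
        (auto simp: g_def intro!: power_increasing)
    also have "measure_pmf.expectation (cell_pmf a b) g
        = ?up * th ^ (m + 2) + ?dn * th ^ m + (1 - ?up - ?dn) * th ^ Suc m"
      unfolding g_def by (rule integral_two_point_exception) simp
    also have "\<dots> = \<kappa> * th ^ max x y"
      using th by (simp add: kap m field_simps)
    finally show ?thesis using False kap0 by (simp add: \<phi>_def ennreal_mult')
  qed (simp add: \<phi>_def)
  have main: "(\<integral>\<^sup>+v. \<phi> (walk x v n) (walk y v n) \<partial>cells_pmf n a b) \<le> ennreal \<kappa> ^ n * \<phi> x y"
  proof (induction n)
    case (Suc n)
    have w: "walk z (v(n := c)) n = walk z v n" for v c z by (rule walk_cong) auto
    have "(\<integral>\<^sup>+v. \<phi> (walk x v (Suc n)) (walk y v (Suc n)) \<partial>cells_pmf (Suc n) a b)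
      = (\<integral>\<^sup>+v. \<integral>\<^sup>+c. \<phi> (queue_step (walk x v n) c) (queue_step (walk y v n) c) \<partial>cell_pmf a b \<partial>cells_pmf n a b)"
      by (subst bind_commute_pmf[symmetric] | simp add: lessThan_Suc Pi_pmf_insert' w
           bind_commute_pmf[of "cell_pmf a b"])+
    also have "\<dots> \<le> (\<integral>\<^sup>+v. ennreal \<kappa> * \<phi> (walk x v n) (walk y v n) \<partial>cells_pmf n a b)"
      by (intro nn_integral_mono step)
    also have "\<dots> = ennreal \<kappa> * (\<integral>\<^sup>+v. \<phi> (walk x v n) (walk y v n) \<partial>cells_pmf n a b)"
      by (rule nn_integral_cmult) simp
    also have "\<dots> \<le> ennreal \<kappa> * (ennreal \<kappa> ^ n * \<phi> x y)"
      by (intro mult_left_mono Suc) simp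
    finally show ?case by (simp add: mult_ac)
  qed simp
  have "emeasure (cells_pmf n a b) {v. walk x v n \<noteq> walk y v n}
      = (\<integral>\<^sup>+v. indicator {v. walk x v n \<noteq> walk y v n} v \<partial>cells_pmf n a b)"
    by simp
  also have "\<dots> \<le> (\<integral>\<^sup>+v. \<phi> (walk x v n) (walk y v n) \<partial>cells_pmf n a b)"
    using th by (intro nn_integral_mono) (auto simp: \<phi>_def indicator_def one_le_power ennreal_1[symmetric] simp del: ennreal_1 intro!: ennreal_leI)
  also have "\<dots> \<le> ennreal \<kappa> ^ n * ennreal (th ^ max x y)"
    using main by (rule order_trans) (auto simp: \<phi>_def intro!: mult_left_mono)
  also have "\<dots> = ennreal (th ^ max x y * \<kappa> ^ n)"
    using kap0 th by (simp add: ennreal_power ennreal_mult' mult.commute)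
  finally show ?thesis
    using kap0 th by (simp add: measure_pmf.emeasure_eq_measure \<kappa>_def)
qed

section \<open>Paths of a single queue\<close>

lemma sets_arrival_intensity:
  "S \<in> sets (arrival_intensity lam) \<longleftrightarrow> S \<in> sets borel \<and> S \<subseteq> {0..}"
  unfolding arrival_intensity_def
  by (subst sets_scale_measure, subst sets_restrict_space_iff) auto

lemma sets_departure_intensity:
  "S \<in> sets departure_intensity \<longleftrightarrow> S \<in> sets borel \<and> S \<subseteq> {0..} \<times> {0..}"
  unfolding departure_intensity_def
  by (subst sets_restrict_space_iff) (auto simp: closed_Times)

lemma Times_in_sets_departure:
  fixes S T :: "real set"
  assumes "S \<in> sets borel" "T \<in> sets borel" "S \<subseteq> {0..}" "T \<subseteq> {0..}"
  shows "S \<times> T \<in> sets departure_intensity"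
proof -
  have "S \<times> T \<in> sets (borel \<Otimes>\<^sub>M borel)" using assms(1,2) by (rule pair_measureI)
  then have "S \<times> T \<in> sets borel" by (simp only: borel_prod)
  then show ?thesis using assms by (auto simp: sets_departure_intensity)
qed

lemma cadlag_left_lim:
  assumes "cadlag f" "0 < z"
  shows "(f \<longlongrightarrow> left_lim f z) (at_left z)"
proof -
  obtain x where x: "(f \<longlongrightarrow> x) (at_left z)" using assms by (auto simp: cadlag_def)
  then have "left_lim f z = x" using assms(2) by (simp add: left_lim_def tendsto_Lim)
  with x show ?thesis by simp
qed

text \<open>Evaluating \<open>f\<close> at the last point of the grid \<open>\<int> / (n + 1)\<close> strictly before \<open>z\<close> gives step functions that
  converge to the left limit.\<close>

lemma borel_measurable_left_lim:
  fixes f :: "real \<Rightarrow> real"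
  assumes "\<And>z. 0 < z \<Longrightarrow> (f \<longlongrightarrow> left_lim f z) (at_left z)"
  shows "left_lim f \<in> borel_measurable borel"
proof (rule borel_measurable_LIMSEQ_metric)
  fix n :: nat
  have "(\<lambda>z::real. f (real_of_int (\<lceil>real (Suc n) * z\<rceil> - 1) / real (Suc n))) \<in> borel_measurable borel"
    by (rule measurable_compose[where N = "count_space UNIV" and f = "\<lambda>z. \<lceil>real (Suc n) * z\<rceil>"
          and g = "\<lambda>k. f (real_of_int (k - 1) / real (Suc n))"]) measurable
  then show "(\<lambda>z::real. if z \<le> 0 then f 0 else f (real_of_int (\<lceil>real (Suc n) * z\<rceil> - 1) / real (Suc n)))
      \<in> borel_measurable borel"
    by measurable
next
  fix z :: real
  show "(\<lambda>n. if z \<le> 0 then f 0 else f (real_of_int (\<lceil>real (Suc n) * z\<rceil> - 1) / real (Suc n)))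
      \<longlonglongrightarrow> left_lim f z"
  proof (cases "z \<le> 0")
    case False
    let ?s = "\<lambda>n. real_of_int (\<lceil>real (Suc n) * z\<rceil> - 1) / real (Suc n)"
    have lt: "?s n < z" for n
    proof -
      have "real_of_int (\<lceil>real (Suc n) * z\<rceil> - 1) < real (Suc n) * z" by linarith
      then show ?thesis by (subst divide_less_eq) (simp add: mult.commute)
    qed
    have ge: "z - 1 / real (Suc n) \<le> ?s n" for n
    proof -
      have "real (Suc n) * z - 1 \<le> real_of_int (\<lceil>real (Suc n) * z\<rceil> - 1)" by linarith
      then have "(real (Suc n) * z - 1) / real (Suc n) \<le> ?s n" by (rule divide_right_mono) simp
      then show ?thesis by (simp add: diff_divide_distrib)
    qed
    have "?s \<longlonglongrightarrow> z"
    proof (rule tendsto_sandwich)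
      show "\<forall>\<^sub>F n in sequentially. z - 1 / real (Suc n) \<le> ?s n" using ge by simp
      show "\<forall>\<^sub>F n in sequentially. ?s n \<le> z" using lt by (simp add: less_imp_le)
      show "(\<lambda>n. z - 1 / real (Suc n)) \<longlonglongrightarrow> z"
        using tendsto_diff[OF tendsto_const LIMSEQ_inverse_real_of_nat, of z] by (simp add: divide_inverse)
    qed simp
    then have "filterlim ?s (at_left z) sequentially"
      using lt unfolding filterlim_at by (intro conjI always_eventually allI) (simp_all add: less_imp_neq)
    from filterlim_compose[OF assms this] False show ?thesis by simp
  qed (simp add: left_lim_def)
qed

lemma left_lim_real_of_nat:
  fixes q :: "real \<Rightarrow> nat"
  assumes "cadlag q"
  shows "0 < z \<Longrightarrow> ((\<lambda>s. real (q s)) \<longlongrightarrow> left_lim (\<lambda>s. real (q s)) z) (at_left z)"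
    and "left_lim (\<lambda>s. real (q s)) z = real (left_lim q z)"
proof -
  have lim: "((\<lambda>s. real (q s)) \<longlongrightarrow> real (left_lim q z)) (at_left z)" if "0 < z"
    using cadlag_left_lim[OF assms that] unfolding tendsto_discrete
    by (intro tendsto_eventually) (auto elim: eventually_mono)
  show eq: "left_lim (\<lambda>s. real (q s)) z = real (left_lim q z)"
    using tendsto_Lim[OF _ lim] by (auto simp: left_lim_def)
  show "0 < z \<Longrightarrow> ((\<lambda>s. real (q s)) \<longlongrightarrow> left_lim (\<lambda>s. real (q s)) z) (at_left z)"
    using lim by (simp add: eq)
qed

lemma left_lim_mem_closed:
  fixes f :: "real \<Rightarrow> 'a::t2_space"
  assumes "(f \<longlongrightarrow> left_lim f z) (at_left z)" "closed S" "s < z"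
    and "\<And>y. s < y \<Longrightarrow> y < z \<Longrightarrow> f y \<in> S"
  shows "left_lim f z \<in> S"
proof (rule Lim_in_closed_set[OF assms(2) _ _ assms(1)])
  show "\<forall>\<^sub>F y in at_left z. f y \<in> S"
    unfolding eventually_at_left_field using assms(3,4) by auto
qed simp

text \<open>The service marks that remove a customer: those below the rate at an instant at which the queue is
  not empty.\<close>

definition served :: "(real \<Rightarrow> nat) \<Rightarrow> (real \<Rightarrow> real) \<Rightarrow> real set \<Rightarrow> (real \<times> real) set" where
  "served q \<rho> T = {(u, z). 0 \<le> u \<and> u \<le> \<rho> z \<and> z \<in> T \<and> 0 < left_lim q z}"

definition marks_below :: "(real \<Rightarrow> real) \<Rightarrow> real set \<Rightarrow> (real \<times> real) set" where
  "marks_below \<rho> T = {(u, z). 0 \<le> u \<and> u \<le> \<rho> z \<and> z \<in> T}"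

text \<open>The equation of a single queue when the service rate is a prescribed function of time.\<close>

definition queue_path :: "real measure \<Rightarrow> (real \<times> real) measure \<Rightarrow> (real \<Rightarrow> real) \<Rightarrow> (real \<Rightarrow> nat) \<Rightarrow> bool" where
  "queue_path \<alpha> \<delta> \<rho> q \<longleftrightarrow> cadlag q \<and> (\<forall>t\<ge>0. real (q t) = real (q 0) + measure \<alpha> {0..t}
      - (\<integral>(u, z). indicat_real {0..t} z * of_bool (left_lim q z > 0) * of_bool (u \<le> \<rho> z) \<partial>\<delta>))"

definition integer_valued :: "'a measure \<Rightarrow> 'a measure \<Rightarrow> bool" where
  "integer_valued \<nu> X \<longleftrightarrow> sets X = sets \<nu> \<and> (\<forall>S\<in>sets \<nu>. emeasure X S \<in> insert \<infinity> (range of_nat))"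

text \<open>Sets of infinite measure get the count \<open>0\<close>.\<close>

definition ncount :: "'a measure \<Rightarrow> 'a set \<Rightarrow> nat" where
  "ncount X S = nat \<lfloor>measure X S\<rfloor>"

lemma ncount_eq: "emeasure X S = of_nat k \<Longrightarrow> ncount X S = k"
  by (simp add: ncount_def measure_def)

lemma integer_valued_count:
  assumes "integer_valued \<nu> X" "S \<in> sets \<nu>" "emeasure X S < \<infinity>"
  shows "emeasure X S = of_nat (ncount X S)" "measure X S = real (ncount X S)"
  using assms by (auto simp: integer_valued_def ncount_def measure_def)

lemma marks_below_subset:
  assumes "\<And>z. z \<in> T \<Longrightarrow> \<rho> z \<le> K"
  shows "marks_below \<rho> T \<subseteq> {0..K} \<times> T"
  unfolding marks_below_def by (auto intro: order_trans[OF _ assms])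

lemma served_subset_marks_below: "served q \<rho> T \<subseteq> marks_below \<rho> T"
  by (auto simp: served_def marks_below_def)

lemma marks_below_sets:
  assumes "\<rho> \<in> borel_measurable borel" "T \<in> sets borel" "T \<subseteq> {0..}"
  shows "marks_below \<rho> T \<in> sets departure_intensity"
proof -
  have [measurable]: "\<rho> \<in> borel_measurable borel" "T \<in> sets borel" by fact+
  have "{x \<in> space (borel \<Otimes>\<^sub>M borel). 0 \<le> fst x \<and> fst x \<le> \<rho> (snd x) \<and> snd x \<in> T} \<in> sets (borel \<Otimes>\<^sub>M (borel :: real measure))"
    by measurable
  also have "{x \<in> space (borel \<Otimes>\<^sub>M borel). 0 \<le> fst x \<and> fst x \<le> \<rho> (snd x) \<and> snd x \<in> T} = marks_below \<rho> T"
    by (auto simp: marks_below_def space_pair_measure)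
  finally have "marks_below \<rho> T \<in> sets borel" by (simp only: borel_prod)
  then show ?thesis using assms by (auto simp: sets_departure_intensity marks_below_def)
qed

lemma served_sets:
  assumes "cadlag q" "\<rho> \<in> borel_measurable borel" "T \<in> sets borel" "T \<subseteq> {0..}"
  shows "served q \<rho> T \<in> sets departure_intensity"
proof -
  have "left_lim (\<lambda>s. real (q s)) \<in> borel_measurable borel"
    by (intro borel_measurable_left_lim left_lim_real_of_nat(1) assms(1))
  from measurable_sets[OF this, of "{0<..}"] have "{z. 0 < left_lim q z} \<in> sets borel"
    by (simp add: vimage_def left_lim_real_of_nat(2)[OF assms(1)])
  then have "T \<inter> {z. 0 < left_lim q z} \<in> sets borel" using assms by auto
  from marks_below_sets[OF assms(2) this] assms(4)
  have "marks_below \<rho> (T \<inter> {z. 0 < left_lim q z}) \<in> sets departure_intensity" by auto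
  also have "marks_below \<rho> (T \<inter> {z. 0 < left_lim q z}) = served q \<rho> T"
    by (auto simp: marks_below_def served_def)
  finally show ?thesis .
qed

lemma served_integral:
  assumes "sets \<delta> = sets departure_intensity" "cadlag q" "\<rho> \<in> borel_measurable borel"
  shows "(\<integral>(u, z). indicat_real {0..t} z * of_bool (left_lim q z > 0) * of_bool (u \<le> \<rho> z) \<partial>\<delta>)
    = measure \<delta> (served q \<rho> {0..t})"
proof -
  have sp: "space \<delta> = {0..} \<times> {0..}"
    using sets_eq_imp_space_eq[OF assms(1)] by (simp add: departure_intensity_def space_restrict_space)
  have "(\<integral>(u, z). indicat_real {0..t} z * of_bool (left_lim q z > 0) * of_bool (u \<le> \<rho> z) \<partial>\<delta>)
     = (\<integral>x. indicat_real (served q \<rho> {0..t}) x \<partial>\<delta>)"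
  proof (intro Bochner_Integration.integral_cong refl)
    fix x assume "x \<in> space \<delta>"
    then obtain u z where x: "x = (u, z)" "0 \<le> u" "0 \<le> z" by (auto simp: sp)
    then show "(case x of (u, z) \<Rightarrow> indicat_real {0..t} z * of_bool (left_lim q z > 0) * of_bool (u \<le> \<rho> z))
        = indicat_real (served q \<rho> {0..t}) x"
      by (cases "0 < left_lim q z"; cases "u \<le> \<rho> z"; simp add: served_def indicator_def)
  qed
  also have "\<dots> = measure \<delta> (served q \<rho> {0..t} \<inter> space \<delta>)" by simp
  also have "served q \<rho> {0..t} \<inter> space \<delta> = served q \<rho> {0..t}" by (auto simp: served_def sp)
  finally show ?thesis .
qed

lemma queue_path_increment:
  assumes path: "queue_path \<alpha> \<delta> \<rho> q"
    and sets: "sets \<alpha> = sets (arrival_intensity lam)" "sets \<delta> = sets departure_intensity"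
    and rho: "\<rho> \<in> borel_measurable borel" "\<And>z. 0 \<le> z \<Longrightarrow> z \<le> t \<Longrightarrow> \<rho> z \<le> K"
    and fin: "emeasure \<alpha> {0..t} < \<infinity>" "emeasure \<delta> ({0..K} \<times> {0..t}) < \<infinity>"
    and st: "0 \<le> s" "s \<le> t"
  shows "real (q t) = real (q s) + measure \<alpha> {s<..t} - measure \<delta> (served q \<rho> {s<..t})"
proof -
  have cad: "cadlag q" using path by (simp add: queue_path_def)
  have q: "real (q z) = real (q 0) + measure \<alpha> {0..z} - measure \<delta> (served q \<rho> {0..z})" if "0 \<le> z" for z
    using path that unfolding queue_path_def served_integral[OF sets(2) cad rho(1)] by blast
  have sub: "{0..s} \<subseteq> {0..t}" "{s<..t} \<subseteq> {0..t}" using st by auto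
  have sv: "served q \<rho> T \<in> sets \<delta>" if "T \<in> sets borel" "T \<subseteq> {0..}" for T
    using served_sets[OF cad rho(1) that] sets(2) by simp
  have "measure \<alpha> ({0..s} \<union> {s<..t}) = measure \<alpha> {0..s} + measure \<alpha> {s<..t}"
  proof (rule measure_Union)
    have le: "emeasure \<alpha> S < \<infinity>" if "S \<subseteq> {0..t}" for S
    proof -
      have "emeasure \<alpha> S \<le> emeasure \<alpha> {0..t}"
        using that by (intro emeasure_mono) (auto simp: sets sets_arrival_intensity)
      then show ?thesis using fin(1) by (rule order.strict_trans1)
    qed
    show "emeasure \<alpha> {0..s} \<noteq> \<infinity>" "emeasure \<alpha> {s<..t} \<noteq> \<infinity>"
      using less_imp_neq[OF le[OF sub(1)]] less_imp_neq[OF le[OF sub(2)]] .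
  qed (use st in \<open>auto simp: sets sets_arrival_intensity\<close>)
  moreover have "{0..s} \<union> {s<..t} = {0..t}" using st by auto
  moreover have "measure \<delta> (served q \<rho> {0..s} \<union> served q \<rho> {s<..t})
      = measure \<delta> (served q \<rho> {0..s}) + measure \<delta> (served q \<rho> {s<..t})"
  proof (rule measure_Union)
    have le: "emeasure \<delta> (served q \<rho> T) < \<infinity>" if "T \<subseteq> {0..t}" for T
    proof -
      have "marks_below \<rho> T \<subseteq> {0..K} \<times> T"
        using rho(2) that by (intro marks_below_subset) auto
      then have "served q \<rho> T \<subseteq> {0..K} \<times> {0..t}"
        using served_subset_marks_below[of q \<rho> T] that by blast
      then have "emeasure \<delta> (served q \<rho> T) \<le> emeasure \<delta> ({0..K} \<times> {0..t})"
        by (intro emeasure_mono) (auto simp: sets intro!: Times_in_sets_departure)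
      then show ?thesis using fin(2) by (rule order.strict_trans1)
    qed
    show "emeasure \<delta> (served q \<rho> {0..s}) \<noteq> \<infinity>" "emeasure \<delta> (served q \<rho> {s<..t}) \<noteq> \<infinity>"
      using less_imp_neq[OF le[OF sub(1)]] less_imp_neq[OF le[OF sub(2)]] .
    show "served q \<rho> {0..s} \<in> sets \<delta>" "served q \<rho> {s<..t} \<in> sets \<delta>"
      using st by (auto intro!: sv)
    show "served q \<rho> {0..s} \<inter> served q \<rho> {s<..t} = {}"
      by (auto simp: served_def)
  qed
  moreover have "served q \<rho> {0..s} \<union> served q \<rho> {s<..t} = served q \<rho> {0..t}"
    using st by (auto simp: served_def)
  ultimately show ?thesis using q[of s] q[of t] st by simp
qed

text \<open>If a cell contains a single point, its position is irrelevant.  The only case that needs an argument is one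
  service mark and a positive queue: were the mark not served, the queue would be constant and positive
  on the whole cell, and so the mark would be served.\<close>

lemma queue_path_cell_step:
  assumes path: "queue_path \<alpha> \<delta> \<rho> q"
    and \<alpha>: "integer_valued (arrival_intensity lam) \<alpha>" and \<delta>: "integer_valued departure_intensity \<delta>"
    and rho: "\<rho> \<in> borel_measurable borel" "\<And>z. 0 \<le> z \<Longrightarrow> z \<le> t \<Longrightarrow> \<rho> z \<le> K" and r: "0 \<le> r" "r \<le> K"
    and fin: "emeasure \<alpha> {0..t} < \<infinity>" "emeasure \<delta> ({0..K} \<times> {0..t}) < \<infinity>"
    and st: "0 \<le> s" "s < t"
    and one: "emeasure \<alpha> {s<..t} + emeasure \<delta> ({0..K} \<times> {s<..t}) \<le> 1"
    and same: "emeasure \<delta> (marks_below \<rho> {s<..t}) = emeasure \<delta> ({0..r} \<times> {s<..t})"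
  shows "q t = queue_step (q s) (ncount \<alpha> {s<..t}, ncount \<delta> ({0..r} \<times> {s<..t}))"
proof -
  have cad: "cadlag q" using path by (simp add: queue_path_def)
  have sets: "sets \<alpha> = sets (arrival_intensity lam)" "sets \<delta> = sets departure_intensity"
    using \<alpha> \<delta> by (auto simp: integer_valued_def)
  define a where "a = ncount \<alpha> {s<..t}"
  define b where "b = ncount \<delta> ({0..K} \<times> {s<..t})"
  define d where "d = ncount \<delta> ({0..r} \<times> {s<..t})"
  have A_in: "{s<..z} \<in> sets (arrival_intensity lam)" for z
    using st by (auto simp: sets_arrival_intensity)
  have R_in: "{0..c} \<times> {s<..z} \<in> sets departure_intensity" for c z
    using st by (intro Times_in_sets_departure) auto
  have m_in: "marks_below \<rho> {s<..t} \<in> sets departure_intensity"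
    using st by (intro marks_below_sets rho) auto
  have s_in: "served q \<rho> {s<..z} \<in> sets departure_intensity" for z
    using st by (intro served_sets cad rho) auto
  have sm: "served q \<rho> {s<..z} \<subseteq> marks_below \<rho> {s<..z}" for z
    by (rule served_subset_marks_below)
  have mR: "marks_below \<rho> {s<..t} \<subseteq> {0..K} \<times> {s<..t}"
    using rho(2) st by (intro marks_below_subset) auto
  have lt: "emeasure \<alpha> {s<..t} < \<infinity>" "emeasure \<delta> ({0..K} \<times> {s<..t}) < \<infinity>"
  proof -
    have "emeasure \<alpha> {s<..t} \<le> 1"
      by (rule order_trans[OF _ one]) (rule add_increasing2[OF zero_le order_refl])
    moreover have "emeasure \<delta> ({0..K} \<times> {s<..t}) \<le> 1"
      by (rule order_trans[OF _ one]) (rule add_increasing[OF zero_le order_refl])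
    ultimately show "emeasure \<alpha> {s<..t} < \<infinity>" "emeasure \<delta> ({0..K} \<times> {s<..t}) < \<infinity>"
      by (auto intro: order.strict_trans1)
  qed
  have lt': "emeasure \<delta> S < \<infinity>" if "S \<subseteq> {0..K} \<times> {s<..t}" for S
    using emeasure_mono[OF that, of \<delta>] lt(2) R_in sets by (auto intro: order.strict_trans1)
  have ab: "a + b \<le> 1"
  proof -
    have "emeasure \<alpha> {s<..t} = of_nat a" "emeasure \<delta> ({0..K} \<times> {s<..t}) = of_nat b"
      unfolding a_def b_def
      using integer_valued_count(1)[OF \<alpha> A_in lt(1)] integer_valued_count(1)[OF \<delta> R_in lt(2)] .
    then have "(of_nat (a + b) :: ennreal) \<le> of_nat 1"
      using one by (simp only: of_nat_add of_nat_1)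
    then show ?thesis by (simp only: of_nat_le_iff)
  qed
  have meas_a: "measure \<alpha> {s<..t} = a"
    using integer_valued_count(2)[OF \<alpha> A_in lt(1)] by (simp add: a_def)
  have meas_b: "measure \<delta> ({0..K} \<times> {s<..t}) = b"
    using integer_valued_count(2)[OF \<delta> R_in lt(2)] by (simp add: b_def)
  have sub_r: "{0..r} \<times> {s<..t} \<subseteq> {0..K} \<times> {s<..t}" using r by auto
  have meas_d: "measure \<delta> ({0..r} \<times> {s<..t}) = d"
    using integer_valued_count(2)[OF \<delta> R_in lt'[OF sub_r]] by (simp add: d_def)
  have meas_m: "measure \<delta> (marks_below \<rho> {s<..t}) = d"
    using same meas_d by (simp add: measure_def)
  have mono: "measure \<delta> S \<le> measure \<delta> T" if "S \<subseteq> T" "S \<in> sets \<delta>" "T \<in> sets \<delta>" "T \<subseteq> {0..K} \<times> {s<..t}" for S T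
    using lt'[OF that(4)] that by (intro measure_mono_fmeasurable) (auto simp: fmeasurable_def)
  have d_le: "d \<le> b"
    using mono[OF sub_r] R_in sets meas_b meas_d by auto
  have inc: "real (q z) = real (q s) + measure \<alpha> {s<..z} - measure \<delta> (served q \<rho> {s<..z})"
    if "s \<le> z" "z \<le> t" for z
  proof (rule queue_path_increment[OF path sets rho(1) _ _ _ st(1) that(1)])
    show "\<rho> y \<le> K" if "0 \<le> y" "y \<le> z" for y using rho(2)[of y] that \<open>z \<le> t\<close> by simp
    have "emeasure \<alpha> {0..z} \<le> emeasure \<alpha> {0..t}"
      using that by (intro emeasure_mono) (auto simp: sets sets_arrival_intensity)
    then show "emeasure \<alpha> {0..z} < \<infinity>" using fin(1) by (rule order.strict_trans1)
    have "emeasure \<delta> ({0..K} \<times> {0..z}) \<le> emeasure \<delta> ({0..K} \<times> {0..t})"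
      using that by (intro emeasure_mono) (auto simp: sets intro!: Times_in_sets_departure)
    then show "emeasure \<delta> ({0..K} \<times> {0..z}) < \<infinity>" using fin(2) by (rule order.strict_trans1)
  qed
  have sv_mono: "measure \<delta> (served q \<rho> {s<..z}) \<le> measure \<delta> (served q \<rho> {s<..t})" if "z \<le> t" for z
    using that s_in sm[of t] mR sets by (intro mono) (auto simp: served_def)
  have sv_d: "measure \<delta> (served q \<rho> {s<..t}) \<le> d"
    using mono[OF sm[of t]] s_in m_in mR sets meas_m by auto
  have sv_nat: "measure \<delta> (served q \<rho> {s<..t}) = ncount \<delta> (served q \<rho> {s<..t})"
    using sm[of t] mR by (intro integer_valued_count(2)[OF \<delta> s_in lt']) auto
  have inc_t: "real (q t) = real (q s) + real a - real (ncount \<delta> (served q \<rho> {s<..t}))"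
    using inc[of t] st meas_a sv_nat by simp
  consider "b = 0" | "b = 1" "a = 0" "d = 0" | "b = 1" "a = 0" "d = 1"
    using ab d_le by linarith
  then have "q t = queue_step (q s) (a, d)"
  proof cases
    case 1
    then have "d = 0" "measure \<delta> (served q \<rho> {s<..t}) = 0"
      using d_le sv_d by (auto intro: antisym)
    with inc_t sv_nat have "q t = q s + a" by simp
    then show ?thesis using ab \<open>d = 0\<close> by (cases "a = 0") (auto simp: queue_step_def)
  next
    case 2
    then have "q t = q s" using inc_t sv_d sv_nat by simp
    then show ?thesis using 2 by (simp add: queue_step_def)
  next
    case 3
    have a0: "measure \<alpha> {s<..z} = 0" if "z \<le> t" for z
    proof -
      have "measure \<alpha> {s<..z} \<le> measure \<alpha> {s<..t}"
        using lt(1) A_in that by (intro measure_mono_fmeasurable) (auto simp: fmeasurable_def sets)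
      then show ?thesis using meas_a 3 by (simp add: measure_le_0_iff)
    qed
    show ?thesis
    proof (cases "q s = 0")
      case True
      then show ?thesis using inc_t 3 by (simp add: queue_step_def)
    next
      case False
      have "ncount \<delta> (served q \<rho> {s<..t}) = 1"
      proof (rule ccontr)
        assume "ncount \<delta> (served q \<rho> {s<..t}) \<noteq> 1"
        then have z0: "measure \<delta> (served q \<rho> {s<..t}) = 0"
          using sv_d sv_nat 3 by simp
        \<comment> \<open>no service at all means a constant positive queue, and that would have served the mark\<close>
        have const: "q z = q s" if "s \<le> z" "z \<le> t" for z
          using inc[OF that] a0[OF that(2)] sv_mono[OF that(2)] z0 by (simp add: measure_le_0_iff)
        have "left_lim q z = q s" if "s < z" "z \<le> t" for z
        proof -
          have "left_lim q z \<in> {q s}"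
          proof (rule left_lim_mem_closed[OF cadlag_left_lim[OF cad] _ that(1)])
            show "0 < z" using st that by simp
            show "q y \<in> {q s}" if "s < y" "y < z" for y
              using const[of y] that \<open>z \<le> t\<close> by (simp only: singleton_iff)
          qed simp
          then show ?thesis by simp
        qed
        then have "served q \<rho> {s<..t} = marks_below \<rho> {s<..t}"
          using False by (auto simp: served_def marks_below_def)
        then show False using z0 meas_m 3 by simp
      qed
      then show ?thesis using inc_t 3 False by (simp add: queue_step_def)
    qed
  qed
  then show ?thesis by (simp add: a_def d_def)
qed

definition cell :: "real \<Rightarrow> nat \<Rightarrow> nat \<Rightarrow> real set" where
  "cell t n k = {real k * t / real n <.. real (Suc k) * t / real n}"

definition cell_counts :: "real measure \<Rightarrow> (real \<times> real) measure \<Rightarrow> real \<Rightarrow> real \<Rightarrow> nat \<Rightarrow> nat \<Rightarrow> nat \<times> nat" where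
  "cell_counts \<alpha> \<delta> r t n k = (ncount \<alpha> (cell t n k), ncount \<delta> ({0..r} \<times> cell t n k))"

text \<open>The marks on which the rates \<open>\<rho>\<close> and \<open>r\<close> disagree lie in the rectangle of half-width \<open>\<epsilon>\<close> around \<open>r\<close> after
  time \<open>T0\<close>.  If it is empty, the counts for the constant rate \<open>r\<close> determine the path at the grid points.\<close>

lemma queue_path_eq_walk:
  assumes path: "queue_path \<alpha> \<delta> \<rho> q"
    and \<alpha>: "integer_valued (arrival_intensity lam) \<alpha>" and \<delta>: "integer_valued departure_intensity \<delta>"
    and rho: "\<rho> \<in> borel_measurable borel" "\<And>z. 0 \<le> z \<Longrightarrow> z \<le> t \<Longrightarrow> \<rho> z \<le> K" and r: "0 \<le> r" "r \<le> K"
    and fin: "emeasure \<alpha> {0..t} < \<infinity>" "emeasure \<delta> ({0..K} \<times> {0..t}) < \<infinity>"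
    and t: "0 < t" "0 < n"
    and one: "\<And>k. k < n \<Longrightarrow> emeasure \<alpha> (cell t n k) + emeasure \<delta> ({0..K} \<times> cell t n k) \<le> 1"
    and near: "\<And>z. 0 \<le> z \<Longrightarrow> z \<le> T0 \<Longrightarrow> \<rho> z = r" "\<And>z. 0 \<le> z \<Longrightarrow> z \<le> t \<Longrightarrow> \<bar>\<rho> z - r\<bar> \<le> \<epsilon>" "0 \<le> T0"
    and none: "emeasure \<delta> ({max 0 (r - \<epsilon>)..r + \<epsilon>} \<times> {T0<..t}) = 0"
  shows "q t = walk (q 0) (cell_counts \<alpha> \<delta> r t n) n"
proof -
  have "q (real k * t / real n) = walk (q 0) (cell_counts \<alpha> \<delta> r t n) k" if "k \<le> n" for k
    using that
  proof (induction k)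
    case (Suc k)
    let ?s = "real k * t / real n" and ?t = "real (Suc k) * t / real n"
    have t': "?t \<le> t" using Suc.prems t by (simp add: divide_le_eq mult.commute)
    have s: "0 \<le> ?s" "?s < ?t" using t by (auto simp: divide_strict_right_mono)
    have sets: "sets \<alpha> = sets (arrival_intensity lam)" "sets \<delta> = sets departure_intensity"
      using \<alpha> \<delta> by (auto simp: integer_valued_def)
    have "emeasure \<delta> (marks_below \<rho> {?s<..?t}) = emeasure \<delta> ({0..r} \<times> {?s<..?t})"
    proof (rule emeasure_eq_AE)
      let ?R = "{max 0 (r - \<epsilon>)..r + \<epsilon>} \<times> {T0<..t}"
      have "?R \<in> sets \<delta>"
        using near(3) by (auto simp: sets intro!: Times_in_sets_departure)
      then have "AE x in \<delta>. x \<notin> ?R" using none by (intro AE_not_in) (simp add: null_sets_def)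
      then show "AE x in \<delta>. x \<in> marks_below \<rho> {?s<..?t} \<longleftrightarrow> x \<in> {0..r} \<times> {?s<..?t}"
      proof eventually_elim
        case (elim x)
        obtain u z where x: "x = (u, z)" by (cases x)
        show ?case
        proof (cases "0 \<le> z \<and> z \<le> t")
          case True
          then have "z \<le> T0 \<Longrightarrow> \<rho> z = r" "\<bar>\<rho> z - r\<bar> \<le> \<epsilon>" using near by auto
          then show ?thesis using elim True by (cases "z \<le> T0") (auto simp: x marks_below_def)
        next
          case False
          then show ?thesis using s t' by (auto simp: x marks_below_def)
        qed
      qed
    qed (use s in \<open>auto simp: sets intro!: marks_below_sets rho Times_in_sets_departure\<close>)
    then have "q ?t = queue_step (q ?s) (ncount \<alpha> {?s<..?t}, ncount \<delta> ({0..r} \<times> {?s<..?t}))"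
    proof (intro queue_path_cell_step[OF path \<alpha> \<delta> rho(1) _ r _ _ s])
      show "\<rho> y \<le> K" if "0 \<le> y" "y \<le> ?t" for y using rho(2)[of y] that t' by simp
      have "emeasure \<alpha> {0..?t} \<le> emeasure \<alpha> {0..t}"
        using t' by (intro emeasure_mono) (auto simp: sets sets_arrival_intensity)
      then show "emeasure \<alpha> {0..?t} < \<infinity>" using fin(1) by (rule order.strict_trans1)
      have "emeasure \<delta> ({0..K} \<times> {0..?t}) \<le> emeasure \<delta> ({0..K} \<times> {0..t})"
        using t' by (intro emeasure_mono) (auto simp: sets intro!: Times_in_sets_departure)
      then show "emeasure \<delta> ({0..K} \<times> {0..?t}) < \<infinity>" using fin(2) by (rule order.strict_trans1)
      show "emeasure \<alpha> {?s<..?t} + emeasure \<delta> ({0..K} \<times> {?s<..?t}) \<le> 1"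
        using one[of k] Suc.prems by (simp add: cell_def)
    qed
    then show ?case using Suc by (simp add: cell_counts_def cell_def)
  qed simp
  from this[of n] t show ?thesis by simp
qed

section \<open>Poisson noise on a grid\<close>

lemma measure_arrival_intensity:
  assumes "0 \<le> s" "s \<le> t" "0 < lam"
  shows "emeasure (arrival_intensity lam) {s<..t} = ennreal (lam * (t - s))"
    and "emeasure (arrival_intensity lam) {s..t} = ennreal (lam * (t - s))"
proof -
  have *: "emeasure (arrival_intensity lam) S = ennreal lam * emeasure lborel S"
    if "S \<in> sets borel" "S \<subseteq> {0..}" for S
  proof -
    have "emeasure (restrict_space lborel {0..}) S = emeasure lborel S"
      using that by (intro emeasure_restrict_space) auto
    then show ?thesis
      using that by (simp add: arrival_intensity_def)
  qed
  show "emeasure (arrival_intensity lam) {s<..t} = ennreal (lam * (t - s))"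
    "emeasure (arrival_intensity lam) {s..t} = ennreal (lam * (t - s))"
    using assms by (subst *; auto simp: ennreal_mult')+
qed

lemma emeasure_departure_intensity:
  fixes S T :: "real set"
  assumes "S \<in> sets borel" "T \<in> sets borel" "S \<subseteq> {0..}" "T \<subseteq> {0..}"
  shows "emeasure departure_intensity (S \<times> T) = emeasure lborel S * emeasure lborel T"
proof -
  have "emeasure departure_intensity (S \<times> T) = emeasure lborel (S \<times> T)"
    unfolding departure_intensity_def
    using assms by (intro emeasure_restrict_space) (auto simp: closed_Times)
  also have "\<dots> = emeasure (lborel \<Otimes>\<^sub>M lborel) (S \<times> T)" by (simp only: lborel_prod)
  also have "\<dots> = emeasure lborel S * emeasure lborel T"
    using assms by (intro lborel.emeasure_pair_measure_Times) auto
  finally show ?thesis .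
qed

lemma poisson_random_measure_integer_valued:
  "poisson_random_measure M \<nu> X \<Longrightarrow> \<omega> \<in> space M \<Longrightarrow> integer_valued \<nu> (X \<omega>)"
  by (auto simp: poisson_random_measure_def integer_valued_def)

lemma poisson_random_measure_measurable:
  "poisson_random_measure M \<nu> X \<Longrightarrow> S \<in> sets \<nu> \<Longrightarrow> (\<lambda>\<omega>. emeasure (X \<omega>) S) \<in> borel_measurable M"
  by (auto simp: poisson_random_measure_def)

lemma random_measure_eventsI:
  assumes "S \<in> sets \<nu>"
  shows "{\<omega> \<in> space M. emeasure (X \<omega>) S = c} \<in> random_measure_events M \<nu> X"
proof -
  have "{\<omega> \<in> space M. emeasure (X \<omega>) S = c} = (\<lambda>\<omega>. emeasure (X \<omega>) S) -` {c} \<inter> space M" by auto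
  moreover have "(\<lambda>\<omega>. emeasure (X \<omega>) S) -` {c} \<inter> space M
      \<in> {(\<lambda>\<omega>. emeasure (X \<omega>) S) -` T \<inter> space M |S T. S \<in> sets \<nu> \<and> T \<in> sets borel}"
    using assms by (intro CollectI exI[of _ S] exI[of _ "{c}"]) simp
  ultimately show ?thesis
    unfolding random_measure_events_def by (simp only: sigma_sets.Basic)
qed

lemma poisson_random_measure_prob:
  assumes "poisson_random_measure M \<nu> X" "S \<in> sets \<nu>" "emeasure \<nu> S < \<infinity>"
  shows "measure M {\<omega>\<in>space M. emeasure (X \<omega>) S = of_nat k}
    = measure \<nu> S ^ k / fact k * exp (- measure \<nu> S)"
  using assms by (auto simp: poisson_random_measure_def)

lemma poisson_random_measure_nonzero_le:
  assumes "prob_space M" "poisson_random_measure M \<nu> X" "S \<in> sets \<nu>" "emeasure \<nu> S < \<infinity>"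
  shows "measure M {\<omega>\<in>space M. emeasure (X \<omega>) S \<noteq> 0} \<le> measure \<nu> S"
proof -
  interpret prob_space M by fact
  note [measurable] = poisson_random_measure_measurable[OF assms(2,3)]
  have "prob {\<omega>\<in>space M. emeasure (X \<omega>) S \<noteq> 0} = 1 - prob {\<omega>\<in>space M. emeasure (X \<omega>) S = 0}"
    by (rule prob_neg) measurable
  also have "prob {\<omega>\<in>space M. emeasure (X \<omega>) S = 0} = exp (- measure \<nu> S)"
    using poisson_random_measure_prob[OF assms(2-4), of 0] by simp
  also have "1 - exp (- measure \<nu> S) \<le> measure \<nu> S"
    using exp_ge_add_one_self[of "- measure \<nu> S"] by simp
  finally show ?thesis .
qed

lemma poisson_random_measure_AE_null:
  assumes "prob_space M" "poisson_random_measure M \<nu> X" "S \<in> sets \<nu>" "emeasure \<nu> S = 0"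
  shows "AE \<omega> in M. emeasure (X \<omega>) S = 0"
proof -
  interpret prob_space M by fact
  note [measurable] = poisson_random_measure_measurable[OF assms(2,3)]
  have "prob {\<omega>\<in>space M. emeasure (X \<omega>) S = 0} = 1"
    using poisson_random_measure_prob[OF assms(2,3), of 0] assms(4) by (simp add: measure_def)
  then show ?thesis by (subst (asm) prob_Collect_eq_1) auto
qed

text \<open>The Poisson weights of the finite counts already add up to \<open>1\<close>.\<close>

lemma poisson_random_measure_AE_finite:
  assumes "prob_space M" "poisson_random_measure M \<nu> X" "S \<in> sets \<nu>" "emeasure \<nu> S < \<infinity>"
  shows "AE \<omega> in M. emeasure (X \<omega>) S < \<infinity>"
proof -
  interpret prob_space M by fact
  note [measurable] = poisson_random_measure_measurable[OF assms(2,3)]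
  let ?m = "measure \<nu> S"
  let ?A = "\<lambda>k::nat. {\<omega>\<in>space M. emeasure (X \<omega>) S = of_nat k}"
  have "(\<lambda>k. prob (?A k)) sums prob (\<Union>k. ?A k)"
    by (rule finite_measure_UNION) (auto simp: disjoint_family_on_def)
  moreover have "(\<lambda>k. prob (?A k)) sums 1"
  proof -
    have "(\<lambda>k. ?m ^ k / fact k * exp (- ?m)) sums (exp ?m * exp (- ?m))"
      using exp_converges[of ?m] by (intro sums_mult2) (simp add: divide_inverse mult.commute)
    then show ?thesis
      by (simp add: poisson_random_measure_prob[OF assms(2-4)] exp_minus)
  qed
  ultimately have 1: "prob (\<Union>k. ?A k) = 1" by (rule sums_unique2)
  have "AE \<omega> in M. \<omega> \<in> (\<Union>k. ?A k)"
    using prob_eq_1[of "\<Union>k. ?A k"] 1 by auto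
  then show ?thesis by eventually_elim (auto simp: of_nat_less_top)
qed

lemma poisson_random_measure_indep_counts:
  assumes "prob_space M" "poisson_random_measure M \<nu> X"
    and I: "finite I" "I \<noteq> {}" and S: "inj_on S I" "\<And>i. i \<in> I \<Longrightarrow> S i \<in> sets \<nu>"
      "\<And>i. i \<in> I \<Longrightarrow> emeasure \<nu> (S i) < \<infinity>" "disjoint (S ` I)"
  shows "measure M {\<omega>\<in>space M. \<forall>i\<in>I. emeasure (X \<omega>) (S i) = of_nat (v i)}
    = (\<Prod>i\<in>I. measure \<nu> (S i) ^ v i / fact (v i) * exp (- measure \<nu> (S i)))"
proof -
  interpret prob_space M by fact
  define w where "w = (\<lambda>s. of_nat (v (the_inv_into I S s)) :: ennreal)"
  have w: "w (S i) = of_nat (v i)" if "i \<in> I" for i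
    using that S(1) by (simp add: w_def the_inv_into_f_f)
  have "S ` I \<subseteq> sets \<nu>" using S by auto
  then have ind: "indep_vars (\<lambda>_. borel) (\<lambda>S \<omega>. emeasure (X \<omega>) S) (S ` I)"
    using assms(2) I S(4) by (auto simp: poisson_random_measure_def)
  have "{\<omega>\<in>space M. \<forall>i\<in>I. emeasure (X \<omega>) (S i) = of_nat (v i)}
      = (\<Inter>s\<in>S ` I. (\<lambda>\<omega>. emeasure (X \<omega>) s) -` {w s} \<inter> space M)"
    using I(2) w by auto
  also have "prob \<dots> = (\<Prod>s\<in>S ` I. prob ((\<lambda>\<omega>. emeasure (X \<omega>) s) -` {w s} \<inter> space M))"
    using I by (intro indep_varsD[OF ind]) auto
  also have "\<dots> = (\<Prod>i\<in>I. prob ((\<lambda>\<omega>. emeasure (X \<omega>) (S i)) -` {w (S i)} \<inter> space M))"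
    by (simp add: prod.reindex[OF S(1)])
  also have "\<dots> = (\<Prod>i\<in>I. measure \<nu> (S i) ^ v i / fact (v i) * exp (- measure \<nu> (S i)))"
  proof (rule prod.cong)
    fix i assume i: "i \<in> I"
    have "(\<lambda>\<omega>. emeasure (X \<omega>) (S i)) -` {w (S i)} \<inter> space M
        = {\<omega>\<in>space M. emeasure (X \<omega>) (S i) = of_nat (v i)}"
      using w[OF i] by auto
    then show "prob ((\<lambda>\<omega>. emeasure (X \<omega>) (S i)) -` {w (S i)} \<inter> space M)
        = measure \<nu> (S i) ^ v i / fact (v i) * exp (- measure \<nu> (S i))"
      using poisson_random_measure_prob[OF assms(2) S(2,3)] i by simp
  qed simp
  finally show ?thesis .
qed

lemma driving_noiseD:
  assumes "driving_noise M N lam A D"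
  shows "prob_space M"
    and "\<And>i. i \<in> {1..N} \<Longrightarrow> poisson_random_measure M (arrival_intensity lam) (A i)"
    and "\<And>i. i \<in> {1..N} \<Longrightarrow> poisson_random_measure M departure_intensity (D i)"
    and "prob_space.indep_sets M
       (case_sum (\<lambda>i. random_measure_events M (arrival_intensity lam) (A i))
                 (\<lambda>i. random_measure_events M departure_intensity (D i))) ({1..N} <+> {1..N})"
  using assms by (auto simp: driving_noise_def)

lemma driving_noise_indep:
  assumes noise: "driving_noise M N lam A D" and J: "J \<subseteq> {1..N}" "J \<noteq> {}"
    and F: "\<And>i. i \<in> J \<Longrightarrow> F i \<in> random_measure_events M (arrival_intensity lam) (A i)"
    and G: "\<And>i. i \<in> J \<Longrightarrow> G i \<in> random_measure_events M departure_intensity (D i)"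
  shows "measure M (\<Inter>i\<in>J. F i \<inter> G i) = (\<Prod>i\<in>J. measure M (F i) * measure M (G i))"
proof -
  interpret prob_space M using noise by (rule driving_noiseD)
  have fin: "finite J" using J finite_subset by auto
  have "(\<Inter>i\<in>J. F i \<inter> G i) = (\<Inter>j\<in>J <+> J. case_sum F G j)" by (simp only: Plus_def INT_Un image_image INT_Int_distrib sum.case)
  also have "prob \<dots> = (\<Prod>j\<in>J <+> J. prob (case_sum F G j))"
    using J F G fin by (intro indep_setsD[OF driving_noiseD(4)[OF noise]]) auto
  also have "\<dots> = (\<Prod>i\<in>J. prob (F i)) * (\<Prod>i\<in>J. prob (G i))"
    using fin by (simp add: prod.Plus o_def)
  finally show ?thesis by (simp add: prod.distrib)
qed

text \<open>The probability of at most one point is \<open>exp (-m) (1 + m) \<ge> (1 - m) (1 + m)\<close>, where \<open>m\<close> is the sum of the two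
  means.\<close>

lemma driving_noise_crowded_le:
  assumes noise: "driving_noise M N lam A D" and i: "i \<in> {1..N}"
    and S: "S \<in> sets (arrival_intensity lam)" "emeasure (arrival_intensity lam) S < \<infinity>"
    and R: "R \<in> sets departure_intensity" "emeasure departure_intensity R < \<infinity>"
  shows "measure M {\<omega>\<in>space M. \<not> emeasure (A i \<omega>) S + emeasure (D i \<omega>) R \<le> 1}
    \<le> (measure (arrival_intensity lam) S + measure departure_intensity R)\<^sup>2"
proof -
  interpret prob_space M using noise by (rule driving_noiseD)
  note PA = driving_noiseD(2)[OF noise i] and PD = driving_noiseD(3)[OF noise i]
  note [measurable] = poisson_random_measure_measurable[OF PA S(1)] poisson_random_measure_measurable[OF PD R(1)]
  let ?a = "measure (arrival_intensity lam) S" and ?b = "measure departure_intensity R"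
  define E where "E = (\<lambda>j k::nat. {\<omega>\<in>space M. emeasure (A i \<omega>) S = of_nat j \<and> emeasure (D i \<omega>) R = of_nat k})"
  have [measurable]: "E j k \<in> events" for j k unfolding E_def by measurable
  have E: "prob (E j k) = (?a ^ j / fact j * exp (- ?a)) * (?b ^ k / fact k * exp (- ?b))" for j k
  proof -
    let ?F = "{\<omega>\<in>space M. emeasure (A i \<omega>) S = of_nat j}" and ?G = "{\<omega>\<in>space M. emeasure (D i \<omega>) R = of_nat k}"
    have "prob (\<Inter>i\<in>{i}. ?F \<inter> ?G) = (\<Prod>i\<in>{i}. prob ?F * prob ?G)"
      using i S R by (intro driving_noise_indep[OF noise]) (simp_all add: random_measure_eventsI)
    moreover have "E j k = ?F \<inter> ?G" by (auto simp: E_def)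
    ultimately show ?thesis
      using poisson_random_measure_prob[OF PA S] poisson_random_measure_prob[OF PD R] by simp
  qed
  have "exp (- ?a) * exp (- ?b) * (1 + (?a + ?b)) = prob (E 0 0) + prob (E 1 0) + prob (E 0 1)"
    unfolding E by (simp add: algebra_simps)
  also have "\<dots> = prob (E 0 0 \<union> E 1 0 \<union> E 0 1)"
  proof -
    have "E 0 0 \<inter> E 1 0 = {}" "(E 0 0 \<union> E 1 0) \<inter> E 0 1 = {}" by (auto simp: E_def)
    then show ?thesis by (simp add: finite_measure_Union)
  qed
  also have "\<dots> \<le> prob {\<omega>\<in>space M. emeasure (A i \<omega>) S + emeasure (D i \<omega>) R \<le> 1}"
    by (intro finite_measure_mono) (auto simp: E_def)
  finally have low: "exp (- ?a) * exp (- ?b) * (1 + (?a + ?b))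
      \<le> prob {\<omega>\<in>space M. emeasure (A i \<omega>) S + emeasure (D i \<omega>) R \<le> 1}" .
  have "1 - (?a + ?b) \<le> exp (- ?a) * exp (- ?b)"
  proof -
    have "exp (- ?a) * exp (- ?b) = exp (- (?a + ?b))" by (simp add: mult_exp_exp)
    then show ?thesis using exp_ge_add_one_self[of "- (?a + ?b)"] by linarith
  qed
  then have "(1 - (?a + ?b)) * (1 + (?a + ?b)) \<le> exp (- ?a) * exp (- ?b) * (1 + (?a + ?b))"
    by (rule mult_right_mono) (simp add: add_nonneg_nonneg)
  with low have "1 - (?a + ?b)\<^sup>2 \<le> prob {\<omega>\<in>space M. emeasure (A i \<omega>) S + emeasure (D i \<omega>) R \<le> 1}"
    by (simp add: power2_eq_square algebra_simps)
  moreover have "prob {\<omega>\<in>space M. \<not> emeasure (A i \<omega>) S + emeasure (D i \<omega>) R \<le> 1}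
      = 1 - prob {\<omega>\<in>space M. emeasure (A i \<omega>) S + emeasure (D i \<omega>) R \<le> 1}"
    by (rule prob_neg) measurable
  ultimately show ?thesis by simp
qed

text \<open>Disjoint events with the weights of a discrete distribution exhaust the space up to a null set; this
  transports the law of finitely many counts to a \<open>pmf\<close>.\<close>

lemma prob_UN_pmf:
  assumes "prob_space M" and G: "\<And>v. v \<in> set_pmf p \<Longrightarrow> G v \<in> sets M" "disjoint_family_on G (set_pmf p)"
    and eq: "\<And>v. v \<in> set_pmf p \<Longrightarrow> measure M (G v) = pmf p v"
  shows "measure M (\<Union>v\<in>S \<inter> set_pmf p. G v) = measure_pmf.prob p S"
proof -
  interpret prob_space M by fact
  have "emeasure M (\<Union>v\<in>S \<inter> set_pmf p. G v) = (\<integral>\<^sup>+v. emeasure M (G v) \<partial>count_space (S \<inter> set_pmf p))"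
    using G by (intro emeasure_UN_countable) (auto simp: disjoint_family_on_def)
  also have "\<dots> = (\<integral>\<^sup>+v. pmf p v \<partial>count_space (S \<inter> set_pmf p))"
    by (intro nn_integral_cong) (auto simp: emeasure_eq_measure eq)
  also have "\<dots> = emeasure p (S \<inter> set_pmf p)" by (rule nn_integral_pmf)
  also have "\<dots> = emeasure p S" by (rule emeasure_Int_set_pmf)
  finally show ?thesis by (simp add: measure_def)
qed

lemma cell_facts:
  assumes "0 < t" "0 < n"
  shows "cell t n k \<in> sets borel" "cell t n k \<subseteq> {0..}" "cell t n k \<noteq> {}"
proof -
  have le: "0 \<le> real k * t / real n" using assms by simp
  have lt: "real k * t / real n < real (Suc k) * t / real n"
    using assms by (intro divide_strict_right_mono mult_strict_right_mono) auto
  show "cell t n k \<in> sets borel" "cell t n k \<subseteq> {0..}" "cell t n k \<noteq> {}"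
    using le lt by (auto simp: cell_def intro: dense)
qed

lemma cell_disjoint:
  assumes "0 < t" "0 < n" "j \<noteq> k"
  shows "cell t n j \<inter> cell t n k = {}"
proof -
  have *: "cell t n j \<inter> cell t n k = {}" if "j < k" for j k
  proof -
    have "real (Suc j) * t / real n \<le> real k * t / real n"
      using that assms by (intro divide_right_mono mult_right_mono) auto
    then show ?thesis by (auto simp: cell_def)
  qed
  show ?thesis using *[of j k] *[of k j] assms(3) by (cases "j < k") auto
qed

lemma emeasure_cell:
  assumes "0 < t" "0 < n" "0 < lam" "0 \<le> r"
  shows "emeasure (arrival_intensity lam) (cell t n k) = ennreal (lam * t / n)"
    and "emeasure departure_intensity ({0..r} \<times> cell t n k) = ennreal (r * t / n)"
proof -
  have le: "0 \<le> real k * t / real n" "real k * t / real n \<le> real (Suc k) * t / real n"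
    using assms by (auto intro!: divide_right_mono mult_right_mono)
  have diff: "real (Suc k) * t / real n - real k * t / real n = t / real n"
    using assms by (simp add: field_simps)
  show "emeasure (arrival_intensity lam) (cell t n k) = ennreal (lam * t / n)"
    unfolding cell_def using measure_arrival_intensity(1)[OF le assms(3)] by (simp only: diff) simp
  have "emeasure lborel (cell t n k) = ennreal (t / n)"
    unfolding cell_def using le by (simp only: emeasure_lborel_Ioc diff)
  then show "emeasure departure_intensity ({0..r} \<times> cell t n k) = ennreal (r * t / n)"
    using cell_facts[OF assms(1,2)] assms by (simp add: emeasure_departure_intensity flip: ennreal_mult')
qed

lemma random_measure_events_subset_Pow: "random_measure_events M \<nu> X \<subseteq> Pow (space M)"
  unfolding random_measure_events_def by (rule subsetI, rule PowI, rule sigma_sets_into_sp) auto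

lemma random_measure_events_subset_sets:
  assumes "poisson_random_measure M \<nu> X"
  shows "random_measure_events M \<nu> X \<subseteq> sets M"
  unfolding random_measure_events_def
  using poisson_random_measure_measurable[OF assms]
  by (intro sets.sigma_sets_subset) (auto intro: measurable_sets)

lemma noise_events_subset_sets:
  assumes "driving_noise M N lam A D"
  shows "noise_events M N lam A D \<subseteq> sets M"
  unfolding noise_events_def
  using driving_noiseD(2,3)[OF assms, THEN random_measure_events_subset_sets]
  by (intro sets.sigma_sets_subset UN_least Un_least)

lemma disjoint_imageI:
  assumes "\<And>j k. j \<noteq> k \<Longrightarrow> S j \<inter> S k = {}" "\<And>k. S k \<noteq> {}"
  shows "inj_on S I" "disjoint (S ` I)"
proof -
  show "inj_on S I"
  proof (rule inj_onI, rule ccontr)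
    fix j k assume "S j = S k" "j \<noteq> k"
    with assms(1)[of j k] have "S j = {}" by simp
    with assms(2) show False by blast
  qed
  show "disjoint (S ` I)"
  proof (rule disjointI)
    fix a b assume "a \<in> S ` I" "b \<in> S ` I" "a \<noteq> b"
    then obtain j k where jk: "a = S j" "b = S k" by blast
    with \<open>a \<noteq> b\<close> have "j \<noteq> k" by auto
    then show "a \<inter> b = {}" unfolding jk by (rule assms(1))
  qed
qed

definition cells_event where
  "cells_event M A D r t n N V = {\<omega>\<in>space M. \<forall>i\<in>{1..N}. \<forall>k<n.
      emeasure (A i \<omega>) (cell t n k) = of_nat (fst (V i k)) \<and>
      emeasure (D i \<omega>) ({0..r} \<times> cell t n k) = of_nat (snd (V i k))}"

text \<open>The counts of different cells are independent because the cells are disjoint, and those of different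
  sources by assumption.\<close>

lemma cells_event_prob:
  assumes noise: "driving_noise M N lam A D" and pos: "0 < lam" "0 < r" "0 < t" "0 < n" "1 \<le> N"
  shows "cells_event M A D r t n N V \<in> noise_events M N lam A D"
    and "measure M (cells_event M A D r t n N V)
      = (\<Prod>i\<in>{1..N}. \<Prod>k<n. pmf (cell_pmf (lam * t / n) (r * t / n)) (V i k))"
proof -
  interpret prob_space M using noise by (rule driving_noiseD)
  define F where "F = (\<lambda>i. {\<omega>\<in>space M. \<forall>k\<in>{..<n}. emeasure (A i \<omega>) (cell t n k) = of_nat (fst (V i k))})"
  define G where "G = (\<lambda>i. {\<omega>\<in>space M. \<forall>k\<in>{..<n}. emeasure (D i \<omega>) ({0..r} \<times> cell t n k) = of_nat (snd (V i k))})"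
  note cf = cell_facts[OF pos(3,4)] and ce = emeasure_cell[OF pos(3,4,1) less_imp_le[OF pos(2)]]
  have cA: "cell t n k \<in> sets (arrival_intensity lam)" for k using cf by (auto simp: sets_arrival_intensity)
  have cD: "{0..r} \<times> cell t n k \<in> sets departure_intensity" for k using cf by (auto intro!: Times_in_sets_departure)
  have closed: "(\<Inter>j\<in>J. H j) \<in> sigma_sets (space M) B"
    if "J \<noteq> {}" "finite J" "B \<subseteq> Pow (space M)" "\<And>j. j \<in> J \<Longrightarrow> H j \<in> sigma_sets (space M) B" for J :: "nat set" and H and B
  proof -
    interpret S: sigma_algebra "space M" "sigma_sets (space M) B"
      using that(3) by (rule sigma_algebra_sigma_sets)
    show ?thesis using that by (intro S.finite_INT) auto
  qed
  have n0: "{..<n} \<noteq> {}" using pos by auto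
  have F_alt: "F i = (\<Inter>k\<in>{..<n}. {\<omega>\<in>space M. emeasure (A i \<omega>) (cell t n k) = of_nat (fst (V i k))})" for i
    using n0 by (auto simp: F_def)
  have G_alt: "G i = (\<Inter>k\<in>{..<n}. {\<omega>\<in>space M. emeasure (D i \<omega>) ({0..r} \<times> cell t n k) = of_nat (snd (V i k))})" for i
    using n0 by (auto simp: G_def)
  have F: "F i \<in> random_measure_events M (arrival_intensity lam) (A i)" for i
    unfolding F_alt random_measure_events_def
    using n0 by (intro closed random_measure_eventsI[unfolded random_measure_events_def] cA) auto
  have G: "G i \<in> random_measure_events M departure_intensity (D i)" for i
    unfolding G_alt random_measure_events_def
    using n0 by (intro closed random_measure_eventsI[unfolded random_measure_events_def] cD) auto
  have alt: "cells_event M A D r t n N V = (\<Inter>i\<in>{1..N}. F i \<inter> G i)"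
    using pos(5) by (auto simp: cells_event_def F_def G_def)
  show "cells_event M A D r t n N V \<in> noise_events M N lam A D"
  proof -
    let ?B = "\<Union>i\<in>{1..N}. random_measure_events M (arrival_intensity lam) (A i)
                    \<union> random_measure_events M departure_intensity (D i)"
    have B: "?B \<subseteq> Pow (space M)"
      by (intro UN_least Un_least random_measure_events_subset_Pow)
    interpret S: sigma_algebra "space M" "sigma_sets (space M) ?B"
      using B by (rule sigma_algebra_sigma_sets)
    have "F i \<inter> G i \<in> sigma_sets (space M) ?B" if "i \<in> {1..N}" for i
      using that F G by (intro S.Int sigma_sets.Basic) blast+
    then show ?thesis
      unfolding alt noise_events_def using pos(5) B by (intro closed) auto
  qed
  have pA: "prob (F i) = (\<Prod>k<n. pmf (poisson_pmf (lam * t / n)) (fst (V i k)))" if "i \<in> {1..N}" for i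
  proof -
    have m: "measure (arrival_intensity lam) (cell t n k) = lam * t / n" for k
      using pos by (simp add: measure_def ce(1))
    have "prob (F i) = (\<Prod>k\<in>{..<n}. measure (arrival_intensity lam) (cell t n k) ^ fst (V i k)
        / fact (fst (V i k)) * exp (- measure (arrival_intensity lam) (cell t n k)))"
      unfolding F_def
      by (rule poisson_random_measure_indep_counts[OF prob_space_axioms driving_noiseD(2)[OF noise that]])
        (simp_all add: n0[simplified] cA ce(1) disjoint_imageI[of "cell t n"] cell_disjoint[OF pos(3,4)] cf(3))
    also have "\<dots> = (\<Prod>k<n. pmf (poisson_pmf (lam * t / n)) (fst (V i k)))"
      unfolding m using pos by (intro prod.cong refl pmf_poisson[symmetric]) simp
    finally show ?thesis .
  qed
  have pD: "prob (G i) = (\<Prod>k<n. pmf (poisson_pmf (r * t / n)) (snd (V i k)))" if "i \<in> {1..N}" for i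
  proof -
    let ?R = "\<lambda>k. {0..r} \<times> cell t n k"
    have R: "?R j \<inter> ?R k = {}" if "j \<noteq> k" for j k
      using cell_disjoint[OF pos(3,4) that] by (auto simp: Times_Int_Times)
    have R0: "?R k \<noteq> {}" for k using cf(3)[of k] pos by auto
    have m: "measure departure_intensity (?R k) = r * t / n" for k
      using pos by (simp add: measure_def ce(2))
    have "prob (G i) = (\<Prod>k\<in>{..<n}. measure departure_intensity (?R k) ^ snd (V i k)
        / fact (snd (V i k)) * exp (- measure departure_intensity (?R k)))"
      unfolding G_def
      by (rule poisson_random_measure_indep_counts[OF prob_space_axioms driving_noiseD(3)[OF noise that]])
        (simp_all add: n0[simplified] cD ce(2) disjoint_imageI[of ?R, OF R R0])
    also have "\<dots> = (\<Prod>k<n. pmf (poisson_pmf (r * t / n)) (snd (V i k)))"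
      unfolding m using pos by (intro prod.cong refl pmf_poisson[symmetric]) simp
    finally show ?thesis .
  qed
  have "prob (cells_event M A D r t n N V) = (\<Prod>i\<in>{1..N}. prob (F i) * prob (G i))"
    unfolding alt using pos(5) F G by (intro driving_noise_indep[OF noise]) auto
  also have "\<dots> = (\<Prod>i\<in>{1..N}. \<Prod>k<n. pmf (cell_pmf (lam * t / n) (r * t / n)) (V i k))"
    by (intro prod.cong refl) (simp only: pA pD prod.distrib[symmetric] cell_pmf_def pmf_pair[symmetric] prod.collapse)
  finally show "prob (cells_event M A D r t n N V)
      = (\<Prod>i\<in>{1..N}. \<Prod>k<n. pmf (cell_pmf (lam * t / n) (r * t / n)) (V i k))" .
qed

abbreviation noise_pmf :: "nat \<Rightarrow> nat \<Rightarrow> real \<Rightarrow> real \<Rightarrow> (nat \<Rightarrow> nat \<Rightarrow> nat \<times> nat) pmf" where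
  "noise_pmf N n a b \<equiv> Pi_pmf {1..N} undefined (\<lambda>_. cells_pmf n a b)"

definition system_walk :: "nat \<Rightarrow> nat \<Rightarrow> (nat \<Rightarrow> nat) \<Rightarrow> (nat \<Rightarrow> nat \<Rightarrow> nat \<times> nat) \<Rightarrow> nat \<Rightarrow> nat" where
  "system_walk N n x V = (\<lambda>i\<in>{1..N}. walk (x i) (V i) n)"

definition walk_law :: "nat \<Rightarrow> nat \<Rightarrow> real \<Rightarrow> real \<Rightarrow> (nat \<Rightarrow> nat) pmf \<Rightarrow> (nat \<Rightarrow> nat) pmf" where
  "walk_law N n a b p = map_pmf (\<lambda>(x, V). system_walk N n x V) (pair_pmf p (noise_pmf N n a b))"

lemma pmf_noise:
  assumes "V \<in> set_pmf (noise_pmf N n a b)"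
  shows "pmf (noise_pmf N n a b) V = (\<Prod>i\<in>{1..N}. \<Prod>k<n. pmf (cell_pmf a b) (V i k))"
proof -
  have V: "\<And>i. i \<notin> {1..N} \<Longrightarrow> V i = undefined" "\<And>i. i \<in> {1..N} \<Longrightarrow> V i \<in> set_pmf (cells_pmf n a b)"
    using assms by (auto simp: set_Pi_pmf PiE_dflt_def)
  have "pmf (noise_pmf N n a b) V = (\<Prod>i\<in>{1..N}. pmf (cells_pmf n a b) (V i))"
    using V(1) by (intro pmf_Pi') auto
  also have "\<dots> = (\<Prod>i\<in>{1..N}. \<Prod>k<n. pmf (cell_pmf a b) (V i k))"
  proof (intro prod.cong refl)
    fix i assume "i \<in> {1..N}"
    from V(2)[OF this] show "pmf (cells_pmf n a b) (V i) = (\<Prod>k<n. pmf (cell_pmf a b) (V i k))"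
      by (intro pmf_Pi') (auto simp: set_Pi_pmf PiE_dflt_def)
  qed
  finally show ?thesis .
qed

lemma set_noise_pmf_eqI:
  assumes "V \<in> set_pmf (noise_pmf N n a b)" "W \<in> set_pmf (noise_pmf N n a b)"
    and "\<And>i k. i \<in> {1..N} \<Longrightarrow> k < n \<Longrightarrow> V i k = W i k"
  shows "V = W"
proof (intro ext)
  fix i k
  show "V i k = W i k"
  proof (cases "i \<in> {1..N}")
    case True
    then have "V i \<in> set_pmf (cells_pmf n a b)" "W i \<in> set_pmf (cells_pmf n a b)"
      using assms(1,2) by (auto simp: set_Pi_pmf PiE_dflt_def)
    then have "k \<ge> n \<Longrightarrow> V i k = W i k" by (auto simp: set_Pi_pmf PiE_dflt_def)
    with assms(3)[OF True, of k] show ?thesis by (cases "k < n") auto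
  next
    case False
    then have "V i = undefined" "W i = undefined"
      using assms(1,2) by (auto simp: set_Pi_pmf PiE_dflt_def)
    then show ?thesis by simp
  qed
qed

lemma sets_state_space: "sets (state_space N) = Pow (PiE {1..N} (\<lambda>_. UNIV))"
  by (subst count_space_PiM_finite) auto

lemma countable_states: "countable (PiE {1..N::nat} (\<lambda>_. UNIV :: nat set))"
  by (intro countable_PiE) auto

lemma queue_state_measurable:
  assumes "\<And>i. i \<in> {1..N} \<Longrightarrow> q i t \<in> M \<rightarrow>\<^sub>M count_space UNIV"
  shows "queue_state N q t \<in> M \<rightarrow>\<^sub>M state_space N"
proof -
  have "(\<lambda>\<omega>. \<lambda>i\<in>{1..N}. q i t \<omega>) \<in> M \<rightarrow>\<^sub>M state_space N"
    by (intro measurable_restrict assms)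
  then show ?thesis by (simp add: queue_state_def[abs_def])
qed

text \<open>Each of the \<open>n\<close> cells is crowded with probability of order \<open>1 / n\<^sup>2\<close>.\<close>

lemma crowded_grid:
  assumes noise: "driving_noise M N lam A D" and i: "i \<in> {1..N}" and pos: "0 < lam" "0 < K" "0 < t" "0 < n"
  defines "crowded \<equiv> {\<omega>\<in>space M. \<exists>k<n. \<not> emeasure (A i \<omega>) (cell t n k) + emeasure (D i \<omega>) ({0..K} \<times> cell t n k) \<le> 1}"
  shows "crowded \<in> sets M" and "measure M crowded \<le> ((lam + K) * t)\<^sup>2 / real n"
proof -
  interpret prob_space M using noise by (rule driving_noiseD)
  define C where "C = (\<lambda>k. {\<omega>\<in>space M.
      \<not> emeasure (A i \<omega>) (cell t n k) + emeasure (D i \<omega>) ({0..K} \<times> cell t n k) \<le> 1})"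
  note cf = cell_facts[OF pos(3,4)] and ce = emeasure_cell[OF pos(3,4,1) less_imp_le[OF pos(2)]]
  have cA: "cell t n k \<in> sets (arrival_intensity lam)" for k using cf by (auto simp: sets_arrival_intensity)
  have cD: "{0..K} \<times> cell t n k \<in> sets departure_intensity" for k using cf by (auto intro!: Times_in_sets_departure)
  have C_sets: "C k \<in> events" for k
  proof -
    note [measurable] = poisson_random_measure_measurable[OF driving_noiseD(2)[OF noise i] cA]
      poisson_random_measure_measurable[OF driving_noiseD(3)[OF noise i] cD]
    show ?thesis unfolding C_def by measurable
  qed
  have eq: "crowded = (\<Union>k\<in>{..<n}. C k)" unfolding crowded_def C_def by blast
  show "crowded \<in> events" unfolding eq using C_sets by (intro sets.finite_UN) auto
  have "prob (\<Union>k\<in>{..<n}. C k) \<le> (\<Sum>k<n. prob (C k))"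
    using C_sets by (intro finite_measure_subadditive_finite) auto
  also have "(\<Sum>k<n. prob (C k)) \<le> (\<Sum>k<n. ((lam + K) * t / n)\<^sup>2)"
  proof (rule sum_mono)
    fix k
    have nn: "0 \<le> lam * t / n" "0 \<le> K * t / n" using pos by auto
    have "prob (C k) \<le> (measure (arrival_intensity lam) (cell t n k)
        + measure departure_intensity ({0..K} \<times> cell t n k))\<^sup>2"
      unfolding C_def
      by (rule driving_noise_crowded_le[OF noise i cA _ cD]) (simp_all add: ce)
    also have "measure (arrival_intensity lam) (cell t n k) = lam * t / n"
      using nn by (simp add: measure_def ce)
    also have "measure departure_intensity ({0..K} \<times> cell t n k) = K * t / n"
      using nn by (simp add: measure_def ce)
    finally show "prob (C k) \<le> ((lam + K) * t / n)\<^sup>2"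
      by (simp add: add_divide_distrib distrib_right)
  qed
  also have "(\<Sum>k<n. ((lam + K) * t / n)\<^sup>2) = ((lam + K) * t)\<^sup>2 / n"
    using pos by (simp add: power2_eq_square)
  finally show "prob crowded \<le> ((lam + K) * t)\<^sup>2 / real n" unfolding eq .
qed

text \<open>The comparison of a queueing system with the walk.  The path at time \<open>t\<close> can differ from the walk only if
  some cell is crowded or some mark falls into the rectangle where the rate \<open>\<rho>\<close> may differ from \<open>r\<close>.\<close>

lemma law_close_to_walk_law:
  assumes noise: "driving_noise M N lam A D" and pos: "0 < lam" "0 < r" "0 < t" "0 < n" "1 \<le> N" "r \<le> K"
    and meas: "\<And>i s. i \<in> {1..N} \<Longrightarrow> 0 \<le> s \<Longrightarrow> q i s \<in> M \<rightarrow>\<^sub>M count_space UNIV"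
    and indep: "prob_space.indep_set M {queue_state N q 0 -` S \<inter> space M | S. S \<in> sets (state_space N)}
       (noise_events M N lam A D)"
    and p: "\<And>x. x \<in> set_pmf p \<Longrightarrow> x \<in> PiE {1..N} (\<lambda>_. UNIV)"
      "\<And>x. x \<in> set_pmf p \<Longrightarrow> measure M {\<omega>\<in>space M. queue_state N q 0 \<omega> = x} = pmf p x"
    and path: "AE \<omega> in M. \<forall>i\<in>{1..N}. queue_path (A i \<omega>) (D i \<omega>) \<rho> (\<lambda>t. q i t \<omega>)"
    and rho: "\<rho> \<in> borel_measurable borel" "\<And>z. 0 \<le> z \<Longrightarrow> z \<le> t \<Longrightarrow> \<rho> z \<le> K"
    and near: "\<And>z. 0 \<le> z \<Longrightarrow> z \<le> T0 \<Longrightarrow> \<rho> z = r" "\<And>z. 0 \<le> z \<Longrightarrow> z \<le> t \<Longrightarrow> \<bar>\<rho> z - r\<bar> \<le> \<epsilon>" "0 \<le> T0" "T0 \<le> t"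
    and S: "S \<in> sets (state_space N)"
  shows "\<bar>measure M {\<omega>\<in>space M. queue_state N q t \<omega> \<in> S}
      - measure_pmf.prob (walk_law N n (lam * t / n) (r * t / n) p) S\<bar>
    \<le> N * (((lam + K) * t)\<^sup>2 / n + 2 * \<epsilon> * (t - T0))"
proof -
  interpret prob_space M using noise by (rule driving_noiseD)
  let ?a = "lam * t / n" and ?b = "r * t / n"
  let ?J = "pair_pmf p (noise_pmf N n ?a ?b)"
  let ?X = "queue_state N q 0"
  let ?E = "cells_event M A D r t n N"
  have eps: "0 \<le> \<epsilon>" using near(2)[of 0] pos by (auto intro: order_trans[OF abs_ge_zero])
  have K: "0 < K" using pos by simp
  have Xm: "?X \<in> M \<rightarrow>\<^sub>M state_space N" by (intro queue_state_measurable meas) auto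
  \<comment> \<open>the event that the initial state is \<open>x\<close> and the cell counts are \<open>V\<close>\<close>
  define G where "G = (\<lambda>(x, V). {\<omega>\<in>space M. ?X \<omega> = x} \<inter> ?E V)"
  have Xev: "{\<omega>\<in>space M. ?X \<omega> = x} \<in> {?X -` S \<inter> space M | S. S \<in> sets (state_space N)}"
    if "x \<in> set_pmf p" for x
  proof (intro CollectI exI conjI)
    show "{x} \<in> sets (state_space N)" unfolding sets_state_space using p(1)[OF that] by simp
    show "{\<omega>\<in>space M. ?X \<omega> = x} = ?X -` {x} \<inter> space M" by auto
  qed
  have Eev: "?E V \<in> noise_events M N lam A D" for V
    by (rule cells_event_prob[OF noise pos(1-5)])
  have G_sets: "G v \<in> sets M" if "v \<in> set_pmf ?J" for v
  proof -
    obtain x V where v: "v = (x, V)" "x \<in> set_pmf p" using \<open>v \<in> set_pmf ?J\<close> by (cases v) auto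
    have "{\<omega>\<in>space M. ?X \<omega> = x} \<in> sets M" using Xev[OF v(2)] Xm by (auto intro: measurable_sets)
    moreover have "?E V \<in> sets M" using Eev noise_events_subset_sets[OF noise] by blast
    ultimately show ?thesis by (auto simp: G_def v)
  qed
  have G_prob: "prob (G v) = pmf ?J v" if "v \<in> set_pmf ?J" for v
  proof -
    obtain x V where v: "v = (x, V)" "x \<in> set_pmf p" "V \<in> set_pmf (noise_pmf N n ?a ?b)"
      using \<open>v \<in> set_pmf ?J\<close> by (cases v) auto
    have "prob (G v) = prob {\<omega>\<in>space M. ?X \<omega> = x} * prob (?E V)"
      unfolding G_def v by (simp add: indep_setD[OF indep Xev[OF v(2)] Eev])
    also have "\<dots> = pmf p x * pmf (noise_pmf N n ?a ?b) V"
      using p(2)[OF v(2)] pmf_noise[OF v(3)] cells_event_prob(2)[OF noise pos(1-5), of V] by simp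
    finally show ?thesis by (simp add: v pmf_pair)
  qed
  have count: "cell_counts (A i \<omega>) (D i \<omega>) r t n k = V i k"
    if "\<omega> \<in> ?E V" "i \<in> {1..N}" "k < n" for \<omega> V i k
    using that ncount_eq[of "A i \<omega>" "cell t n k" "fst (V i k)"]
      ncount_eq[of "D i \<omega>" "{0..r} \<times> cell t n k" "snd (V i k)"]
    by (simp add: cell_counts_def cells_event_def prod_eq_iff)
  have G_disj: "disjoint_family_on G (set_pmf ?J)"
    unfolding disjoint_family_on_def
  proof (intro ballI impI)
    fix v w assume vw: "v \<in> set_pmf ?J" "w \<in> set_pmf ?J" "v \<noteq> w"
    show "G v \<inter> G w = {}"
    proof (rule ccontr)
      assume "G v \<inter> G w \<noteq> {}"
      then obtain \<omega> where om: "\<omega> \<in> G v" "\<omega> \<in> G w" by blast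
      obtain x V y W where xy: "v = (x, V)" "w = (y, W)" by (cases v, cases w)
      have "x = y" using om by (auto simp: G_def xy)
      moreover have "V = W"
      proof (rule set_noise_pmf_eqI)
        show "V i k = W i k" if "i \<in> {1..N}" "k < n" for i k
          using count[OF _ that, of \<omega> V] count[OF _ that, of \<omega> W] om by (simp add: G_def xy)
      qed (use vw xy in auto)
      ultimately show False using vw xy by simp
    qed
  qed
  define C where "C = (\<lambda>(x, V). system_walk N n x V) -` S"
  define W where "W = (\<Union>v\<in>C \<inter> set_pmf ?J. G v)"
  define U where "U = (\<Union>v\<in>UNIV \<inter> set_pmf ?J. G v)"
  have "prob W = measure_pmf.prob ?J C"
    unfolding W_def by (rule prob_UN_pmf[OF prob_space_axioms G_sets G_disj G_prob])
  also have "\<dots> = measure_pmf.prob (walk_law N n ?a ?b p) S"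
    by (simp add: walk_law_def C_def)
  finally have W: "prob W = measure_pmf.prob (walk_law N n ?a ?b p) S" .
  have W_sets: "W \<in> events" and U_sets: "U \<in> events"
    unfolding W_def U_def using G_sets by (auto intro!: sets.countable_UN' countable_Int2)
  have "prob U = 1"
    unfolding U_def by (subst prob_UN_pmf[OF prob_space_axioms G_sets G_disj G_prob]) auto
  then have AE_U: "AE \<omega> in M. \<omega> \<in> U" using U_sets prob_eq_1[of U] by simp
  let ?R = "{max 0 (r - \<epsilon>)..r + \<epsilon>} \<times> {T0<..t}"
  define crowded where "crowded = (\<lambda>i. {\<omega>\<in>space M. \<exists>k<n.
      \<not> emeasure (A i \<omega>) (cell t n k) + emeasure (D i \<omega>) ({0..K} \<times> cell t n k) \<le> 1})"
  define hit where "hit = (\<lambda>i. {\<omega>\<in>space M. emeasure (D i \<omega>) ?R \<noteq> 0})"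
  define bad where "bad = (\<Union>i\<in>{1..N}. crowded i \<union> hit i)"
  have R_sets: "?R \<in> sets departure_intensity" using near by (intro Times_in_sets_departure) auto
  have R_meas: "emeasure departure_intensity ?R = ennreal ((r + \<epsilon> - max 0 (r - \<epsilon>)) * (t - T0))"
    using near eps pos by (subst emeasure_departure_intensity) (auto simp: ennreal_mult')
  have crowded_sets: "crowded i \<in> events" if "i \<in> {1..N}" for i
    unfolding crowded_def by (rule crowded_grid(1)[OF noise that pos(1) K pos(3,4)])
  have hit_sets: "hit i \<in> events" if "i \<in> {1..N}" for i
  proof -
    note [measurable] = poisson_random_measure_measurable[OF driving_noiseD(3)[OF noise that] R_sets]
    show ?thesis unfolding hit_def by measurable
  qed
  have bad_sets: "bad \<in> events"
    unfolding bad_def using crowded_sets hit_sets by (intro sets.finite_UN) auto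
  have "prob bad \<le> (\<Sum>i\<in>{1..N}. prob (crowded i \<union> hit i))"
    unfolding bad_def using crowded_sets hit_sets by (intro finite_measure_subadditive_finite) auto
  also have "\<dots> \<le> (\<Sum>i\<in>{1..N}. ((lam + K) * t)\<^sup>2 / n + 2 * \<epsilon> * (t - T0))"
  proof (rule sum_mono)
    fix i assume i: "i \<in> {1..N}"
    have "prob (crowded i \<union> hit i) \<le> prob (crowded i) + prob (hit i)"
      using i crowded_sets hit_sets by (intro measure_Un_le) auto
    also have "prob (crowded i) \<le> ((lam + K) * t)\<^sup>2 / n"
      unfolding crowded_def by (rule crowded_grid(2)[OF noise i pos(1) K pos(3,4)])
    also have "prob (hit i) \<le> measure departure_intensity ?R"
      unfolding hit_def
      by (rule poisson_random_measure_nonzero_le[OF prob_space_axioms driving_noiseD(3)[OF noise i] R_sets])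
        (simp add: R_meas)
    also have "\<dots> = (r + \<epsilon> - max 0 (r - \<epsilon>)) * (t - T0)"
      unfolding measure_def R_meas using near eps pos by (intro enn2real_ennreal mult_nonneg_nonneg) auto
    also have "\<dots> \<le> 2 * \<epsilon> * (t - T0)"
      using near eps by (intro mult_right_mono) auto
    finally show "prob (crowded i \<union> hit i) \<le> ((lam + K) * t)\<^sup>2 / n + 2 * \<epsilon> * (t - T0)"
      by simp
  qed
  finally have bad: "prob bad \<le> N * (((lam + K) * t)\<^sup>2 / n + 2 * \<epsilon> * (t - T0))" by simp
  have finA: "emeasure (arrival_intensity lam) {0..t} < \<infinity>" using measure_arrival_intensity(2)[of 0 t lam] pos by simp
  have finD: "emeasure departure_intensity ({0..K} \<times> {0..t}) < \<infinity>"
    using pos by (subst emeasure_departure_intensity) (auto simp: ennreal_mult_less_top)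
  have AE_fin: "AE \<omega> in M. \<forall>i\<in>{1..N}. emeasure (A i \<omega>) {0..t} < \<infinity> \<and> emeasure (D i \<omega>) ({0..K} \<times> {0..t}) < \<infinity>"
    using finA finD
    by (intro AE_finite_allI AE_conjI poisson_random_measure_AE_finite[OF prob_space_axioms driving_noiseD(2)[OF noise]]
        poisson_random_measure_AE_finite[OF prob_space_axioms driving_noiseD(3)[OF noise]])
      (auto simp: sets_arrival_intensity intro!: Times_in_sets_departure)
  have agree: "AE \<omega> in M. \<omega> \<notin> bad \<longrightarrow> (queue_state N q t \<omega> \<in> S \<longleftrightarrow> \<omega> \<in> W)"
    using AE_U AE_fin path AE_space
  proof eventually_elim
    case (elim \<omega>)
    show ?case
    proof
      assume nb: "\<omega> \<notin> bad"
      obtain x V where v: "(x, V) \<in> set_pmf ?J" "\<omega> \<in> G (x, V)" using elim(1) by (auto simp: U_def)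
      have state: "queue_state N q t \<omega> = system_walk N n x V"
        unfolding queue_state_def system_walk_def
      proof (intro restrict_ext)
        fix i assume i: "i \<in> {1..N}"
        have "q i t \<omega> = walk (q i 0 \<omega>) (cell_counts (A i \<omega>) (D i \<omega>) r t n) n"
        proof (rule queue_path_eq_walk[OF _ _ _ rho _ pos(6) _ _ pos(3,4) _ near(1-3)])
          show "queue_path (A i \<omega>) (D i \<omega>) \<rho> (\<lambda>t. q i t \<omega>)" using elim(3) i by blast
          show "integer_valued (arrival_intensity lam) (A i \<omega>)"
            by (rule poisson_random_measure_integer_valued[OF driving_noiseD(2)[OF noise i] elim(4)])
          show "integer_valued departure_intensity (D i \<omega>)"
            by (rule poisson_random_measure_integer_valued[OF driving_noiseD(3)[OF noise i] elim(4)])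
          show "emeasure (A i \<omega>) (cell t n k) + emeasure (D i \<omega>) ({0..K} \<times> cell t n k) \<le> 1" if "k < n" for k
            using nb that i elim(4) by (auto simp: bad_def crowded_def)
          show "emeasure (D i \<omega>) ?R = 0" using nb i elim(4) by (auto simp: bad_def hit_def)
          show "emeasure (A i \<omega>) {0..t} < \<infinity>" "emeasure (D i \<omega>) ({0..K} \<times> {0..t}) < \<infinity>"
            using elim(2) i by blast+
        qed (use pos in auto)
        also have "\<dots> = walk (q i 0 \<omega>) (V i) n"
          using v(2) i count by (intro walk_cong) (auto simp: G_def)
        also have "q i 0 \<omega> = ?X \<omega> i" using i by (simp add: queue_state_def)
        also have "?X \<omega> = x" using v(2) by (simp add: G_def)
        finally show "q i t \<omega> = walk (x i) (V i) n" .
      qed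
      have "\<omega> \<in> W \<longleftrightarrow> (x, V) \<in> C"
      proof
        assume "\<omega> \<in> W"
        then obtain w where w: "w \<in> C" "w \<in> set_pmf ?J" "\<omega> \<in> G w" by (auto simp: W_def)
        have "w = (x, V)"
        proof (rule ccontr)
          assume "w \<noteq> (x, V)"
          then have "G w \<inter> G (x, V) = {}"
            using G_disj w(2) v(1) unfolding disjoint_family_on_def by blast
          with w(3) v(2) show False by blast
        qed
        with w show "(x, V) \<in> C" by simp
      qed (use v in \<open>auto simp: W_def\<close>)
      then show "queue_state N q t \<omega> \<in> S \<longleftrightarrow> \<omega> \<in> W" by (simp add: C_def state)
    qed
  qed
  let ?Q = "{\<omega>\<in>space M. queue_state N q t \<omega> \<in> S}"
  have "queue_state N q t \<in> M \<rightarrow>\<^sub>M state_space N" using pos by (intro queue_state_measurable meas) auto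
  then have Q_sets: "?Q \<in> events" using S measurable_sets[of "queue_state N q t" M "state_space N" S]
    by (simp add: vimage_def Int_def conj_commute)
  have "prob ?Q \<le> prob (W \<union> bad)"
    using agree W_sets bad_sets by (intro finite_measure_mono_AE) auto
  also have "\<dots> \<le> prob W + prob bad" using W_sets bad_sets by (intro measure_Un_le)
  finally have 1: "prob ?Q \<le> prob W + prob bad" .
  have "prob W \<le> prob (?Q \<union> bad)"
    using agree AE_space Q_sets bad_sets
    by (intro finite_measure_mono_AE) (auto elim: eventually_elim2)
  also have "\<dots> \<le> prob ?Q + prob bad" using Q_sets bad_sets by (intro measure_Un_le)
  finally show ?thesis using 1 bad W by linarith
qed

section \<open>Invariance and ergodicity of the walk\<close>

abbreviation geometric_states :: "nat \<Rightarrow> real \<Rightarrow> (nat \<Rightarrow> nat) pmf" where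
  "geometric_states N x \<equiv> Pi_pmf {1..N} undefined (\<lambda>_. geometric_pmf (1 - x))"

lemma map_system_walk_noise:
  "map_pmf (system_walk N n x) (noise_pmf N n a b)
    = Pi_pmf {1..N} undefined (\<lambda>i. map_pmf (\<lambda>v. walk (x i) v n) (cells_pmf n a b))"
  unfolding map_pmf_def
  by (subst Pi_pmf_bind[where d' = undefined])
    (auto simp: system_walk_def restrict_def intro!: bind_pmf_cong)

lemma walk_law_eq_bind:
  "walk_law N n a b p = bind_pmf p (\<lambda>x. map_pmf (system_walk N n x) (noise_pmf N n a b))"
  by (simp add: walk_law_def pair_pmf_def map_pmf_def bind_assoc_pmf bind_return_pmf)

lemma walk_law_geometric_states:
  assumes "0 < a" "a < b"
  shows "walk_law N n a b (geometric_states N (a / b)) = geometric_states N (a / b)"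
proof -
  have "geometric_states N (a / b) = Pi_pmf {1..N} undefined
      (\<lambda>_. bind_pmf (geometric_pmf (1 - a / b)) (\<lambda>x. map_pmf (\<lambda>v. walk x v n) (cells_pmf n a b)))"
    by (simp only: walk_geometric_invariant[OF assms])
  also have "\<dots> = walk_law N n a b (geometric_states N (a / b))"
    unfolding walk_law_eq_bind map_system_walk_noise by (subst Pi_pmf_bind[where d' = undefined]) simp_all
  finally show ?thesis by simp
qed

lemma system_walk_contraction:
  assumes "0 < a" "0 < b" "1 \<le> th"
  shows "measure_pmf.prob (noise_pmf N n a b) {V. system_walk N n x V \<noteq> system_walk N n y V}
    \<le> (\<Sum>i\<in>{1..N}. th ^ max (x i) (y i)) * (1 + exp (- (a + b)) * (a * (th - 1) + b * (1 / th - 1))) ^ n"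
proof -
  let ?k = "(1 + exp (- (a + b)) * (a * (th - 1) + b * (1 / th - 1))) ^ n"
  let ?D = "\<lambda>i. {V. walk (x i) (V i) n \<noteq> walk (y i) (V i) n}"
  have "{V. system_walk N n x V \<noteq> system_walk N n y V} \<subseteq> (\<Union>i\<in>{1..N}. ?D i)"
    by (auto simp: system_walk_def fun_eq_iff restrict_def split: if_splits)
  then have "measure_pmf.prob (noise_pmf N n a b) {V. system_walk N n x V \<noteq> system_walk N n y V}
      \<le> measure_pmf.prob (noise_pmf N n a b) (\<Union>i\<in>{1..N}. ?D i)"
    by (intro measure_pmf.finite_measure_mono) auto
  also have "\<dots> \<le> (\<Sum>i\<in>{1..N}. measure_pmf.prob (noise_pmf N n a b) (?D i))"
    by (intro measure_pmf.finite_measure_subadditive_finite) auto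
  also have "\<dots> \<le> (\<Sum>i\<in>{1..N}. th ^ max (x i) (y i) * ?k)"
  proof (rule sum_mono)
    fix i assume i: "i \<in> {1..N}"
    have "measure_pmf.prob (noise_pmf N n a b) (?D i)
        = measure_pmf.prob (map_pmf (\<lambda>V. V i) (noise_pmf N n a b)) {v. walk (x i) v n \<noteq> walk (y i) v n}"
      by (simp add: vimage_def)
    also have "map_pmf (\<lambda>V. V i) (noise_pmf N n a b) = cells_pmf n a b"
      using i by (subst Pi_pmf_component) auto
    finally show "measure_pmf.prob (noise_pmf N n a b) (?D i) \<le> th ^ max (x i) (y i) * ?k"
      using walk_pair_contraction[OF assms, of n "x i" "y i"] by simp
  qed
  finally show ?thesis by (simp only: sum_distrib_right)
qed

text \<open>Start the two walks from independent initial states and let them read the same cells.\<close>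

lemma walk_law_diff_le:
  "ennreal \<bar>measure_pmf.prob (walk_law N n a b p) S - measure_pmf.prob (walk_law N n a b p') S\<bar>
    \<le> (\<integral>\<^sup>+(x, y). measure_pmf.prob (noise_pmf N n a b) {V. system_walk N n x V \<noteq> system_walk N n y V}
        \<partial>pair_pmf p p')"
proof -
  define Z where "Z = pair_pmf (pair_pmf p p') (noise_pmf N n a b)"
  let ?f = "\<lambda>((x, y), V). system_walk N n x V" and ?g = "\<lambda>((x, y), V). system_walk N n y V"
  have f: "map_pmf ?f Z = walk_law N n a b p" and g: "map_pmf ?g Z = walk_law N n a b p'"
    unfolding Z_def walk_law_eq_bind pair_pmf_def
    by (simp_all add: map_bind_pmf bind_assoc_pmf bind_return_pmf map_pmf_def)
  have "\<bar>measure_pmf.prob (walk_law N n a b p) S - measure_pmf.prob (walk_law N n a b p') S\<bar>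
      = \<bar>measure_pmf.prob Z (?f -` S) - measure_pmf.prob Z (?g -` S)\<bar>"
    by (simp add: f[symmetric] g[symmetric])
  also have "\<dots> \<le> measure_pmf.prob Z {z. ?f z \<noteq> ?g z}"
  proof -
    have "measure_pmf.prob Z (?f -` S) \<le> measure_pmf.prob Z (?g -` S) + measure_pmf.prob Z {z. ?f z \<noteq> ?g z}"
      by (rule order_trans[OF measure_pmf.finite_measure_mono measure_Un_le]) auto
    moreover have "measure_pmf.prob Z (?g -` S) \<le> measure_pmf.prob Z (?f -` S) + measure_pmf.prob Z {z. ?f z \<noteq> ?g z}"
      by (rule order_trans[OF measure_pmf.finite_measure_mono measure_Un_le]) auto
    ultimately show ?thesis by linarith
  qed
  finally have "ennreal \<bar>measure_pmf.prob (walk_law N n a b p) S - measure_pmf.prob (walk_law N n a b p') S\<bar>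
      \<le> emeasure Z {z. ?f z \<noteq> ?g z}"
    by (simp add: measure_pmf.emeasure_eq_measure)
  also have "\<dots> = (\<integral>\<^sup>+z. indicator {z. ?f z \<noteq> ?g z} z \<partial>Z)" by simp
  also have "\<dots> = (\<integral>\<^sup>+xy. \<integral>\<^sup>+V. indicator {z. ?f z \<noteq> ?g z} (xy, V) \<partial>noise_pmf N n a b \<partial>pair_pmf p p')"
    unfolding Z_def by (rule nn_integral_pair_pmf')
  also have "\<dots> = (\<integral>\<^sup>+(x, y). measure_pmf.prob (noise_pmf N n a b) {V. system_walk N n x V \<noteq> system_walk N n y V}
        \<partial>pair_pmf p p')"
  proof (intro nn_integral_cong, clarify)
    fix x y
    have "(\<integral>\<^sup>+V. indicator {z. ?f z \<noteq> ?g z} ((x, y), V) \<partial>noise_pmf N n a b)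
        = (\<integral>\<^sup>+V. indicator {V. system_walk N n x V \<noteq> system_walk N n y V} V \<partial>noise_pmf N n a b)"
      by (intro nn_integral_cong) (auto simp: indicator_def)
    then show "(\<integral>\<^sup>+V. indicator {z. ?f z \<noteq> ?g z} ((x, y), V) \<partial>noise_pmf N n a b)
        = ennreal (measure_pmf.prob (noise_pmf N n a b) {V. system_walk N n x V \<noteq> system_walk N n y V})"
      by (simp add: measure_pmf.emeasure_eq_measure)
  qed
  finally show ?thesis .
qed

text \<open>The choice \<open>th = sqrt (r / lam)\<close> minimises \<open>lam (th - 1) + r (1 / th - 1)\<close>; the minimum is
  \<open>- lam (th - 1)\<^sup>2\<close>.\<close>

lemma contraction_factor:
  fixes lam r h :: real
  assumes "0 < lam" "lam < r" "0 < h" "h \<le> 1"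
  defines "th \<equiv> sqrt (r / lam)"
  defines "\<kappa> \<equiv> 1 + exp (- (lam * h + r * h)) * (lam * h * (th - 1) + r * h * (1 / th - 1))"
  shows "0 \<le> \<kappa>" "\<kappa> \<le> exp (- (exp (- (lam + r)) * lam * (th - 1)\<^sup>2 * h))" "1 < th"
proof -
  show th: "1 < th" using assms by (simp add: th_def)
  have "th\<^sup>2 = r / lam" using assms by (simp add: th_def)
  then have r: "r = lam * th\<^sup>2" using assms(1) by (simp add: field_simps)
  have drift: "lam * h * (th - 1) + r * h * (1 / th - 1) = - (lam * h * (th - 1)\<^sup>2)"
    using th unfolding r by (simp add: field_simps power2_eq_square)
  have "lam * h * (th - 1) \<ge> 0" using assms th by simp
  moreover have "r * h * (1 / th - 1) \<ge> - (r * h)"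
    using assms th mult_left_mono[of "-1" "1 / th - 1" "r * h"] by simp
  moreover have "0 \<le> lam * h" using assms by simp
  ultimately have low: "lam * h * (th - 1) + r * h * (1 / th - 1) \<ge> - (lam * h + r * h)" by linarith
  have "lam * h + r * h \<le> exp (lam * h + r * h)"
    using exp_ge_add_one_self[of "lam * h + r * h"] by linarith
  then have "exp (- (lam * h + r * h)) * (lam * h + r * h) \<le> exp (- (lam * h + r * h)) * exp (lam * h + r * h)"
    by (intro mult_left_mono) auto
  also have "\<dots> = 1" by (simp add: mult_exp_exp)
  finally have "exp (- (lam * h + r * h)) * (lam * h + r * h) \<le> 1" .
  moreover have "exp (- (lam * h + r * h)) * - (lam * h + r * h)
      \<le> exp (- (lam * h + r * h)) * (lam * h * (th - 1) + r * h * (1 / th - 1))"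
    using low by (intro mult_left_mono) auto
  ultimately show "0 \<le> \<kappa>" unfolding \<kappa>_def by (simp only: mult_minus_right)
  have "lam * h \<le> lam * 1" "r * h \<le> r * 1" using assms(1-4) by (intro mult_left_mono; simp)+
  then have "lam * h + r * h \<le> lam + r" by simp
  then have "exp (- (lam + r)) * (lam * h * (th - 1)\<^sup>2) \<le> exp (- (lam * h + r * h)) * (lam * h * (th - 1)\<^sup>2)"
    using assms by (intro mult_right_mono) auto
  then have "\<kappa> \<le> 1 + - (exp (- (lam + r)) * lam * (th - 1)\<^sup>2 * h)"
    unfolding \<kappa>_def drift by (simp add: mult_ac)
  also have "\<dots> \<le> exp (- (exp (- (lam + r)) * lam * (th - 1)\<^sup>2 * h))" by (rule exp_ge_add_one_self)
  finally show "\<kappa> \<le> exp (- (exp (- (lam + r)) * lam * (th - 1)\<^sup>2 * h))" .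
qed

text \<open>Horizon \<open>j + 1\<close> with \<open>(j + 1) ^ 3\<close> cells.  The growing horizon makes the walks coalesce, with an error of order
  \<open>exp (- c (j + 1))\<close>; a cubic number of cells is taken because the distance between the queue and the walk is of
  order horizon squared over number of cells, which then vanishes as well.\<close>

lemma walk_law_tendsto_geometric:
  fixes lam r :: real
  assumes lr: "0 < lam" "lam < r"
  shows "(\<lambda>j. measure_pmf.prob (walk_law N (Suc j ^ 3) (lam * real (Suc j) / real (Suc j ^ 3))
      (r * real (Suc j) / real (Suc j ^ 3)) p) S) \<longlonglongrightarrow> measure_pmf.prob (geometric_states N (lam / r)) S"
proof -
  define a where "a = (\<lambda>j. lam * real (Suc j) / real (Suc j ^ 3))"
  define b where "b = (\<lambda>j. r * real (Suc j) / real (Suc j ^ 3))"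
  define h where "h = (\<lambda>j. real (Suc j) / real (Suc j ^ 3))"
  let ?n = "\<lambda>j. Suc j ^ 3"
  let ?G = "geometric_states N (lam / r)"
  define f where "f = (\<lambda>j (x, y). ennreal (measure_pmf.prob (noise_pmf N (?n j) (a j) (b j))
      {V. system_walk N (?n j) x V \<noteq> system_walk N (?n j) y V}))"
  define th where "th = sqrt (r / lam)"
  define c where "c = exp (- (lam + r)) * lam * (th - 1)\<^sup>2"
  have ab: "0 < a j" "a j < b j" "a j / b j = lam / r" "a j = lam * h j" "b j = r * h j" "0 < h j" for j
    using lr by (auto simp: a_def b_def h_def intro!: divide_strict_right_mono)
  have h1: "h j \<le> 1" for j
    by (simp add: h_def divide_le_eq power3_eq_cube)
  have hn: "real (?n j) * h j = real (Suc j)" for j by (simp add: h_def)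
  have th: "1 < th" using contraction_factor(3)[OF lr, of 1] by (simp add: th_def)
  have c: "0 < c" using lr th by (simp add: c_def)
  have pt: "(\<lambda>j. f j z) \<longlonglongrightarrow> 0" for z
  proof -
    obtain x y where z: "z = (x, y)" by (cases z)
    let ?M = "\<Sum>i\<in>{1..N}. th ^ max (x i) (y i)"
    have M0: "0 \<le> ?M" using th by (intro sum_nonneg) simp
    have upper: "f j z \<le> ennreal (?M * exp (- (c * real (Suc j))))" for j
    proof -
      let ?k = "1 + exp (- (a j + b j)) * (a j * (th - 1) + b j * (1 / th - 1))"
      have k: "0 \<le> ?k" "?k \<le> exp (- (c * h j))"
        using contraction_factor[OF lr ab(6)[of j] h1[of j]] unfolding ab(4,5) th_def c_def by simp_all
      have "?k ^ ?n j \<le> exp (- (c * h j)) ^ ?n j" using k by (intro power_mono)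
      also have "\<dots> = exp (real (?n j) * - (c * h j))" by (rule exp_of_nat_mult[symmetric])
      also have "real (?n j) * - (c * h j) = - (c * real (Suc j))"
        using hn[of j] by (metis mult.left_commute mult_minus_right)
      finally have "?k ^ ?n j \<le> exp (- (c * real (Suc j)))" .
      then have "?M * ?k ^ ?n j \<le> ?M * exp (- (c * real (Suc j)))"
        using M0 by (rule mult_left_mono)
      with system_walk_contraction[OF ab(1)[of j] less_trans[OF ab(1)[of j] ab(2)[of j]] less_imp_le[OF th], of N "?n j" x y]
      show ?thesis unfolding f_def z by (auto intro!: ennreal_leI elim: order_trans)
    qed
    have lim: "(\<lambda>j. ennreal (?M * exp (- (c * real (Suc j))))) \<longlonglongrightarrow> ennreal (?M * 0)"
    proof (intro tendsto_ennrealI tendsto_mult tendsto_const)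
      have "(\<lambda>j. exp (- c) ^ Suc j) \<longlonglongrightarrow> 0"
        using c by (intro LIMSEQ_Suc LIMSEQ_realpow_zero) auto
      also have "(\<lambda>j. exp (- c) ^ Suc j) = (\<lambda>j. exp (- (c * real (Suc j))))"
        by (simp only: exp_of_nat_mult[symmetric] mult_minus_right mult.commute[of c])
      finally show "(\<lambda>j. exp (- (c * real (Suc j)))) \<longlonglongrightarrow> 0" .
    qed
    show ?thesis
    proof (rule tendsto_sandwich[OF _ _ tendsto_const])
      show "\<forall>\<^sub>F j in sequentially. 0 \<le> f j z" by simp
      show "\<forall>\<^sub>F j in sequentially. f j z \<le> ennreal (?M * exp (- (c * real (Suc j))))"
        using upper by (rule always_eventually[OF allI])
      show "(\<lambda>j. ennreal (?M * exp (- (c * real (Suc j))))) \<longlonglongrightarrow> 0"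
        using lim by (simp only: mult_zero_right ennreal_0)
    qed
  qed
  have f1: "f j z \<le> 1" for j z
    unfolding f_def by (cases z) (simp add: ennreal_le_1)
  have "(\<lambda>j. \<integral>\<^sup>+z. f j z \<partial>pair_pmf p ?G) \<longlonglongrightarrow> (\<integral>\<^sup>+z. 0 \<partial>pair_pmf p ?G)"
    by (rule nn_integral_dominated_convergence[where w = "\<lambda>_. 1"])
      (simp_all only: f1 pt AE_I2 measurable_pmf_measure1 space_measure_pmf nn_integral_const, simp_all)
  then have lim: "(\<lambda>j. \<integral>\<^sup>+z. f j z \<partial>pair_pmf p ?G) \<longlonglongrightarrow> 0" by simp
  have "ennreal \<bar>measure_pmf.prob (walk_law N (?n j) (a j) (b j) p) S - measure_pmf.prob ?G S\<bar>
      \<le> (\<integral>\<^sup>+z. f j z \<partial>pair_pmf p ?G)" for j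
    using walk_law_diff_le[of N "?n j" "a j" "b j" p S ?G] walk_law_geometric_states[OF ab(1)[of j] ab(2)[of j], of N "?n j"]
    unfolding ab(3) f_def by (simp add: case_prod_unfold)
  then have "(\<lambda>j. ennreal \<bar>measure_pmf.prob (walk_law N (?n j) (a j) (b j) p) S - measure_pmf.prob ?G S\<bar>) \<longlonglongrightarrow> 0"
    by (intro tendsto_sandwich[OF _ _ tendsto_const lim] always_eventually allI zero_le)
  then have "(\<lambda>j. \<bar>measure_pmf.prob (walk_law N (?n j) (a j) (b j) p) S - measure_pmf.prob ?G S\<bar>) \<longlonglongrightarrow> 0"
    by (subst (asm) ennreal_0[symmetric], subst (asm) tendsto_ennreal_iff) auto
  then show ?thesis
    unfolding a_def b_def by (simp only: tendsto_rabs_zero_iff LIM_zero_iff)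
qed

lemma walk_law_geometric_states_grid:
  assumes "0 < lam" "0 < t" "0 < n" "0 < r" "x < 1" "x * r = lam"
  shows "walk_law N n (lam * t / real n) (r * t / real n) (geometric_states N x) = geometric_states N x"
proof -
  have "(lam * t / n) / (r * t / n) = x" using assms by (simp add: field_simps)
  moreover have "x * r < 1 * r" using assms by (intro mult_strict_right_mono)
  then have "lam < r" using assms by simp
  then have "0 < lam * t / n" "lam * t / n < r * t / n"
    using assms by (auto intro!: divide_strict_right_mono)
  ultimately show ?thesis using walk_law_geometric_states[of "lam * t / n" "r * t / n" N n] by simp
qed

lemma set_geometric_states: "set_pmf (geometric_states N x) \<subseteq> PiE {1..N} (\<lambda>_. UNIV)"
  by (auto simp: set_Pi_pmf PiE_dflt_def PiE_def extensional_def)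

section \<open>Adding an independent initial condition\<close>

lemma pair_snd_prob:
  assumes "prob_space \<pi>" "prob_space M" "S \<in> sets M"
  shows "measure (\<pi> \<Otimes>\<^sub>M M) (snd -` S \<inter> space (\<pi> \<Otimes>\<^sub>M M)) = measure M S"
proof -
  interpret P: prob_space \<pi> by fact
  interpret M: prob_space M by fact
  have "snd -` S \<inter> space (\<pi> \<Otimes>\<^sub>M M) = space \<pi> \<times> S"
    using sets.sets_into_space[OF assms(3)] by (auto simp: space_pair_measure)
  then have "emeasure (\<pi> \<Otimes>\<^sub>M M) (snd -` S \<inter> space (\<pi> \<Otimes>\<^sub>M M)) = emeasure M S"
    using assms(3) by (simp add: M.emeasure_pair_measure_Times P.emeasure_space_1)
  then show ?thesis by (simp add: measure_def)
qed

lemma indep_sets_pair_snd: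
  assumes \<pi>: "prob_space \<pi>" and M: "prob_space M" and ind: "prob_space.indep_sets M F I"
  shows "prob_space.indep_sets (\<pi> \<Otimes>\<^sub>M M) (\<lambda>i. {snd -` S \<inter> space (\<pi> \<Otimes>\<^sub>M M) |S. S \<in> F i}) I"
proof -
  interpret M: prob_space M by fact
  interpret E: prob_space "\<pi> \<Otimes>\<^sub>M M" using \<pi> M by (rule prob_space_pair)
  have F: "F i \<subseteq> sets M" if "i \<in> I" for i using ind that by (auto simp: M.indep_sets_def)
  show ?thesis
  proof (rule E.indep_setsI)
    show "{snd -` S \<inter> space (\<pi> \<Otimes>\<^sub>M M) |S. S \<in> F i} \<subseteq> E.events" if "i \<in> I" for i
      using F[OF that] by (auto intro: measurable_sets[OF measurable_snd])
    fix C J assume J: "J \<noteq> {}" "J \<subseteq> I" "finite J"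
      and C: "\<forall>j\<in>J. C j \<in> {snd -` S \<inter> space (\<pi> \<Otimes>\<^sub>M M) |S. S \<in> F j}"
    from C obtain S where S: "\<And>j. j \<in> J \<Longrightarrow> C j = snd -` S j \<inter> space (\<pi> \<Otimes>\<^sub>M M) \<and> S j \<in> F j"
      by (auto simp: Ball_def) metis
    have SM: "S j \<in> sets M" if "j \<in> J" for j using S[OF that] F J that by blast
    have "(\<Inter>j\<in>J. C j) = snd -` (\<Inter>j\<in>J. S j) \<inter> space (\<pi> \<Otimes>\<^sub>M M)"
      using S J(1) by (auto; blast)
    moreover have "(\<Inter>j\<in>J. S j) \<in> sets M" using J SM by (intro sets.finite_INT) auto
    ultimately have "E.prob (\<Inter>j\<in>J. C j) = M.prob (\<Inter>j\<in>J. S j)"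
      using pair_snd_prob[OF \<pi> M] by simp
    also have "\<dots> = (\<Prod>j\<in>J. M.prob (S j))"
      using J S by (intro M.indep_setsD[OF ind]) auto
    also have "\<dots> = (\<Prod>j\<in>J. E.prob (C j))"
      using S SM pair_snd_prob[OF \<pi> M] by (intro prod.cong) auto
    finally show "E.prob (\<Inter>j\<in>J. C j) = (\<Prod>j\<in>J. E.prob (C j))" .
  qed
qed

lemma random_measure_events_pair_snd:
  "random_measure_events (\<pi> \<Otimes>\<^sub>M M) \<nu> (\<lambda>\<omega>. X (snd \<omega>))
    = {snd -` S \<inter> space (\<pi> \<Otimes>\<^sub>M M) |S. S \<in> random_measure_events M \<nu> X}"
proof -
  let ?E = "\<pi> \<Otimes>\<^sub>M M"
  let ?gen = "{(\<lambda>\<omega>. emeasure (X \<omega>) S) -` T \<inter> space M | S T. S \<in> sets \<nu> \<and> T \<in> sets borel}"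
  have "{(\<lambda>\<omega>. emeasure (X (snd \<omega>)) S) -` T \<inter> space ?E | S T. S \<in> sets \<nu> \<and> T \<in> sets borel}
      = {snd -` C \<inter> space ?E |C. C \<in> ?gen}" (is "?L = ?R")
  proof (intro equalityI subsetI)
    fix Z assume "Z \<in> ?L"
    then obtain S T where ST: "Z = (\<lambda>\<omega>. emeasure (X (snd \<omega>)) S) -` T \<inter> space ?E" "S \<in> sets \<nu>" "T \<in> sets borel"
      by blast
    have "Z = snd -` ((\<lambda>\<omega>. emeasure (X \<omega>) S) -` T \<inter> space M) \<inter> space ?E"
      unfolding ST(1) by (auto simp: space_pair_measure)
    with ST(2,3) show "Z \<in> ?R" by blast
  next
    fix Z assume "Z \<in> ?R"
    then obtain S T where ST: "Z = snd -` ((\<lambda>\<omega>. emeasure (X \<omega>) S) -` T \<inter> space M) \<inter> space ?E"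
        "S \<in> sets \<nu>" "T \<in> sets borel"
      by blast
    have "Z = (\<lambda>\<omega>. emeasure (X (snd \<omega>)) S) -` T \<inter> space ?E"
      unfolding ST(1) by (auto simp: space_pair_measure)
    with ST(2,3) show "Z \<in> ?L" by blast
  qed
  moreover have "snd \<in> space ?E \<rightarrow> space M" by (auto simp: space_pair_measure)
  ultimately show ?thesis
    unfolding random_measure_events_def by (simp only: sigma_sets_vimage_commute)
qed

lemma poisson_random_measure_pair_snd:
  assumes \<pi>: "prob_space \<pi>" and M: "prob_space M" and X: "poisson_random_measure M \<nu> X"
  shows "poisson_random_measure (\<pi> \<Otimes>\<^sub>M M) \<nu> (\<lambda>\<omega>. X (snd \<omega>))"
proof -
  let ?E = "\<pi> \<Otimes>\<^sub>M M"
  interpret M: prob_space M by fact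
  interpret E: prob_space ?E using \<pi> M by (rule prob_space_pair)
  note meas = poisson_random_measure_measurable[OF X]
  have snd_space: "snd \<omega> \<in> space M" if "\<omega> \<in> space ?E" for \<omega> using that by (auto simp: space_pair_measure)
  show ?thesis
    unfolding poisson_random_measure_def
  proof (intro conjI ballI allI impI)
    fix \<omega> assume "\<omega> \<in> space ?E"
    from poisson_random_measure_integer_valued[OF X snd_space[OF this]]
    show "sets (X (snd \<omega>)) = sets \<nu>" by (simp add: integer_valued_def)
  next
    fix \<omega> S assume "\<omega> \<in> space ?E" "S \<in> sets \<nu>"
    with poisson_random_measure_integer_valued[OF X snd_space, of \<omega>]
    show "emeasure (X (snd \<omega>)) S \<in> insert \<infinity> (range of_nat)"
      unfolding integer_valued_def by blast
  next
    fix S assume S: "S \<in> sets \<nu>"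
    show "(\<lambda>\<omega>. emeasure (X (snd \<omega>)) S) \<in> borel_measurable ?E"
      using measurable_compose[OF measurable_snd meas[OF S]] .
    fix k assume fin: "emeasure \<nu> S < \<infinity>"
    have "{\<omega>\<in>space M. emeasure (X \<omega>) S = of_nat k} \<in> sets M"
      using meas[OF S] by measurable
    from pair_snd_prob[OF \<pi> M this]
    have "measure ?E (snd -` {\<omega>\<in>space M. emeasure (X \<omega>) S = of_nat k} \<inter> space ?E)
      = measure \<nu> S ^ k / fact k * exp (- measure \<nu> S)"
      using poisson_random_measure_prob[OF X S fin] by simp
    also have "snd -` {\<omega>\<in>space M. emeasure (X \<omega>) S = of_nat k} \<inter> space ?E
        = {\<omega>\<in>space ?E. emeasure (X (snd \<omega>)) S = of_nat k}"
      using snd_space by auto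
    finally show "measure ?E {\<omega>\<in>space ?E. emeasure (X (snd \<omega>)) S = of_nat k}
      = measure \<nu> S ^ k / fact k * exp (- measure \<nu> S)" .
  next
    fix F assume F: "finite F \<and> F \<subseteq> sets \<nu> \<and> disjoint F"
    have "\<forall>F. finite F \<and> F \<subseteq> sets \<nu> \<and> disjoint F \<longrightarrow>
        M.indep_vars (\<lambda>_. borel) (\<lambda>S \<omega>. emeasure (X \<omega>) S) F"
      using X unfolding poisson_random_measure_def by (elim conjE)
    with F have "M.indep_vars (\<lambda>_. borel) (\<lambda>S \<omega>. emeasure (X \<omega>) S) F" by blast
    then have "M.indep_sets (\<lambda>S. {(\<lambda>\<omega>. emeasure (X \<omega>) S) -` T \<inter> space M |T. T \<in> sets borel}) F"
      by (simp add: M.indep_vars_def2)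
    from indep_sets_pair_snd[OF \<pi> M this]
    have "E.indep_sets (\<lambda>S. {(\<lambda>\<omega>. emeasure (X (snd \<omega>)) S) -` T \<inter> space ?E |T. T \<in> sets borel}) F"
    proof (rule E.indep_sets_mono_sets)
      fix S
      show "{(\<lambda>\<omega>. emeasure (X (snd \<omega>)) S) -` T \<inter> space ?E |T. T \<in> sets borel}
        \<subseteq> {snd -` C \<inter> space ?E |C. C \<in> {(\<lambda>\<omega>. emeasure (X \<omega>) S) -` T \<inter> space M |T. T \<in> sets borel}}"
      proof
        fix Z assume "Z \<in> {(\<lambda>\<omega>. emeasure (X (snd \<omega>)) S) -` T \<inter> space ?E |T. T \<in> sets borel}"
        then obtain T where T: "Z = (\<lambda>\<omega>. emeasure (X (snd \<omega>)) S) -` T \<inter> space ?E" "T \<in> sets borel" by blast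
        have "Z = snd -` ((\<lambda>\<omega>. emeasure (X \<omega>) S) -` T \<inter> space M) \<inter> space ?E"
          unfolding T(1) using snd_space by auto
        with T(2) show "Z \<in> {snd -` C \<inter> space ?E |C. C \<in> {(\<lambda>\<omega>. emeasure (X \<omega>) S) -` T \<inter> space M |T. T \<in> sets borel}}"
          by blast
      qed
    qed
    moreover have "(\<lambda>\<omega>. emeasure (X (snd \<omega>)) S) \<in> borel_measurable ?E" if "S \<in> F" for S
    proof -
      have "S \<in> sets \<nu>" using F that by blast
      from measurable_compose[OF measurable_snd meas[OF this]] show ?thesis .
    qed
    ultimately show "E.indep_vars (\<lambda>_. borel) (\<lambda>S \<omega>. emeasure (X (snd \<omega>)) S) F"
      unfolding E.indep_vars_def2 by (intro conjI ballI)
  qed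
qed

lemma driving_noise_pair_snd:
  assumes \<pi>: "prob_space \<pi>" and noise: "driving_noise M N lam A D"
  shows "driving_noise (\<pi> \<Otimes>\<^sub>M M) N lam (\<lambda>i \<omega>. A i (snd \<omega>)) (\<lambda>i \<omega>. D i (snd \<omega>))"
proof -
  let ?E = "\<pi> \<Otimes>\<^sub>M M"
  note M = driving_noiseD(1)[OF noise]
  interpret E: prob_space ?E using \<pi> M by (rule prob_space_pair)
  have "E.indep_sets (\<lambda>j. {snd -` S \<inter> space ?E |S. S \<in> (case_sum (\<lambda>i. random_measure_events M (arrival_intensity lam) (A i))
                 (\<lambda>i. random_measure_events M departure_intensity (D i))) j}) ({1..N} <+> {1..N})"
    by (rule indep_sets_pair_snd[OF \<pi> M driving_noiseD(4)[OF noise]])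
  then have "E.indep_sets (case_sum (\<lambda>i. random_measure_events ?E (arrival_intensity lam) (\<lambda>\<omega>. A i (snd \<omega>)))
                 (\<lambda>i. random_measure_events ?E departure_intensity (\<lambda>\<omega>. D i (snd \<omega>)))) ({1..N} <+> {1..N})"
  proof (rule E.indep_sets_mono_sets)
    fix j
    show "case_sum (\<lambda>i. random_measure_events ?E (arrival_intensity lam) (\<lambda>\<omega>. A i (snd \<omega>)))
        (\<lambda>i. random_measure_events ?E departure_intensity (\<lambda>\<omega>. D i (snd \<omega>))) j
      \<subseteq> {snd -` S \<inter> space ?E |S. S \<in> case_sum (\<lambda>i. random_measure_events M (arrival_intensity lam) (A i))
                 (\<lambda>i. random_measure_events M departure_intensity (D i)) j}"
      by (cases j) (simp_all only: sum.case random_measure_events_pair_snd order_refl)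
  qed
  then show ?thesis
    unfolding driving_noise_def
    by (intro conjI ballI E.prob_space_axioms poisson_random_measure_pair_snd[OF \<pi> M] driving_noiseD(2,3)[OF noise])
qed

text \<open>In the product space the initial condition depends on the first factor and the noise on the second.\<close>

lemma initial_indep_noise:
  assumes \<pi>: "prob_space \<pi>" and noise: "driving_noise M N lam A D"
    and X: "\<And>\<omega>. \<omega> \<in> space (\<pi> \<Otimes>\<^sub>M M) \<Longrightarrow> X \<omega> = fst \<omega>" and \<F>: "\<F> \<subseteq> sets \<pi>"
  shows "prob_space.indep_set (\<pi> \<Otimes>\<^sub>M M) {X -` S \<inter> space (\<pi> \<Otimes>\<^sub>M M) | S. S \<in> \<F>}
    (noise_events (\<pi> \<Otimes>\<^sub>M M) N lam (\<lambda>i \<omega>. A i (snd \<omega>)) (\<lambda>i \<omega>. D i (snd \<omega>)))"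
proof -
  let ?E = "\<pi> \<Otimes>\<^sub>M M"
  note M = driving_noiseD(1)[OF noise]
  interpret P: prob_space \<pi> by fact
  interpret M: prob_space M by fact
  interpret E: prob_space ?E using \<pi> M by (rule prob_space_pair)
  have snd_fun: "snd \<in> space ?E \<rightarrow> space M" by (auto simp: space_pair_measure)
  let ?V = "vimage_algebra (space ?E) snd M"
  have V: "sets ?V = {snd -` S \<inter> space ?E |S. S \<in> sets M}" by (rule sets_vimage_algebra2[OF snd_fun])
  have "noise_events ?E N lam (\<lambda>i \<omega>. A i (snd \<omega>)) (\<lambda>i \<omega>. D i (snd \<omega>)) \<subseteq> sets ?V"
  proof -
    have "random_measure_events ?E (arrival_intensity lam) (\<lambda>\<omega>. A i (snd \<omega>)) \<subseteq> sets ?V"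
      and "random_measure_events ?E departure_intensity (\<lambda>\<omega>. D i (snd \<omega>)) \<subseteq> sets ?V" if "i \<in> {1..N}" for i
      unfolding random_measure_events_pair_snd V
      using random_measure_events_subset_sets[OF driving_noiseD(2)[OF noise that]]
        random_measure_events_subset_sets[OF driving_noiseD(3)[OF noise that]] by blast+
    then have "sigma_sets (space ?V) (\<Union>i\<in>{1..N}. random_measure_events ?E (arrival_intensity lam) (\<lambda>\<omega>. A i (snd \<omega>))
        \<union> random_measure_events ?E departure_intensity (\<lambda>\<omega>. D i (snd \<omega>))) \<subseteq> sets ?V"
      by (intro sets.sigma_sets_subset UN_least Un_least)
    then show ?thesis unfolding noise_events_def by simp
  qed
  then have noise_form: "\<exists>T\<in>sets M. Z = snd -` T \<inter> space ?E"
    if "Z \<in> noise_events ?E N lam (\<lambda>i \<omega>. A i (snd \<omega>)) (\<lambda>i \<omega>. D i (snd \<omega>))" for Z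
    using that unfolding V by blast
  have init_form: "X -` S \<inter> space ?E = S \<times> space M" if "S \<in> sets \<pi>" for S
    using X sets.sets_into_space[OF that] by (auto simp: space_pair_measure)
  show ?thesis
  proof (rule E.indep_setI)
    show "{X -` S \<inter> space ?E | S. S \<in> \<F>} \<subseteq> E.events" using init_form \<F> by auto
    show "noise_events ?E N lam (\<lambda>i \<omega>. A i (snd \<omega>)) (\<lambda>i \<omega>. D i (snd \<omega>)) \<subseteq> E.events"
      using noise_form by (auto intro: measurable_sets[OF measurable_snd])
    fix a b assume a: "a \<in> {X -` S \<inter> space ?E | S. S \<in> \<F>}"
      and b: "b \<in> noise_events ?E N lam (\<lambda>i \<omega>. A i (snd \<omega>)) (\<lambda>i \<omega>. D i (snd \<omega>))"
    obtain S where S: "a = S \<times> space M" "S \<in> sets \<pi>" using a \<F> init_form by blast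
    obtain T where T: "b = snd -` T \<inter> space ?E" "T \<in> sets M" using noise_form[OF b] by blast
    have Tb: "b = space \<pi> \<times> T"
      unfolding T(1) using sets.sets_into_space[OF T(2)] by (auto simp: space_pair_measure)
    have "a \<inter> b = S \<times> T"
      unfolding S(1) Tb using sets.sets_into_space[OF S(2)] sets.sets_into_space[OF T(2)] by auto
    then have "E.prob (a \<inter> b) = P.prob S * M.prob T"
      using S(2) T(2) by (simp add: measure_def M.emeasure_pair_measure_Times enn2real_mult)
    moreover have "E.prob a = P.prob S"
      using S by (simp add: measure_def M.emeasure_pair_measure_Times M.emeasure_space_1)
    moreover have "E.prob b = M.prob T"
      using T(2) unfolding Tb by (simp add: measure_def M.emeasure_pair_measure_Times P.emeasure_space_1)
    ultimately show "E.prob (a \<inter> b) = E.prob a * E.prob b" by simp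
  qed
qed

section \<open>The mean-field feedback\<close>

lemma mf_rate_eq_service_rate:
  "mf_rate M B \<xi> q z = service_rate B \<xi> (measure M {\<omega>\<in>space M. 0 < q 1 z \<omega>})"
  by (simp add: mf_rate_def service_rate_def)

text \<open>Dominated convergence: the indicator of a busy queue is eventually constant to the left of \<open>z\<close> on almost every
  path.  The limit indicator is taken along one fixed sequence, which makes it measurable.\<close>

lemma busy_probability_left_limit:
  assumes "prob_space M" and meas: "\<And>s. 0 \<le> s \<Longrightarrow> q s \<in> M \<rightarrow>\<^sub>M count_space UNIV"
    and cad: "AE \<omega> in M. cadlag (\<lambda>t. q t \<omega> :: nat)" and z: "0 < z"
  shows "\<exists>L. 0 \<le> L \<and> ((\<lambda>s. measure M {\<omega>\<in>space M. 0 < q s \<omega>}) \<longlongrightarrow> L) (at_left z)"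
proof -
  interpret prob_space M by fact
  define g where "g = (\<lambda>s \<omega>. indicator {\<omega>\<in>space M. 0 < q s \<omega>} \<omega> :: real)"
  have set_g: "{\<omega>\<in>space M. 0 < q s \<omega>} \<in> events" if "0 \<le> s" for s
    using measurable_sets[OF meas[OF that], of "{0<..}"] by (simp add: vimage_def Int_def conj_commute)
  have g_meas: "g s \<in> borel_measurable M" if "0 \<le> s" for s
    unfolding g_def using set_g[OF that] by simp
  have g_int: "integral\<^sup>L M (g s) = prob {\<omega>\<in>space M. 0 < q s \<omega>}" for s
    unfolding g_def by (simp add: Int_def conj_commute)
  have conv: "((\<lambda>s. g s \<omega>) \<longlongrightarrow> of_bool (0 < left_lim (\<lambda>t. q t \<omega>) z)) (at_left z)"
    if "cadlag (\<lambda>t. q t \<omega>)" "\<omega> \<in> space M" for \<omega>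
  proof (rule tendsto_eventually)
    show "\<forall>\<^sub>F s in at_left z. g s \<omega> = of_bool (0 < left_lim (\<lambda>t. q t \<omega>) z)"
      using cadlag_left_lim[OF that(1) z] unfolding tendsto_discrete
      by eventually_elim (use that(2) in \<open>simp add: g_def indicator_def\<close>)
  qed
  define s0 where "s0 = (\<lambda>n. z - z / real (Suc (Suc n)))"
  have s0: "0 \<le> s0 n" "s0 n < z" for n using z by (auto simp: s0_def divide_le_eq)
  have "s0 \<longlonglongrightarrow> z - z * 0"
    unfolding s0_def divide_inverse
    by (intro tendsto_intros LIMSEQ_Suc[OF LIMSEQ_inverse_real_of_nat])
  then have s0_lim: "filterlim s0 (at_left z) sequentially"
    unfolding filterlim_at using s0 by (simp add: less_imp_neq)
  define l where "l = (\<lambda>\<omega>. lim (\<lambda>n. g (s0 n) \<omega>))"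
  have l_meas: "l \<in> borel_measurable M"
    unfolding l_def by (intro borel_measurable_lim_metric g_meas s0)
  have l_eq: "l \<omega> = of_bool (0 < left_lim (\<lambda>t. q t \<omega>) z)"
    if "cadlag (\<lambda>t. q t \<omega>)" "\<omega> \<in> space M" for \<omega>
    unfolding l_def by (rule limI[OF filterlim_compose[OF conv[OF that] s0_lim]])
  have lim: "((\<lambda>s. prob {\<omega>\<in>space M. 0 < q s \<omega>}) \<longlongrightarrow> integral\<^sup>L M l) (at_left z)"
  proof (rule tendsto_at_left_sequentially[OF z])
    fix S assume S: "\<And>n. S n < z" "\<And>n. 0 < S n" "S \<longlonglongrightarrow> z"
    have S_lim: "filterlim S (at_left z) sequentially"
      unfolding filterlim_at using S by (simp add: less_imp_neq)
    have "(\<lambda>n. integral\<^sup>L M (g (S n))) \<longlonglongrightarrow> integral\<^sup>L M l"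
    proof (rule integral_dominated_convergence[where w = "\<lambda>_. 1"])
      show "AE \<omega> in M. (\<lambda>n. g (S n) \<omega>) \<longlonglongrightarrow> l \<omega>"
        using cad AE_space
        by eventually_elim (use filterlim_compose[OF conv S_lim] l_eq in simp)
      show "g (S n) \<in> borel_measurable M" for n by (rule g_meas[OF less_imp_le[OF S(2)]])
    qed (use l_meas in \<open>auto simp: g_def indicator_def\<close>)
    then show "(\<lambda>n. prob {\<omega>\<in>space M. 0 < q (S n) \<omega>}) \<longlonglongrightarrow> integral\<^sup>L M l"
      by (simp only: g_int)
  qed
  have "0 \<le> integral\<^sup>L M l"
    by (rule tendsto_lowerbound[OF lim]) (auto intro: always_eventually)
  with lim show ?thesis by blast
qed

lemma service_rate_tendsto:
  assumes "(p \<longlongrightarrow> L) F" "0 \<le> L" "0 \<le> \<xi>"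
  shows "((\<lambda>s. service_rate B \<xi> (p s)) \<longlongrightarrow> service_rate B \<xi> L) F"
proof -
  have L: "0 \<le> L * \<xi>" using assms by simp
  then have "1 + L * \<xi> \<noteq> 0" "0 < 1 + 1 / (1 + L * \<xi>)" by (auto intro: add_pos_nonneg)
  then show ?thesis
    unfolding service_rate_def log_def by (intro tendsto_intros assms(1)) auto
qed

locale mf_solution =
  fixes M :: "'w measure" and N :: nat and lam B \<xi> :: real and A D q
  assumes sol: "MF1_solution M N lam B \<xi> A D q"
    and N: "1 \<le> N" and lam: "0 < lam" and B: "0 < B" and xi: "0 \<le> \<xi>"
begin

lemma noise: "driving_noise M N lam A D"
  and queue_measurable: "i \<in> {1..N} \<Longrightarrow> 0 \<le> t \<Longrightarrow> q i t \<in> M \<rightarrow>\<^sub>M count_space UNIV"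
  and initial_indep: "prob_space.indep_set M
       {queue_state N q 0 -` S \<inter> space M | S. S \<in> sets (state_space N)} (noise_events M N lam A D)"
  and path: "AE \<omega> in M. \<forall>i\<in>{1..N}. queue_path (A i \<omega>) (D i \<omega>) (left_lim (mf_rate M B \<xi> q)) (\<lambda>t. q i t \<omega>)"
  using sol unfolding MF1_solution_def queue_path_def MF1_equation_def by blast+

sublocale prob_space M
  by (rule driving_noiseD(1)[OF noise])

abbreviation busy :: "real \<Rightarrow> real" where
  "busy z \<equiv> prob {\<omega>\<in>space M. 0 < q 1 z \<omega>}"

lemma mf_rate_left_lim:
  assumes "0 < z"
  shows "(mf_rate M B \<xi> q \<longlongrightarrow> left_lim (mf_rate M B \<xi> q) z) (at_left z)"
proof -
  have "AE \<omega> in M. cadlag (\<lambda>t. q 1 t \<omega>)"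
    using path by eventually_elim (use N in \<open>auto simp: queue_path_def\<close>)
  from busy_probability_left_limit[OF prob_space_axioms _ this assms] queue_measurable[of 1] N
  obtain L where L: "0 \<le> L" "(busy \<longlongrightarrow> L) (at_left z)" by auto
  have "(mf_rate M B \<xi> q \<longlongrightarrow> service_rate B \<xi> L) (at_left z)"
    using service_rate_tendsto[OF L(2,1) xi] by (simp only: mf_rate_eq_service_rate[abs_def])
  moreover from tendsto_Lim[OF _ this] have "left_lim (mf_rate M B \<xi> q) z = service_rate B \<xi> L"
    using assms by (simp add: left_lim_def)
  ultimately show ?thesis by simp
qed

lemma mf_rate_left_lim_closed:
  assumes "0 \<le> z" "closed S" "\<And>y. 0 \<le> y \<Longrightarrow> y \<le> z \<Longrightarrow> mf_rate M B \<xi> q y \<in> S"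
  shows "left_lim (mf_rate M B \<xi> q) z \<in> S"
proof (cases "z = 0")
  case True
  then show ?thesis using assms by (simp add: left_lim_def)
next
  case False
  with assms(1) have "0 < z" by simp
  from left_lim_mem_closed[OF mf_rate_left_lim[OF this] assms(2) this] assms(3)
  show ?thesis by simp
qed

lemma mf_rate_le: "mf_rate M B \<xi> q z \<le> B"
  unfolding mf_rate_eq_service_rate by (rule service_rate_le[OF B xi]) simp

text \<open>A bound on the distance between the rate and \<open>r\<close> passes to left limits, so the comparison with the walk applies
  to a McKean--Vlasov solution.\<close>

lemma law_close:
  assumes p: "set_pmf p \<subseteq> PiE {1..N} (\<lambda>_. UNIV)"
      "\<And>S. S \<in> sets (state_space N) \<Longrightarrow> prob {\<omega>\<in>space M. queue_state N q 0 \<omega> \<in> S} = measure_pmf.prob p S"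
    and r: "0 < r" "r \<le> B" and t: "0 < t" "0 < n" and T0: "0 \<le> T0" "T0 \<le> t"
    and near: "\<And>z. 0 \<le> z \<Longrightarrow> z \<le> T0 \<Longrightarrow> mf_rate M B \<xi> q z = r"
      "\<And>z. 0 \<le> z \<Longrightarrow> z \<le> t \<Longrightarrow> \<bar>mf_rate M B \<xi> q z - r\<bar> \<le> \<epsilon>"
    and S: "S \<in> sets (state_space N)"
  shows "\<bar>prob {\<omega>\<in>space M. queue_state N q t \<omega> \<in> S}
      - measure_pmf.prob (walk_law N n (lam * t / n) (r * t / n) p) S\<bar>
    \<le> N * (((lam + B) * t)\<^sup>2 / n + 2 * \<epsilon> * (t - T0))"
proof (rule law_close_to_walk_law[OF noise lam r(1) t N r(2) queue_measurable initial_indep _ _ path _ _ _ _ T0 S])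
  show "x \<in> PiE {1..N} (\<lambda>_. UNIV)" if "x \<in> set_pmf p" for x using that p(1) by blast
  show "prob {\<omega>\<in>space M. queue_state N q 0 \<omega> = x} = pmf p x" if "x \<in> set_pmf p" for x
  proof -
    have "{x} \<in> sets (state_space N)" unfolding sets_state_space using that p(1) by blast
    from p(2)[OF this] show ?thesis by (simp add: measure_pmf_single)
  qed
  show "left_lim (mf_rate M B \<xi> q) \<in> borel_measurable borel"
    by (rule borel_measurable_left_lim[OF mf_rate_left_lim])
  show "left_lim (mf_rate M B \<xi> q) z \<le> B" if "0 \<le> z" "z \<le> t" for z
    using mf_rate_left_lim_closed[OF that(1), of "{..B}"] mf_rate_le by simp
  show "left_lim (mf_rate M B \<xi> q) z = r" if "0 \<le> z" "z \<le> T0" for z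
    using mf_rate_left_lim_closed[OF that(1), of "{r}"] near(1) that(2) by simp
  show "\<bar>left_lim (mf_rate M B \<xi> q) z - r\<bar> \<le> \<epsilon>" if "0 \<le> z" "z \<le> t" for z
  proof -
    have "left_lim (mf_rate M B \<xi> q) z \<in> cball r \<epsilon>"
      using near(2) that(2)
      by (intro mf_rate_left_lim_closed[OF that(1)]) (auto simp: dist_real_def abs_minus_commute)
    then show ?thesis by (simp add: dist_real_def abs_minus_commute)
  qed
qed auto

end

lemma le_of_le_add_inverse_nat:
  fixes x C e :: real
  assumes "\<And>n. 0 < n \<Longrightarrow> x \<le> C / real n + e"
  shows "x \<le> e"
proof (rule LIMSEQ_le_const)
  have "(\<lambda>n. C * inverse (real (Suc n)) + e) \<longlonglongrightarrow> C * 0 + e"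
    by (intro tendsto_intros LIMSEQ_inverse_real_of_nat)
  then show "(\<lambda>n. C / real (Suc n) + e) \<longlonglongrightarrow> e" by (simp add: divide_inverse)
  show "\<exists>m. \<forall>n\<ge>m. x \<le> C / real (Suc n) + e" using assms by blast
qed

lemma geometric_states_busy:
  assumes "1 \<le> N" "0 < x" "x < 1"
  shows "measure_pmf.prob (geometric_states N x) {y\<in>PiE {1..N} (\<lambda>_. UNIV). 0 < y 1} = x"
proof -
  have "measure_pmf.prob (geometric_states N x) {y\<in>PiE {1..N} (\<lambda>_. UNIV). 0 < y 1}
      = measure_pmf.prob (geometric_states N x) {y. 0 < y 1}"
    using set_geometric_states[of N x]
    by (intro measure_pmf.finite_measure_eq_AE) (auto simp: AE_measure_pmf_iff)
  also have "\<dots> = measure_pmf.prob (map_pmf (\<lambda>y. y 1) (geometric_states N x)) {0<..}"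
    by (simp add: vimage_def)
  also have "map_pmf (\<lambda>y. y 1) (geometric_states N x) = geometric_pmf (1 - x)"
    using assms by (subst Pi_pmf_component) auto
  also have "{0<..} = - {0::nat}" by auto
  also have "measure_pmf.prob (geometric_pmf (1 - x)) (- {0}) = 1 - pmf (geometric_pmf (1 - x)) 0"
    by (simp add: measure_pmf.prob_compl[of "{0}", simplified] Compl_eq_Diff_UNIV measure_pmf_single)
  finally show ?thesis using assms by simp
qed

context mf_solution
begin

lemma busy_eq_event:
  "busy t = prob {\<omega>\<in>space M. queue_state N q t \<omega> \<in> {y\<in>PiE {1..N} (\<lambda>_. UNIV). 0 < y 1}}"
  using N by (intro arg_cong[where f = prob]) (auto simp: queue_state_def)

text \<open>Gronwall's argument on intervals of length \<open>\<eta>\<close>.  Suppose the busy probability is \<open>x\<close> up to \<open>j \<eta>\<close> and within \<open>\<delta>\<close> of \<open>x\<close> up to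
  \<open>(j + 1) \<eta>\<close>.  The rate is then within \<open>C \<delta>\<close> of its stationary value, the walk keeps its geometric
  law, and the comparison gives the better bound \<open>2 N C \<eta> \<delta> \<le> \<delta> / 2\<close>.\<close>

lemma busy_constant:
  assumes x: "0 < x" "x < 1" "x * service_rate B \<xi> x = lam"
    and init: "\<And>S. S \<in> sets (state_space N) \<Longrightarrow>
      prob {\<omega>\<in>space M. queue_state N q 0 \<omega> \<in> S} = measure_pmf.prob (geometric_states N x) S"
    and t: "0 \<le> t"
  shows "busy t = x"
proof -
  let ?r = "service_rate B \<xi> x"
  let ?S = "{y\<in>PiE {1..N} (\<lambda>_. UNIV :: nat set). 0 < y 1}"
  have S: "?S \<in> sets (state_space N)" unfolding sets_state_space by blast
  have r: "0 < ?r" "?r \<le> B" using service_rate_pos service_rate_le B xi x by auto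
  have geo: "measure_pmf.prob (geometric_states N x) ?S = x" by (rule geometric_states_busy[OF N x(1,2)])
  define C where "C = 2 * B * \<xi> / ln 2"
  have C0: "0 \<le> C" using B xi by (simp add: C_def)
  have lip: "\<bar>mf_rate M B \<xi> q z - ?r\<bar> \<le> C * \<bar>busy z - x\<bar>" for z
    unfolding mf_rate_eq_service_rate C_def using B xi x by (intro service_rate_lipschitz) auto
  \<comment> \<open>a length on which one comparison halves the error\<close>
  define \<eta> where "\<eta> = 1 / (4 * (real N * C + 1))"
  have eta: "0 < \<eta>" "real N * (2 * C * \<eta>) \<le> 1 / 2"
  proof -
    have NC: "0 \<le> real N * C" using C0 by simp
    then show "0 < \<eta>" by (simp add: \<eta>_def)
    have "real N * (2 * C * \<eta>) = (real N * C) / (2 * (real N * C + 1))"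
      using NC by (simp add: \<eta>_def field_simps)
    also have "\<dots> \<le> 1 / 2" using NC by (simp add: divide_le_eq)
    finally show "real N * (2 * C * \<eta>) \<le> 1 / 2" .
  qed
  have busy0: "busy 0 = x" using init[OF S] geo busy_eq_event[of 0] by simp
  have "busy t = x" if "0 \<le> t" "t \<le> real j * \<eta>" for j t
    using that
  proof (induction j arbitrary: t)
    case 0
    then show ?case using busy0 by simp
  next
    case (Suc j)
    let ?T = "real j * \<eta>"
    have T: "0 \<le> ?T" using eta by simp
    have step: "\<bar>busy t - x\<bar> \<le> (1 / 2) ^ m" if "0 \<le> t" "t \<le> real (Suc j) * \<eta>" for m t
      using that
    proof (induction m arbitrary: t)
      case 0
      have "0 \<le> busy t" "busy t \<le> 1" by auto
      then show ?case using x(1,2) by (simp only: power_0 abs_le_iff) linarith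
    next
      case (Suc m)
      show ?case
      proof (cases "t \<le> ?T")
        case True
        then show ?thesis using \<open>\<And>t. 0 \<le> t \<Longrightarrow> t \<le> ?T \<Longrightarrow> busy t = x\<close> Suc.prems by simp
      next
        case False
        have "real (Suc j) * \<eta> = ?T + \<eta>" by (simp add: algebra_simps)
        then have t: "0 < t" "?T \<le> t" "t - ?T \<le> \<eta>" using False T Suc.prems by linarith+
        let ?e = "C * (1 / 2) ^ m"
        have "\<bar>busy t - x\<bar> \<le> real N * ((lam + B) * t)\<^sup>2 / real n + real N * (2 * ?e * (t - ?T))"
          if n: "0 < n" for n
        proof -
          have "\<bar>prob {\<omega>\<in>space M. queue_state N q t \<omega> \<in> ?S}
              - measure_pmf.prob (walk_law N n (lam * t / n) (?r * t / n) (geometric_states N x)) ?S\<bar>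
            \<le> N * (((lam + B) * t)\<^sup>2 / n + 2 * ?e * (t - ?T))"
          proof (rule law_close[OF set_geometric_states init r(1,2) t(1) n T t(2) _ _ S])
            show "mf_rate M B \<xi> q z = ?r" if "0 \<le> z" "z \<le> ?T" for z
              using \<open>\<And>t. 0 \<le> t \<Longrightarrow> t \<le> ?T \<Longrightarrow> busy t = x\<close>[OF that] by (simp add: mf_rate_eq_service_rate)
            show "\<bar>mf_rate M B \<xi> q z - ?r\<bar> \<le> ?e" if "0 \<le> z" "z \<le> t" for z
            proof -
              have "\<bar>busy z - x\<bar> \<le> (1 / 2) ^ m" using Suc.IH[of z] that Suc.prems by simp
              then have "C * \<bar>busy z - x\<bar> \<le> ?e" using C0 by (rule mult_left_mono)
              with lip[of z] show ?thesis by simp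
            qed
          qed
          moreover have "walk_law N n (lam * t / n) (?r * t / n) (geometric_states N x) = geometric_states N x"
            using lam t(1) n r(1) x(2,3) by (rule walk_law_geometric_states_grid)
          ultimately show ?thesis using geo busy_eq_event[of t] by (simp add: distrib_left)
        qed
        then have "\<bar>busy t - x\<bar> \<le> real N * (2 * ?e * (t - ?T))" by (rule le_of_le_add_inverse_nat)
        also have "\<dots> \<le> real N * (2 * ?e * \<eta>)"
          using t C0 by (intro mult_left_mono) auto
        also have "\<dots> = (real N * (2 * C * \<eta>)) * (1 / 2) ^ m" by simp
        also have "\<dots> \<le> 1 / 2 * (1 / 2) ^ m" using eta by (intro mult_right_mono) auto
        finally show ?thesis by simp
      qed
    qed
    have "(\<lambda>m. (1 / 2 :: real) ^ m) \<longlonglongrightarrow> 0" by (intro LIMSEQ_realpow_zero) auto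
    then have "\<bar>busy t - x\<bar> \<le> 0" using step[OF Suc.prems] by (intro LIMSEQ_le_const) auto
    then show ?case by simp
  qed
  moreover obtain j :: nat where "t < real j * \<eta>" using ex_less_of_nat_mult[OF eta(1)] by blast
  ultimately show ?thesis using t by (meson less_imp_le)
qed

lemma law_constant_rate:
  assumes p: "set_pmf p \<subseteq> PiE {1..N} (\<lambda>_. UNIV)"
      "\<And>S. S \<in> sets (state_space N) \<Longrightarrow> prob {\<omega>\<in>space M. queue_state N q 0 \<omega> \<in> S} = measure_pmf.prob p S"
    and busy: "\<And>z. 0 \<le> z \<Longrightarrow> busy z = c" and t: "0 < t" "0 < n" and S: "S \<in> sets (state_space N)"
  shows "\<bar>prob {\<omega>\<in>space M. queue_state N q t \<omega> \<in> S}
      - measure_pmf.prob (walk_law N n (lam * t / n) (service_rate B \<xi> c * t / n) p) S\<bar>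
    \<le> N * ((lam + B) * t)\<^sup>2 / n"
proof -
  have c: "0 \<le> c" using busy[of 0] by auto
  have "\<bar>prob {\<omega>\<in>space M. queue_state N q t \<omega> \<in> S}
      - measure_pmf.prob (walk_law N n (lam * t / n) (service_rate B \<xi> c * t / n) p) S\<bar>
    \<le> N * (((lam + B) * t)\<^sup>2 / n + 2 * 0 * (t - t))"
    using service_rate_pos[OF B xi c] service_rate_le[OF B xi c] t busy
    by (intro law_close[OF p _ _ t _ _ _ _ S]) (auto simp: mf_rate_eq_service_rate)
  then show ?thesis by simp
qed

lemma geometric_law_preserved:
  assumes x: "0 < x" "x < 1" "x * service_rate B \<xi> x = lam"
    and init: "\<And>S. S \<in> sets (state_space N) \<Longrightarrow>
      prob {\<omega>\<in>space M. queue_state N q 0 \<omega> \<in> S} = measure_pmf.prob (geometric_states N x) S"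
    and t: "0 \<le> t" and S: "S \<in> sets (state_space N)"
  shows "prob {\<omega>\<in>space M. queue_state N q t \<omega> \<in> S} = measure_pmf.prob (geometric_states N x) S"
proof (cases "t = 0")
  case False
  with t have t: "0 < t" by simp
  let ?r = "service_rate B \<xi> x"
  have r: "0 < ?r" using service_rate_pos B xi x by auto
  have "\<bar>prob {\<omega>\<in>space M. queue_state N q t \<omega> \<in> S} - measure_pmf.prob (geometric_states N x) S\<bar>
      \<le> N * ((lam + B) * t)\<^sup>2 / real n + 0" if n: "0 < n" for n :: nat
  proof -
    have "walk_law N n (lam * t / n) (?r * t / n) (geometric_states N x) = geometric_states N x"
      using lam t n r x(2,3) by (rule walk_law_geometric_states_grid)
    with law_constant_rate[OF set_geometric_states init busy_constant[OF x init] t n S] show ?thesis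
      by simp
  qed
  then have "\<bar>prob {\<omega>\<in>space M. queue_state N q t \<omega> \<in> S} - measure_pmf.prob (geometric_states N x) S\<bar> \<le> 0"
    by (rule le_of_le_add_inverse_nat)
  then show ?thesis by simp
qed (use init[OF S] in simp)

text \<open>Stationarity makes the rate constant, so the law at time \<open>j + 1\<close> is both the given one and, up to a vanishing
  error, that of the walk with that rate, which forgets its initial state.\<close>

lemma stationary_law_geometric:
  assumes p: "set_pmf p \<subseteq> PiE {1..N} (\<lambda>_. UNIV)"
      "\<And>S t. S \<in> sets (state_space N) \<Longrightarrow> 0 \<le> t \<Longrightarrow>
        prob {\<omega>\<in>space M. queue_state N q t \<omega> \<in> S} = measure_pmf.prob p S"
    and stable: "lam < service_rate B \<xi> (busy 0)" and S: "S \<in> sets (state_space N)"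
  shows "measure_pmf.prob p S = measure_pmf.prob (geometric_states N (lam / service_rate B \<xi> (busy 0))) S"
proof -
  let ?r = "service_rate B \<xi> (busy 0)"
  let ?S = "{y\<in>PiE {1..N} (\<lambda>_. UNIV :: nat set). 0 < y 1}"
  have S1: "?S \<in> sets (state_space N)" unfolding sets_state_space by blast
  have const: "busy z = busy 0" if "0 \<le> z" for z
    by (simp only: busy_eq_event p(2)[OF S1 that] p(2)[OF S1 order_refl])
  let ?w = "\<lambda>j. measure_pmf.prob (walk_law N (Suc j ^ 3) (lam * real (Suc j) / real (Suc j ^ 3))
      (?r * real (Suc j) / real (Suc j ^ 3)) p) S"
  have bound: "\<bar>measure_pmf.prob p S - ?w j\<bar> \<le> N * (lam + B)\<^sup>2 * inverse (real (Suc j))" for j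
  proof -
    have "real N * ((lam + B) * s)\<^sup>2 / s ^ 3 = N * (lam + B)\<^sup>2 * inverse s" if "0 < s" for s
      using that by (simp add: power2_eq_square power3_eq_cube field_simps)
    from this[of "real (Suc j)"]
    have "real N * ((lam + B) * real (Suc j))\<^sup>2 / real (Suc j ^ 3) = N * (lam + B)\<^sup>2 * inverse (real (Suc j))"
      by (simp only: of_nat_power of_nat_0_less_iff zero_less_Suc)
    with law_constant_rate[OF p(1) p(2) const, of "real (Suc j)" "Suc j ^ 3" S] S p(2)[OF S]
    show ?thesis by simp
  qed
  have "(\<lambda>j. N * (lam + B)\<^sup>2 * inverse (real (Suc j))) \<longlonglongrightarrow> N * (lam + B)\<^sup>2 * 0"
    by (intro tendsto_intros LIMSEQ_inverse_real_of_nat)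
  then have "(\<lambda>j. N * (lam + B)\<^sup>2 * inverse (real (Suc j))) \<longlonglongrightarrow> 0" by simp
  then have "(\<lambda>j. \<bar>measure_pmf.prob p S - ?w j\<bar>) \<longlonglongrightarrow> 0"
    by (rule tendsto_sandwich[OF _ _ tendsto_const, rotated -1]) (use bound in \<open>simp_all add: always_eventually\<close>)
  then have "(\<lambda>j. measure_pmf.prob p S - ?w j) \<longlonglongrightarrow> 0" by (simp only: tendsto_rabs_zero_iff)
  then have "(\<lambda>j. measure_pmf.prob p S - (measure_pmf.prob p S - ?w j)) \<longlonglongrightarrow> measure_pmf.prob p S - 0"
    by (intro tendsto_diff tendsto_const)
  then have "?w \<longlonglongrightarrow> measure_pmf.prob p S" by simp
  moreover have "?w \<longlonglongrightarrow> measure_pmf.prob (geometric_states N (lam / ?r)) S"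
    by (rule walk_law_tendsto_geometric[OF lam stable])
  ultimately show ?thesis by (rule LIMSEQ_unique)
qed

end

section \<open>Construction of a solution by reflection\<close>

text \<open>The amount of unused service before \<open>t\<close>, that is the running maximum of \<open>d - (a + x)\<close>; natural subtraction
  supplies the positive part.  Only rational times and \<open>t\<close> itself enter, which keeps the maximum measurable in
  the noise.\<close>

definition overflow :: "(real \<Rightarrow> nat) \<Rightarrow> (real \<Rightarrow> nat) \<Rightarrow> nat \<Rightarrow> real \<Rightarrow> nat" where
  "overflow a d x t = (LEAST k. d t - (a t + x) \<le> k \<and>
    (\<forall>p::rat. 0 \<le> real_of_rat p \<and> real_of_rat p \<le> t \<longrightarrow> d (real_of_rat p) - (a (real_of_rat p) + x) \<le> k))"

text \<open>Skorokhod reflection at \<open>0\<close> of the free path \<open>x + a - d\<close>.\<close>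

definition reflected :: "(real \<Rightarrow> nat) \<Rightarrow> (real \<Rightarrow> nat) \<Rightarrow> nat \<Rightarrow> real \<Rightarrow> nat" where
  "reflected a d x t = x + a t + overflow a d x t - d t"

lemma overflow_least:
  assumes "d t - (a t + x) \<le> k"
    "\<And>p::rat. 0 \<le> real_of_rat p \<Longrightarrow> real_of_rat p \<le> t \<Longrightarrow> d (real_of_rat p) - (a (real_of_rat p) + x) \<le> k"
  shows "overflow a d x t \<le> k"
  unfolding overflow_def using assms by (intro Least_le) blast

lemma overflow_ge:
  assumes mono: "mono_on {0..} d" and t: "0 \<le> t"
  shows "d t - (a t + x) \<le> overflow a d x t"
    and "0 \<le> real_of_rat p \<Longrightarrow> real_of_rat p \<le> t \<Longrightarrow> d (real_of_rat p) - (a (real_of_rat p) + x) \<le> overflow a d x t"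
proof -
  have "d (real_of_rat p) - (a (real_of_rat p) + x) \<le> d t" if "0 \<le> real_of_rat p" "real_of_rat p \<le> t" for p
    using mono_onD[OF mono, of "real_of_rat p" t] that t by simp
  then have "d t - (a t + x) \<le> d t \<and>
    (\<forall>p::rat. 0 \<le> real_of_rat p \<and> real_of_rat p \<le> t \<longrightarrow> d (real_of_rat p) - (a (real_of_rat p) + x) \<le> d t)"
    by auto
  from LeastI[of "\<lambda>k. d t - (a t + x) \<le> k \<and>
    (\<forall>p::rat. 0 \<le> real_of_rat p \<and> real_of_rat p \<le> t \<longrightarrow> d (real_of_rat p) - (a (real_of_rat p) + x) \<le> k)", OF this]
  show "d t - (a t + x) \<le> overflow a d x t"
    and "0 \<le> real_of_rat p \<Longrightarrow> real_of_rat p \<le> t \<Longrightarrow> d (real_of_rat p) - (a (real_of_rat p) + x) \<le> overflow a d x t"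
    unfolding overflow_def by blast+
qed

lemma reflected_unchanged:
  assumes mono: "mono_on {0..} a" "mono_on {0..} d" and t: "0 \<le> t" "t \<le> z" and eq: "a z = a t" "d z = d t"
  shows "reflected a d x z = reflected a d x t"
proof -
  have const: "a y = a t" "d y = d t" if "t \<le> y" "y \<le> z" for y
    using mono_onD[OF mono(1), of t y] mono_onD[OF mono(1), of y z]
      mono_onD[OF mono(2), of t y] mono_onD[OF mono(2), of y z] that t eq by auto
  have "overflow a d x z = overflow a d x t"
  proof (rule antisym)
    show "overflow a d x z \<le> overflow a d x t"
    proof (rule overflow_least)
      show "d z - (a z + x) \<le> overflow a d x t"
        unfolding eq by (rule overflow_ge(1)[OF mono(2) t(1)])
      fix p assume p: "0 \<le> real_of_rat p" "real_of_rat p \<le> z"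
      show "d (real_of_rat p) - (a (real_of_rat p) + x) \<le> overflow a d x t"
      proof (cases "real_of_rat p \<le> t")
        case True
        then show ?thesis by (rule overflow_ge(2)[OF mono(2) t(1) p(1)])
      next
        case False
        then have "a (real_of_rat p) = a t" "d (real_of_rat p) = d t"
            using const[of "real_of_rat p"] p by simp_all
        then show ?thesis using overflow_ge(1)[where a = a and x = x, OF mono(2) t(1)] by simp
      qed
    qed
    show "overflow a d x t \<le> overflow a d x z"
    proof (rule overflow_least)
      show "d t - (a t + x) \<le> overflow a d x z"
        using overflow_ge(1)[where a = a and x = x and t = z, OF mono(2)] t eq by simp
      fix p assume "0 \<le> real_of_rat p" "real_of_rat p \<le> t"
      then show "d (real_of_rat p) - (a (real_of_rat p) + x) \<le> overflow a d x z"
        using t by (intro overflow_ge(2)[OF mono(2)]) auto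
    qed
  qed
  then show ?thesis by (simp add: reflected_def eq)
qed

text \<open>The starting time must be rational: then it is among the times over which \<open>overflow\<close> takes its maximum.\<close>

lemma reflected_step:
  assumes mono: "mono_on {0..} a" "mono_on {0..} d" and s: "0 \<le> s" "s \<in> \<rat>" "s \<le> z"
    and one: "(a z - a s) + (d z - d s) \<le> 1"
  shows "reflected a d x z = reflected a d x s + (a z - a s) - (d z - d s)"
proof -
  obtain ps where ps: "s = real_of_rat ps" using s(2) by (auto simp: Rats_def)
  have z: "0 \<le> z" using s by simp
  have le: "a s \<le> a z" "d s \<le> d z" using mono_onD[OF mono(1), of s z] mono_onD[OF mono(2), of s z] s z by auto
  have mid: "a s \<le> a y" "a y \<le> a z" "d s \<le> d y" "d y \<le> d z" if "s \<le> y" "y \<le> z" for y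
    using mono_onD[OF mono(1), of s y] mono_onD[OF mono(1), of y z]
      mono_onD[OF mono(2), of s y] mono_onD[OF mono(2), of y z] that s by auto
  have up: "overflow a d x s \<le> overflow a d x z"
  proof (rule overflow_least)
    show "d s - (a s + x) \<le> overflow a d x z"
      unfolding ps using s ps by (intro overflow_ge(2)[OF mono(2) z]) auto
    fix p assume "0 \<le> real_of_rat p" "real_of_rat p \<le> s"
    then show "d (real_of_rat p) - (a (real_of_rat p) + x) \<le> overflow a d x z"
      using s by (intro overflow_ge(2)[OF mono(2) z]) auto
  qed
  have ge_s: "d s - (a s + x) \<le> overflow a d x s" by (rule overflow_ge(1)[OF mono(2) s(1)])
  have ge_z: "d z - (a z + x) \<le> overflow a d x z" by (rule overflow_ge(1)[OF mono(2) z])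
  show ?thesis
  proof (cases "d z = d s")
    case True
    have "overflow a d x z \<le> overflow a d x s"
    proof (rule overflow_least)
      show "d z - (a z + x) \<le> overflow a d x s" using ge_s le True by simp
      fix p assume p: "0 \<le> real_of_rat p" "real_of_rat p \<le> z"
      show "d (real_of_rat p) - (a (real_of_rat p) + x) \<le> overflow a d x s"
      proof (cases "real_of_rat p \<le> s")
        case True
        then show ?thesis by (rule overflow_ge(2)[OF mono(2) s(1) p(1)])
      next
        case False
        then show ?thesis using mid[of "real_of_rat p"] p ge_s True by simp
      qed
    qed
    with up have "overflow a d x z = overflow a d x s" by simp
    then show ?thesis using True ge_s le by (simp add: reflected_def)
  next
    case False
    then have a: "a z = a s" and d: "d z = Suc (d s)" using one le by auto
    have "overflow a d x z \<le> max (overflow a d x s) (d z - (a s + x))"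
    proof (rule overflow_least)
      fix p assume p: "0 \<le> real_of_rat p" "real_of_rat p \<le> z"
      show "d (real_of_rat p) - (a (real_of_rat p) + x) \<le> max (overflow a d x s) (d z - (a s + x))"
      proof (cases "real_of_rat p \<le> s")
        case True
        then have "d (real_of_rat p) - (a (real_of_rat p) + x) \<le> overflow a d x s"
          by (rule overflow_ge(2)[OF mono(2) s(1) p(1)])
        then show ?thesis by simp
      next
        case False
        then show ?thesis using mid[of "real_of_rat p"] p by simp
      qed
    qed (simp add: a)
    then have "overflow a d x z = max (overflow a d x s) (d z - (a s + x))" using up ge_z a by simp
    then show ?thesis using ge_s by (simp add: reflected_def a d)
  qed
qed

lemma reflected_0:
  assumes "a 0 = 0" "d 0 = 0"
  shows "reflected a d x 0 = x"
proof -
  have "overflow a d x 0 \<le> 0"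
  proof (rule overflow_least)
    fix p assume "0 \<le> real_of_rat p" "real_of_rat p \<le> 0"
    then have "real_of_rat p = 0" by simp
    then show "d (real_of_rat p) - (a (real_of_rat p) + x) \<le> 0" using assms by simp
  qed (simp add: assms)
  then show ?thesis by (simp add: reflected_def assms)
qed

text \<open>The measures tend to \<open>0\<close> and are integers.\<close>

lemma integer_valued_vanishes:
  assumes X: "integer_valued \<nu> X" and S: "\<And>n. S n \<in> sets \<nu>" "decseq S" "(\<Inter>n. S n) = {}"
    and fin: "\<And>n. emeasure X (S n) < \<infinity>"
  shows "\<exists>n::nat. emeasure X (S n) = 0"
proof -
  have sets: "sets X = sets \<nu>" using X by (simp add: integer_valued_def)
  have "(\<lambda>n. emeasure X (S n)) \<longlonglongrightarrow> emeasure X (\<Inter>n. S n)"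
    using S(1,2) fin by (intro Lim_emeasure_decseq) (auto simp: sets less_imp_neq)
  then have "(\<lambda>n. emeasure X (S n)) \<longlonglongrightarrow> 0" by (simp add: S(3))
  then have "\<forall>\<^sub>F n in sequentially. emeasure X (S n) < 1" by (rule order_tendstoD) simp
  then obtain n where n: "emeasure X (S n) < 1" by (auto simp: eventually_sequentially)
  have "emeasure X (S n) = of_nat (ncount X (S n))" by (rule integer_valued_count(1)[OF X S(1) fin])
  with n have "(of_nat (ncount X (S n)) :: ennreal) < of_nat 1" by simp
  then have "ncount X (S n) = 0" by (simp only: of_nat_less_iff)
  with \<open>emeasure X (S n) = of_nat (ncount X (S n))\<close> show ?thesis by auto
qed

text \<open>The map \<open>S\<close> turns a set of times into the points with such a time: the identity for arrivals, the strip
  \<open>{0..r} \<times> T\<close> for service marks.\<close>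

locale counting =
  fixes \<nu> :: "'a measure" and X :: "'a measure" and S :: "real set \<Rightarrow> 'a set"
  assumes X: "integer_valued \<nu> X"
    and S: "\<And>T. T \<in> sets borel \<Longrightarrow> T \<subseteq> {0..} \<Longrightarrow> S T \<in> sets \<nu>"
    and S_Un: "\<And>T U. S (T \<union> U) = S T \<union> S U" and S_Int: "\<And>T U. S (T \<inter> U) = S T \<inter> S U"
    and S_empty: "S {} = {}" and S_INT: "\<And>T. S (\<Inter>n::nat. T n) = (\<Inter>n. S (T n))"
    and fin: "\<And>t. 0 \<le> t \<Longrightarrow> emeasure X (S {0..t}) < \<infinity>"
begin

definition num :: "real \<Rightarrow> nat" where "num t = ncount X (S {0<..t})"

lemma S_mono: "T \<subseteq> U \<Longrightarrow> S T \<subseteq> S U"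
proof -
  assume "T \<subseteq> U"
  then have "S U = S T \<union> S U" using S_Un[of T U] by (simp add: Un_absorb1)
  then show "S T \<subseteq> S U" by blast
qed

lemma fin_sub:
  assumes "T \<in> sets borel" "T \<subseteq> {0..t}"
  shows "emeasure X (S T) < \<infinity>"
proof (cases "0 \<le> t")
  case True
  have "emeasure X (S T) \<le> emeasure X (S {0..t})"
    using X S_mono[OF assms(2)] by (intro emeasure_mono) (auto simp: integer_valued_def intro!: S)
  then show ?thesis using fin[OF True] by (rule order.strict_trans1)
next
  case False
  then have "T = {}" using assms(2) by auto
  then show ?thesis by (simp add: S_empty)
qed

lemma measure_increment:
  assumes "0 \<le> s" "s \<le> t"
  shows "num s \<le> num t" "measure X (S {s<..t}) = real (num t - num s)"
    "emeasure X (S {s<..t}) = of_nat (num t - num s)"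
proof -
  have sets: "sets X = sets \<nu>" using X by (simp add: integer_valued_def)
  have n: "measure X (S {0<..u}) = real (num u)" if "0 \<le> u" for u
    unfolding num_def using that by (intro integer_valued_count(2)[OF X S fin_sub[of _ u]]) auto
  have "measure X (S {0<..s} \<union> S {s<..t}) = measure X (S {0<..s}) + measure X (S {s<..t})"
  proof (rule measure_Union)
    show "emeasure X (S {0<..s}) \<noteq> \<infinity>" "emeasure X (S {s<..t}) \<noteq> \<infinity>"
      using assms by (intro less_imp_neq fin_sub[of _ t]; auto)+
    show "S {0<..s} \<in> sets X" "S {s<..t} \<in> sets X" unfolding sets using assms by (auto intro!: S)
    have "{0<..s} \<inter> {s<..t} = {}" by auto
    then show "S {0<..s} \<inter> S {s<..t} = {}" by (simp only: S_Int[symmetric] S_empty)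
  qed
  moreover have "{0<..s} \<union> {s<..t} = {0<..t}" using assms by auto
  ultimately have *: "real (num t) = real (num s) + measure X (S {s<..t})"
    using assms n[of s] n[of t] by (simp add: S_Un[symmetric])
  have "real (num s) \<le> real (num t)" unfolding * by simp
  then show le: "num s \<le> num t" by simp
  show m: "measure X (S {s<..t}) = real (num t - num s)" using * le by (simp add: of_nat_diff)
  have "emeasure X (S {s<..t}) = of_nat (ncount X (S {s<..t}))"
    and "measure X (S {s<..t}) = real (ncount X (S {s<..t}))"
    using assms by (intro integer_valued_count[OF X S fin_sub[of _ t]]; auto)+
  then show "emeasure X (S {s<..t}) = of_nat (num t - num s)" using m by simp
qed

lemma num_mono: "mono_on {0..} num"
  by (rule mono_onI) (use measure_increment(1) in auto)

lemma num_right: "0 \<le> t \<Longrightarrow> \<exists>y>t. \<forall>z. t \<le> z \<and> z \<le> y \<longrightarrow> num z = num t"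
proof -
  assume t: "0 \<le> t"
  have "\<exists>n::nat. emeasure X (S {t<..t + inverse (real (Suc n))}) = 0"
  proof (rule integer_valued_vanishes[OF X])
    have inv: "inverse (real (Suc (Suc n))) \<le> inverse (real (Suc n))" for n
      by (rule le_imp_inverse_le) simp_all
    have "{t<..t + inverse (real (Suc (Suc n)))} \<subseteq> {t<..t + inverse (real (Suc n))}" for n
    proof
      fix y assume "y \<in> {t<..t + inverse (real (Suc (Suc n)))}"
      then have y: "t < y" "y \<le> t + inverse (real (Suc (Suc n)))" by simp_all
      then have "y \<le> t + inverse (real (Suc n))" using inv[of n] by linarith
      with y(1) show "y \<in> {t<..t + inverse (real (Suc n))}" by simp
    qed
    then show "decseq (\<lambda>n. S {t<..t + inverse (real (Suc n))})"
      by (intro decseq_SucI S_mono)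
    have "(\<Inter>n. {t<..t + inverse (real (Suc n))}) = {}"
    proof (intro equals0I)
      fix y assume y: "y \<in> (\<Inter>n. {t<..t + inverse (real (Suc n))})"
      have "0 < y - t" using INT_D[OF y, of 0] by simp
      from reals_Archimedean[OF this] obtain n where "inverse (real (Suc n)) < y - t" by blast
      with INT_D[OF y, of n] show False by simp
    qed
    then show "(\<Inter>n. S {t<..t + inverse (real (Suc n))}) = {}" by (simp only: S_INT[symmetric] S_empty)
    show "S {t<..t + inverse (real (Suc n))} \<in> sets \<nu>" for n using t by (intro S) auto
    show "emeasure X (S {t<..t + inverse (real (Suc n))}) < \<infinity>" for n
      using t by (intro fin_sub[of _ "t + inverse (real (Suc n))"]) auto
  qed
  then obtain n where n: "emeasure X (S {t<..t + inverse (real (Suc n))}) = 0" by blast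
  let ?y = "t + inverse (real (Suc n))"
  have ty: "t < ?y" by simp
  have "num z = num t" if z: "t \<le> z" "z \<le> ?y" for z
  proof -
    from n measure_increment(3)[OF t less_imp_le[OF ty]]
    have "(of_nat (num ?y - num t) :: ennreal) = 0" by (simp only:)
    then have "num ?y \<le> num t" by (simp only: of_nat_eq_0_iff diff_is_0_eq)
    with measure_increment(1)[OF order_trans[OF t z(1)] z(2)] have "num z \<le> num t" by (rule order_trans)
    then show ?thesis by (rule antisym[OF _ measure_increment(1)[OF t z(1)]])
  qed
  with ty show ?thesis by blast
qed

lemma num_left: "0 < t \<Longrightarrow> \<exists>y<t. 0 \<le> y \<and> (\<forall>z. y \<le> z \<and> z < t \<longrightarrow> num z = num y)"
proof -
  assume t: "0 < t"
  let ?l = "\<lambda>n. t - t * inverse (real (Suc n))"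
  have l: "0 \<le> ?l n" "?l n < t" for n using t by (auto simp: inverse_eq_divide divide_le_eq)
  have "\<exists>n::nat. emeasure X (S {?l n<..<t}) = 0"
  proof (rule integer_valued_vanishes[OF X])
    have l_mono: "?l n \<le> ?l (Suc n)" for n
      using t by (intro diff_left_mono mult_left_mono) (auto simp: inverse_eq_divide frac_le)
    have "{?l (Suc n)<..<t} \<subseteq> {?l n<..<t}" for n
    proof
      fix y assume "y \<in> {?l (Suc n)<..<t}"
      then have "?l (Suc n) < y" "y < t" by (simp_all only: greaterThanLessThan_iff)
      with le_less_trans[OF l_mono[of n]] show "y \<in> {?l n<..<t}" unfolding greaterThanLessThan_iff by blast
    qed
    then show "decseq (\<lambda>n. S {?l n<..<t})" by (intro decseq_SucI S_mono)
    have "(\<Inter>n. {?l n<..<t}) = {}"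
    proof (intro equals0I)
      fix y assume y: "y \<in> (\<Inter>n. {?l n<..<t})"
      have "0 < (t - y) / t" using INT_D[OF y, of 0] t by simp
      from reals_Archimedean[OF this] obtain n where "inverse (real (Suc n)) < (t - y) / t" by blast
      then have "t * inverse (real (Suc n)) < t - y" using t by (simp only: pos_less_divide_eq mult.commute)
      moreover have "?l n < y" using INT_D[OF y, of n] by simp
      ultimately show False by linarith
    qed
    then show "(\<Inter>n. S {?l n<..<t}) = {}" by (simp only: S_INT[symmetric] S_empty)
    show "S {?l n<..<t} \<in> sets \<nu>" for n using l[of n] by (intro S) auto
    show "emeasure X (S {?l n<..<t}) < \<infinity>" for n
      using l[of n] by (intro fin_sub[of _ t]) auto
  qed
  then obtain n where n: "emeasure X (S {?l n<..<t}) = 0" by blast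
  have "num z = num (?l n)" if z: "?l n \<le> z" "z < t" for z
  proof -
    have "emeasure X (S {?l n<..z}) \<le> emeasure X (S {?l n<..<t})"
      using X l[of n] z by (intro emeasure_mono S_mono) (auto simp: integer_valued_def intro!: S)
    with n have "emeasure X (S {?l n<..z}) = 0" by simp
    with measure_increment(3)[OF l(1) z(1)] have "(of_nat (num z - num (?l n)) :: ennreal) = 0" by (simp only:)
    then have "num z \<le> num (?l n)" by (simp only: of_nat_eq_0_iff diff_is_0_eq)
    then show ?thesis by (rule antisym[OF _ measure_increment(1)[OF l(1) z(1)]])
  qed
  with l[of n] show ?thesis by blast
qed

end

text \<open>On a cell with at most one point the reflected path obeys the queue equation.  A mark that meets an empty queue
  although the queue was positive at the start of the cell must come after another mark of the same cell; such
  marks lie in countably many strips, one for each rational time, that carry no further mark.\<close>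

lemma reflected_queue_path:
  assumes \<alpha>: "integer_valued (arrival_intensity lam) \<alpha>" and \<delta>: "integer_valued departure_intensity \<delta>"
    and finA: "\<And>t. 0 \<le> t \<Longrightarrow> emeasure \<alpha> {0..t} < \<infinity>"
    and finD: "\<And>t. 0 \<le> t \<Longrightarrow> emeasure \<delta> ({0..r} \<times> {0..t}) < \<infinity>"
    and null: "emeasure \<alpha> {0..0} = 0" "emeasure \<delta> ({0..r} \<times> {0..0}) = 0"
    and grid: "\<And>m. \<exists>n>0. \<forall>k<n. emeasure \<alpha> (cell (real (Suc m)) n k) + emeasure \<delta> ({0..r} \<times> cell (real (Suc m)) n k) \<le> 1"
  shows "queue_path \<alpha> \<delta> (\<lambda>_. r)
    (reflected (\<lambda>t. ncount \<alpha> {0<..t}) (\<lambda>t. ncount \<delta> ({0..r} \<times> {0<..t})) x)"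
proof -
  have sets: "sets \<alpha> = sets (arrival_intensity lam)" "sets \<delta> = sets departure_intensity"
    using \<alpha> \<delta> by (auto simp: integer_valued_def)
  interpret A: counting "arrival_intensity lam" \<alpha> "\<lambda>T. T"
    using \<alpha> finA by unfold_locales (auto simp: sets_arrival_intensity)
  interpret D: counting departure_intensity \<delta> "\<lambda>T. {0..r} \<times> T"
    using \<delta> finD by unfold_locales (auto intro: Times_in_sets_departure)
  define q where "q = reflected A.num D.num x"
  have q_eq: "q = reflected (\<lambda>t. ncount \<alpha> {0<..t}) (\<lambda>t. ncount \<delta> ({0..r} \<times> {0<..t})) x"
    by (simp add: q_def A.num_def[abs_def] D.num_def[abs_def])
  note mono = A.num_mono D.num_mono
  have cad: "cadlag q"
    unfolding cadlag_def
  proof (intro conjI allI impI)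
    fix t :: real assume t: "0 \<le> t"
    obtain y1 where y1: "t < y1" "\<And>z. t \<le> z \<Longrightarrow> z \<le> y1 \<Longrightarrow> A.num z = A.num t" using A.num_right[OF t] by blast
    obtain y2 where y2: "t < y2" "\<And>z. t \<le> z \<Longrightarrow> z \<le> y2 \<Longrightarrow> D.num z = D.num t" using D.num_right[OF t] by blast
    have "q z = q t" if "t < z" "z < min y1 y2" for z
      unfolding q_def using that y1(2)[of z] y2(2)[of z] t by (intro reflected_unchanged mono) auto
    then show "(q \<longlongrightarrow> q t) (at_right t)"
      using y1(1) y2(1) by (intro tendsto_eventually) (auto simp: eventually_at_right_field intro!: exI[of _ "min y1 y2"])
  next
    fix t :: real assume t: "0 < t"
    obtain y1 where y1: "y1 < t" "0 \<le> y1" "\<And>z. y1 \<le> z \<Longrightarrow> z < t \<Longrightarrow> A.num z = A.num y1" using A.num_left[OF t] by blast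
    obtain y2 where y2: "y2 < t" "0 \<le> y2" "\<And>z. y2 \<le> z \<Longrightarrow> z < t \<Longrightarrow> D.num z = D.num y2" using D.num_left[OF t] by blast
    let ?y = "max y1 y2"
    have y: "0 \<le> ?y" "y1 \<le> ?y" "y2 \<le> ?y" "?y < t" using y1(1,2) y2(1) by simp_all
    have eq: "q z = q ?y" if z: "?y < z" "z < t" for z
    proof -
      have "y1 \<le> z" "y2 \<le> z" using z by simp_all
      then have "A.num z = A.num ?y" "D.num z = D.num ?y"
        using y1(3)[OF _ z(2)] y1(3)[OF y(2,4)] y2(3)[OF _ z(2)] y2(3)[OF y(3,4)] by simp_all
      then show ?thesis
        unfolding q_def by (rule reflected_unchanged[OF mono y(1) less_imp_le[OF z(1)]])
    qed
    have "\<forall>\<^sub>F z in at_left t. q z = q ?y"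
      unfolding eventually_at_left_field
    proof (intro exI conjI allI impI)
      show "?y < t" by (rule y(4))
    qed (rule eq)
    then have "(q \<longlongrightarrow> q ?y) (at_left t)" by (rule tendsto_eventually)
    then show "\<exists>c. (q \<longlongrightarrow> c) (at_left t)" by blast
  qed
  let ?sv = "served q (\<lambda>_. r)"
  have sv_sub: "?sv T \<subseteq> {0..r} \<times> T" for T by (auto simp: served_def)
  have sv_sets: "?sv T \<in> sets \<delta>" if "T \<in> sets borel" "T \<subseteq> {0..}" for T
    unfolding sets using that by (intro served_sets cad) auto
  have R_sets: "{0..r} \<times> T \<in> sets \<delta>" if "T \<in> sets borel" "T \<subseteq> {0..}" for T
    using D.S[OF that] by (simp add: sets)
  have step: "real (q z) = real (q s) + measure \<alpha> {s<..z} - measure \<delta> (?sv {s<..z})"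
    if s: "0 \<le> s" "s \<in> \<rat>" "s < z" and one: "(A.num z - A.num s) + (D.num z - D.num s) \<le> 1" for s z
  proof -
    have mid: "A.num s \<le> A.num y" "A.num y \<le> A.num z" "D.num s \<le> D.num y" "D.num y \<le> D.num z"
      if "s \<le> y" "y \<le> z" for y
      using A.measure_increment(1)[of s y] A.measure_increment(1)[of y z]
        D.measure_increment(1)[of s y] D.measure_increment(1)[of y z] that s by auto
    have at: "q y = q s + (A.num y - A.num s) - (D.num y - D.num s)" if y: "s \<le> y" "y \<le> z" for y
      unfolding q_def using mid[OF y] one s y by (intro reflected_step mono) auto
    have mA: "measure \<alpha> {s<..z} = real (A.num z - A.num s)" using s by (intro A.measure_increment) auto
    have mD: "measure \<delta> ({0..r} \<times> {s<..z}) = real (D.num z - D.num s)" using s by (intro D.measure_increment) auto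
    have fin: "emeasure \<delta> ({0..r} \<times> {s<..z}) < \<infinity>" using s by (intro D.fin_sub[of _ z]) auto
    have sz: "{s<..z} \<in> sets borel" "{s<..z} \<subseteq> {0..}" using s by auto
    have le: "measure \<delta> (?sv {s<..z}) \<le> real (D.num z - D.num s)"
      unfolding mD[symmetric] using fin sv_sub sv_sets[OF sz] R_sets[OF sz]
      by (intro measure_mono_fmeasurable) (auto simp: fmeasurable_def)
    show ?thesis
    proof (cases "D.num z = D.num s")
      case True
      then have "measure \<delta> (?sv {s<..z}) = 0" using le by (simp add: measure_le_0_iff)
      then show ?thesis using at[of z] s mA True by simp
    next
      case False
      then have d: "D.num z - D.num s = 1" and a: "A.num z = A.num s" using one mid[of z] s by auto
      have a_mid: "A.num y = A.num s" if "s \<le> y" "y \<le> z" for y using mid[OF that] a by simp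
      have left: "\<exists>y'. s < y' \<and> y' < y \<and> q y' = left_lim q y" if "s < y" for y
      proof -
        have "\<forall>\<^sub>F y' in at_left y. q y' = left_lim q y"
          using cadlag_left_lim[OF cad, of y] that s by (simp add: tendsto_discrete)
        then obtain b where b: "b < y" "\<And>y'. b < y' \<Longrightarrow> y' < y \<Longrightarrow> q y' = left_lim q y"
          by (auto simp: eventually_at_left_field)
        have "max b s < y" using b(1) that by simp
        from dense[OF this] obtain y' where "max b s < y'" "y' < y" by blast
        with b(2)[of y'] show ?thesis by auto
      qed
      show ?thesis
      proof (cases "q s = 0")
        case True
        have "left_lim q y = 0" if y: "s < y" "y \<le> z" for y
        proof -
          obtain y' where y': "s < y'" "y' < y" "q y' = left_lim q y" using left[OF y(1)] by blast
          have "q y' = 0" using at[of y'] a_mid[of y'] y' y True by simp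
          with y' show ?thesis by simp
        qed
        then have "?sv {s<..z} = {}" by (auto simp: served_def)
        then show ?thesis using at[of z] s mA a d True by simp
      next
        case False
        \<comment> \<open>every mark that finds the queue empty lies after another mark of this cell, hence in \<open>?U\<close>\<close>
        let ?U = "\<Union>p\<in>{p::rat. s < real_of_rat p \<and> real_of_rat p < z \<and> D.num (real_of_rat p) = D.num z}. {0..r} \<times> {real_of_rat p<..z}"
        have U: "?U \<in> null_sets \<delta>"
        proof (rule null_sets_UN')
          fix p assume p: "p \<in> {p::rat. s < real_of_rat p \<and> real_of_rat p < z \<and> D.num (real_of_rat p) = D.num z}"
          then have p': "s < real_of_rat p" "real_of_rat p < z" by simp_all
          have "emeasure \<delta> ({0..r} \<times> {real_of_rat p<..z}) = of_nat (D.num z - D.num (real_of_rat p))"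
            by (rule D.measure_increment(3)[OF order_trans[OF s(1) less_imp_le[OF p'(1)]] less_imp_le[OF p'(2)]])
          moreover have "D.num (real_of_rat p) = D.num z" using p by simp
          ultimately have "emeasure \<delta> ({0..r} \<times> {real_of_rat p<..z}) = 0" by simp
          moreover have "{0..r} \<times> {real_of_rat p<..z} \<in> sets \<delta>"
          proof (rule R_sets)
            show "{real_of_rat p<..z} \<subseteq> {0..}"
            proof
              fix y assume "y \<in> {real_of_rat p<..z}"
              then have "real_of_rat p < y" by simp
              with s(1) p'(1) have "0 \<le> y" by linarith
              then show "y \<in> {0..}" by simp
            qed
          qed simp
          ultimately show "{0..r} \<times> {real_of_rat p<..z} \<in> null_sets \<delta>" by (rule null_setsI)
        qed simp
        have "{0..r} \<times> {s<..z} \<subseteq> ?sv {s<..z} \<union> ?U"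
        proof
          fix w assume w: "w \<in> {0..r} \<times> {s<..z}"
          obtain u y where uy: "w = (u, y)" "0 \<le> u" "u \<le> r" "s < y" "y \<le> z" using w by auto
          show "w \<in> ?sv {s<..z} \<union> ?U"
          proof (cases "left_lim q y = 0")
            case True
            obtain y' where y': "s < y'" "y' < y" "q y' = left_lim q y" using left[OF uy(4)] by blast
            obtain p where p: "y' < real_of_rat p" "real_of_rat p < y" using of_rat_dense[OF y'(2)] by blast
            have "q y' = q s - (D.num y' - D.num s)" using at[of y'] a_mid[of y'] y' uy by simp
            then have "D.num y' - D.num s \<noteq> 0" using True y'(3) False by auto
            then have "D.num y' = D.num z" using mid[of y'] y' uy d by simp
            moreover have pp: "s \<le> real_of_rat p" "real_of_rat p \<le> z" "0 \<le> y'" "s < real_of_rat p" "real_of_rat p < z"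
              using p y'(1) uy s by linarith+
            ultimately have "D.num (real_of_rat p) = D.num z"
              using D.measure_increment(1)[OF pp(3) less_imp_le[OF p(1)]] mid(4)[OF pp(1,2)] by linarith
            with pp(4,5) have "p \<in> {p::rat. s < real_of_rat p \<and> real_of_rat p < z \<and> D.num (real_of_rat p) = D.num z}"
              by blast
            moreover have "w \<in> {0..r} \<times> {real_of_rat p<..z}" using uy p(2) by simp
            ultimately show ?thesis by blast
          qed (use uy in \<open>auto simp: served_def\<close>)
        qed
        then have "emeasure \<delta> ({0..r} \<times> {s<..z}) \<le> emeasure \<delta> (?sv {s<..z} \<union> ?U)"
          by (intro emeasure_mono sets.Un sv_sets[OF sz] null_setsD2[OF U])
        also have "\<dots> = emeasure \<delta> (?sv {s<..z})"
          by (rule emeasure_Un_null_set[OF sv_sets[OF sz] U])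
        finally have "emeasure \<delta> ({0..r} \<times> {s<..z}) \<le> emeasure \<delta> (?sv {s<..z})" .
        moreover have "emeasure \<delta> (?sv {s<..z}) \<le> emeasure \<delta> ({0..r} \<times> {s<..z})"
          using sv_sub R_sets[OF sz] by (intro emeasure_mono)
        ultimately have "measure \<delta> (?sv {s<..z}) = real (D.num z - D.num s)"
          unfolding mD[symmetric] by (simp add: measure_def)
        then show ?thesis using at[of z] s mA a d False by simp
      qed
    qed
  qed
  have "real (q t) = real (q 0) + measure \<alpha> {0..t} - measure \<delta> (?sv {0..t})" if t: "0 \<le> t" for t
  proof -
    define m where "m = nat \<lceil>t\<rceil>"
    let ?T = "real (Suc m)"
    have tT: "t \<le> ?T" unfolding m_def using t by linarith
    obtain n where n: "0 < n" and one: "\<And>k. k < n \<Longrightarrow>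
        emeasure \<alpha> (cell ?T n k) + emeasure \<delta> ({0..r} \<times> cell ?T n k) \<le> 1"
      using grid[of m] by blast
    let ?s = "\<lambda>k. real k * ?T / real n"
    have s: "0 \<le> ?s k" "?s k \<in> \<rat>" for k by (simp, intro Rats_divide Rats_mult Rats_of_nat)
    have s_lt: "?s k < ?s (Suc k)" for k using n by (intro divide_strict_right_mono mult_strict_right_mono) auto
    have cell_one: "(A.num z - A.num (?s k)) + (D.num z - D.num (?s k)) \<le> 1"
      if "k < n" "?s k < z" "z \<le> ?s (Suc k)" for k z
    proof -
      have "(of_nat ((A.num (?s (Suc k)) - A.num (?s k)) + (D.num (?s (Suc k)) - D.num (?s k))) :: ennreal) \<le> of_nat 1"
        using one[OF that(1)] A.measure_increment(3)[OF s(1) less_imp_le[OF s_lt], of k]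
          D.measure_increment(3)[OF s(1) less_imp_le[OF s_lt], of k]
        unfolding cell_def by (simp only: of_nat_add of_nat_1)
      then have "(A.num (?s (Suc k)) - A.num (?s k)) + (D.num (?s (Suc k)) - D.num (?s k)) \<le> 1"
        by (simp only: of_nat_le_iff)
      moreover have "A.num z \<le> A.num (?s (Suc k))" "D.num z \<le> D.num (?s (Suc k))"
        using A.measure_increment(1)[OF order_trans[OF s(1) less_imp_le[OF that(2)]] that(3)]
          D.measure_increment(1)[OF order_trans[OF s(1) less_imp_le[OF that(2)]] that(3)] .
      ultimately show ?thesis by linarith
    qed
    have split: "real (q z) = real (q 0) + measure \<alpha> {0..z} - measure \<delta> (?sv {0..z})"
      if eq: "real (q s) = real (q 0) + measure \<alpha> {0..s} - measure \<delta> (?sv {0..s})"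
        and inc: "real (q z) = real (q s) + measure \<alpha> {s<..z} - measure \<delta> (?sv {s<..z})"
        and sz: "0 \<le> s" "s \<le> z" for s z
    proof -
      have "measure \<alpha> ({0..s} \<union> {s<..z}) = measure \<alpha> {0..s} + measure \<alpha> {s<..z}"
      proof (rule measure_Union)
        show "emeasure \<alpha> {0..s} \<noteq> \<infinity>" "emeasure \<alpha> {s<..z} \<noteq> \<infinity>"
          using sz by (intro less_imp_neq A.fin_sub[of _ z]; auto)+
      qed (use sz in \<open>auto simp: sets sets_arrival_intensity\<close>)
      moreover have "measure \<delta> (?sv {0..s} \<union> ?sv {s<..z}) = measure \<delta> (?sv {0..s}) + measure \<delta> (?sv {s<..z})"
      proof (rule measure_Union)
        have fin: "emeasure \<delta> (?sv T) < \<infinity>" if "T \<in> sets borel" "T \<subseteq> {0..z}" for T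
        proof -
          have "T \<subseteq> {0..}" using that(2) by auto
          from emeasure_mono[OF sv_sub R_sets[OF that(1) this]]
          show ?thesis using D.fin_sub[OF that] by (rule order.strict_trans1)
        qed
        show "emeasure \<delta> (?sv {0..s}) \<noteq> \<infinity>" "emeasure \<delta> (?sv {s<..z}) \<noteq> \<infinity>"
          using sz by (intro less_imp_neq fin; auto)+
        show "?sv {0..s} \<in> sets \<delta>" "?sv {s<..z} \<in> sets \<delta>" using sz by (auto intro!: sv_sets)
        show "?sv {0..s} \<inter> ?sv {s<..z} = {}" by (auto simp: served_def)
      qed
      moreover have "{0..s} \<union> {s<..z} = {0..z}" using sz by auto
      moreover have "?sv {0..s} \<union> ?sv {s<..z} = ?sv {0..z}" using sz by (auto simp: served_def)
      ultimately show ?thesis using eq inc by simp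
    qed
    have base: "real (q 0) = real (q 0) + measure \<alpha> {0..0} - measure \<delta> (?sv {0..0})"
    proof -
      have "emeasure \<delta> (?sv {0..0}) \<le> 0"
        unfolding null(2)[symmetric] by (intro emeasure_mono sv_sub R_sets) auto
      then show ?thesis using null(1) by (simp add: measure_def)
    qed
    have claim: "\<forall>z. 0 \<le> z \<and> z \<le> ?s k \<longrightarrow>
        real (q z) = real (q 0) + measure \<alpha> {0..z} - measure \<delta> (?sv {0..z})" if "k \<le> n" for k
      using that
    proof (induction k)
      case 0
      show ?case
      proof (intro allI impI)
        fix z assume "0 \<le> z \<and> z \<le> ?s 0"
        then have z: "z = 0" by simp
        show "real (q z) = real (q 0) + measure \<alpha> {0..z} - measure \<delta> (?sv {0..z})"
          unfolding z by (rule base)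
      qed
    next
      case (Suc k)
      from Suc.prems have kn: "k < n" by simp
      note IH = Suc.IH[OF less_imp_le[OF kn]]
      show ?case
      proof (intro allI impI)
        fix z assume z: "0 \<le> z \<and> z \<le> ?s (Suc k)"
        show "real (q z) = real (q 0) + measure \<alpha> {0..z} - measure \<delta> (?sv {0..z})"
        proof (cases "z \<le> ?s k")
          case True
          with IH z show ?thesis by blast
        next
          case False
          then have lt: "?s k < z" by (simp only: not_le)
          have "real (q (?s k)) = real (q 0) + measure \<alpha> {0..?s k} - measure \<delta> (?sv {0..?s k})"
            using IH s(1)[of k] by blast
          from split[OF this step[OF s lt cell_one[OF kn lt conjunct2[OF z]]] s(1) less_imp_le[OF lt]]
          show ?thesis .
        qed
      qed
    qed
    have "t \<le> ?s n" using tT n by simp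
    with claim[OF order_refl] t show ?thesis by blast
  qed
  then show ?thesis
    unfolding q_eq[symmetric] queue_path_def served_integral[OF sets(2) cad borel_measurable_const]
    using cad by blast
qed

lemma ncount_measurable:
  assumes "(\<lambda>\<omega>. emeasure (X \<omega>) S) \<in> borel_measurable M"
  shows "(\<lambda>\<omega>. ncount (X \<omega>) S) \<in> M \<rightarrow>\<^sub>M count_space UNIV"
proof -
  have "(\<lambda>\<omega>. measure (X \<omega>) S) \<in> borel_measurable M"
    unfolding measure_def by (rule measurable_compose[OF assms]) measurable
  from measurable_compose[OF this measurable_real_floor]
  have "(\<lambda>\<omega>. nat \<lfloor>measure (X \<omega>) S\<rfloor>) \<in> M \<rightarrow>\<^sub>M count_space UNIV"
    by (rule measurable_compose) simp
  then show ?thesis by (simp only: ncount_def)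
qed

lemma measurable_count_space_3:
  fixes f :: "nat \<Rightarrow> nat \<Rightarrow> nat \<Rightarrow> 'b"
  assumes "u \<in> M \<rightarrow>\<^sub>M count_space UNIV" "v \<in> M \<rightarrow>\<^sub>M count_space UNIV" "w \<in> M \<rightarrow>\<^sub>M count_space UNIV"
  shows "(\<lambda>\<omega>. f (u \<omega>) (v \<omega>) (w \<omega>)) \<in> M \<rightarrow>\<^sub>M count_space UNIV"
proof (rule measurable_compose_countable[OF _ assms(1)])
  fix i
  show "(\<lambda>\<omega>. f i (v \<omega>) (w \<omega>)) \<in> M \<rightarrow>\<^sub>M count_space UNIV"
  proof (rule measurable_compose_countable[OF _ assms(2)])
    fix j
    show "(\<lambda>\<omega>. f i j (w \<omega>)) \<in> M \<rightarrow>\<^sub>M count_space UNIV"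
      by (rule measurable_compose[OF assms(3)]) simp
  qed
qed

lemma reflected_measurable:
  assumes a: "\<And>s. 0 \<le> s \<Longrightarrow> (\<lambda>\<omega>. a \<omega> s) \<in> M \<rightarrow>\<^sub>M count_space UNIV"
    and d: "\<And>s. 0 \<le> s \<Longrightarrow> (\<lambda>\<omega>. d \<omega> s) \<in> M \<rightarrow>\<^sub>M count_space UNIV"
    and x: "x \<in> M \<rightarrow>\<^sub>M count_space UNIV" and t: "0 \<le> t"
  shows "(\<lambda>\<omega>. reflected (a \<omega>) (d \<omega>) (x \<omega>) t) \<in> M \<rightarrow>\<^sub>M count_space UNIV"
proof -
  have P: "{\<omega>\<in>space M. d \<omega> s - (a \<omega> s + x \<omega>) \<le> k} \<in> sets M" if "0 \<le> s" for s k
    using measurable_count_space_3[OF d[OF that] a[OF that] x, of "\<lambda>d a x. d - (a + x) \<le> k"]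
    by (simp only: pred_def)
  have Q: "{\<omega>\<in>space M. 0 \<le> real_of_rat p \<and> real_of_rat p \<le> t \<longrightarrow>
      d \<omega> (real_of_rat p) - (a \<omega> (real_of_rat p) + x \<omega>) \<le> k} \<in> sets M" for p k
  proof (cases "0 \<le> real_of_rat p \<and> real_of_rat p \<le> t")
    case True
    with P[of "real_of_rat p" k] show ?thesis by (simp only: simp_thms)
  next
    case False
    then show ?thesis by (simp only: simp_thms) simp
  qed
  have L: "(\<lambda>\<omega>. d \<omega> t - (a \<omega> t + x \<omega>) \<le> k \<and> (\<forall>p::rat. 0 \<le> real_of_rat p \<and> real_of_rat p \<le> t \<longrightarrow>
      d \<omega> (real_of_rat p) - (a \<omega> (real_of_rat p) + x \<omega>) \<le> k)) \<in> M \<rightarrow>\<^sub>M count_space UNIV" for k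
    unfolding pred_def
  proof (rule sets.sets_Collect_conj)
    show "{\<omega>\<in>space M. \<forall>p::rat. 0 \<le> real_of_rat p \<and> real_of_rat p \<le> t \<longrightarrow>
      d \<omega> (real_of_rat p) - (a \<omega> (real_of_rat p) + x \<omega>) \<le> k} \<in> sets M"
      by (rule sets.sets_Collect_countable_All) (rule Q)
  qed (rule P[OF t])
  have o: "(\<lambda>\<omega>. overflow (a \<omega>) (d \<omega>) (x \<omega>) t) \<in> M \<rightarrow>\<^sub>M count_space UNIV"
    unfolding overflow_def by (rule measurable_Least[OF L])
  from measurable_count_space_3[OF x a[OF t] o, of "\<lambda>x a w. x + a + w"]
  have "(\<lambda>\<omega>. x \<omega> + a \<omega> t + overflow (a \<omega>) (d \<omega>) (x \<omega>) t) \<in> M \<rightarrow>\<^sub>M count_space UNIV" .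
  from measurable_count_space_3[OF this d[OF t] d[OF t], of "\<lambda>s d _. s - d"]
  show ?thesis unfolding reflected_def .
qed

text \<open>A grid fails with probability at most of order \<open>1 / n\<close>, so almost surely not all grids fail.\<close>

lemma AE_good_grid:
  assumes noise: "driving_noise M N lam A D" and i: "i \<in> {1..N}" and pos: "0 < lam" "0 < K" "0 < t"
  shows "AE \<omega> in M. \<exists>n>0. \<forall>k<n. emeasure (A i \<omega>) (cell t n k) + emeasure (D i \<omega>) ({0..K} \<times> cell t n k) \<le> 1"
proof -
  interpret prob_space M using noise by (rule driving_noiseD)
  define C where "C = (\<lambda>n. {\<omega>\<in>space M. \<exists>k<n. \<not> emeasure (A i \<omega>) (cell t n k) + emeasure (D i \<omega>) ({0..K} \<times> cell t n k) \<le> 1})"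
  have C: "C n \<in> events" "prob (C n) \<le> ((lam + K) * t)\<^sup>2 / real n" if "0 < n" for n
    unfolding C_def by (rule crowded_grid[OF noise i pos that])+
  have C_sets: "(\<Inter>n. C (Suc n)) \<in> events" using C(1) by (intro sets.countable_INT) auto
  have "prob (\<Inter>n. C (Suc n)) \<le> ((lam + K) * t)\<^sup>2 / real n + 0" if n: "0 < n" for n
  proof -
    have "Suc (n - 1) = n" using n by simp
    then have "(\<Inter>n. C (Suc n)) \<subseteq> C n" by (metis INT_lower UNIV_I)
    then have "prob (\<Inter>n. C (Suc n)) \<le> prob (C n)"
      using C(1)[OF n] by (rule finite_measure_mono)
    with C(2)[OF n] show ?thesis by simp
  qed
  then have "prob (\<Inter>n. C (Suc n)) \<le> 0" by (rule le_of_le_add_inverse_nat)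
  then have "(\<Inter>n. C (Suc n)) \<in> null_sets M"
    using C_sets by (simp add: null_sets_def emeasure_eq_measure measure_le_0_iff)
  then have "AE \<omega> in M. \<omega> \<notin> (\<Inter>n. C (Suc n))" by (rule AE_not_in)
  then show ?thesis
    using AE_space
  proof eventually_elim
    case (elim \<omega>)
    then obtain n where "\<omega> \<notin> C (Suc n)" by blast
    with elim(2) show ?case by (intro exI[of _ "Suc n"]) (auto simp: C_def)
  qed
qed

lemma AE_reflected_queue_path:
  assumes noise: "driving_noise M N lam A D" and i: "i \<in> {1..N}" and pos: "0 < lam" "0 < r"
  shows "AE \<omega> in M. queue_path (A i \<omega>) (D i \<omega>) (\<lambda>_. r)
    (reflected (\<lambda>t. ncount (A i \<omega>) {0<..t}) (\<lambda>t. ncount (D i \<omega>) ({0..r} \<times> {0<..t})) (x \<omega>))"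
proof -
  note PA = driving_noiseD(2)[OF noise i] and PD = driving_noiseD(3)[OF noise i] and M = driving_noiseD(1)[OF noise]
  have AS: "{0..s::real} \<in> sets (arrival_intensity lam)" for s by (auto simp: sets_arrival_intensity)
  have DS: "{0..r} \<times> {0..s} \<in> sets departure_intensity" for s by (auto intro: Times_in_sets_departure)
  have Dm: "emeasure departure_intensity ({0..r} \<times> {0..s}) = ennreal r * ennreal s" if "0 \<le> s" for s
    using that pos by (subst emeasure_departure_intensity) auto
  have finA: "AE \<omega> in M. \<forall>m::nat. emeasure (A i \<omega>) {0..real m} < \<infinity>"
    using pos by (intro AE_all_countable[THEN iffD2] allI poisson_random_measure_AE_finite[OF M PA AS])
      (simp add: measure_arrival_intensity)
  have finD: "AE \<omega> in M. \<forall>m::nat. emeasure (D i \<omega>) ({0..r} \<times> {0..real m}) < \<infinity>"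
    using pos by (intro AE_all_countable[THEN iffD2] allI poisson_random_measure_AE_finite[OF M PD DS])
      (simp add: Dm ennreal_mult_less_top)
  have nullA: "AE \<omega> in M. emeasure (A i \<omega>) {0..0} = 0"
    using pos by (intro poisson_random_measure_AE_null[OF M PA AS]) (subst measure_arrival_intensity; simp)
  have nullD: "AE \<omega> in M. emeasure (D i \<omega>) ({0..r} \<times> {0..0}) = 0"
    using pos by (intro poisson_random_measure_AE_null[OF M PD DS]) (subst Dm; simp)
  have grid: "AE \<omega> in M. \<forall>m. \<exists>n>0. \<forall>k<n.
      emeasure (A i \<omega>) (cell (real (Suc m)) n k) + emeasure (D i \<omega>) ({0..r} \<times> cell (real (Suc m)) n k) \<le> 1"
    using pos by (intro AE_all_countable[THEN iffD2] allI AE_good_grid[OF noise i]) auto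
  show ?thesis
    using finA finD nullA nullD grid AE_space
  proof eventually_elim
    case (elim \<omega>)
    have \<alpha>: "integer_valued (arrival_intensity lam) (A i \<omega>)" and \<delta>: "integer_valued departure_intensity (D i \<omega>)"
      using poisson_random_measure_integer_valued[OF PA elim(6)] poisson_random_measure_integer_valued[OF PD elim(6)] .
    have le: "t \<le> real (nat \<lceil>t\<rceil>)" for t :: real by linarith
    show ?case
    proof (rule reflected_queue_path[OF \<alpha> \<delta> _ _ elim(3,4)])
      fix t :: real
      have sub: "{0..t} \<subseteq> {0..real (nat \<lceil>t\<rceil>)}"
        by (intro atLeastatMost_subset_iff[THEN iffD2] disjI2 conjI order_refl le)
      have "emeasure (A i \<omega>) {0..t} \<le> emeasure (A i \<omega>) {0..real (nat \<lceil>t\<rceil>)}"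
        using \<alpha> AS by (intro emeasure_mono sub) (simp add: integer_valued_def)
      then show "emeasure (A i \<omega>) {0..t} < \<infinity>" using elim(1) by (auto intro: order.strict_trans1)
      have "emeasure (D i \<omega>) ({0..r} \<times> {0..t}) \<le> emeasure (D i \<omega>) ({0..r} \<times> {0..real (nat \<lceil>t\<rceil>)})"
        using \<delta> DS by (intro emeasure_mono Sigma_mono order_refl sub) (simp add: integer_valued_def)
      then show "emeasure (D i \<omega>) ({0..r} \<times> {0..t}) < \<infinity>" using elim(2) by (auto intro: order.strict_trans1)
    qed (use elim(5) in blast)
  qed
qed

text \<open>The queues with constant rate \<open>r\<close> started from the geometric law keep the busy probability \<open>x\<close>, so \<open>r\<close> is the
  rate that the mean-field feedback prescribes for them.\<close>

lemma MF1_solution_exists: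
  assumes \<pi>: "prob_space \<pi>" "sets \<pi> = sets (state_space N)" "translation_invariant N \<pi>"
    and law: "\<And>S. S \<in> sets (state_space N) \<Longrightarrow> measure \<pi> S = measure_pmf.prob (geometric_states N x) S"
    and noise: "driving_noise M N lam A D" and N: "1 \<le> N" and pos: "0 < lam" "0 < B" "0 \<le> \<xi>"
    and x: "0 < x" "x < 1" "x * service_rate B \<xi> x = lam"
  shows "\<exists>q. MF1_solution (\<pi> \<Otimes>\<^sub>M M) N lam B \<xi> (\<lambda>i \<omega>. A i (snd \<omega>)) (\<lambda>i \<omega>. D i (snd \<omega>)) q
    \<and> distr (\<pi> \<Otimes>\<^sub>M M) (state_space N) (queue_state N q 0) = \<pi>"
proof -
  let ?E = "\<pi> \<Otimes>\<^sub>M M"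
  let ?A = "\<lambda>i \<omega>. A i (snd \<omega>)" and ?D = "\<lambda>i \<omega>. D i (snd \<omega>)"
  define r where "r = service_rate B \<xi> x"
  have r: "0 < r" "x * r = lam" using service_rate_pos pos x by (auto simp: r_def)
  define q where "q = (\<lambda>i t \<omega>. reflected (\<lambda>s. ncount (?A i \<omega>) {0<..s})
      (\<lambda>s. ncount (?D i \<omega>) ({0..r} \<times> {0<..s})) (fst \<omega> i) t)"
  have noiseE: "driving_noise ?E N lam ?A ?D" by (rule driving_noise_pair_snd[OF \<pi>(1) noise])
  interpret prob_space ?E by (rule driving_noiseD(1)[OF noiseE])
  interpret P: prob_space \<pi> by (rule \<pi>(1))
  interpret M: prob_space M by (rule driving_noiseD(1)[OF noise])
  have space_\<pi>: "space \<pi> = PiE {1..N} (\<lambda>_. UNIV)"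
    using sets_eq_imp_space_eq[OF \<pi>(2)] by (simp add: space_PiM)
  have fst_meas: "(\<lambda>\<omega>. fst \<omega> i) \<in> ?E \<rightarrow>\<^sub>M count_space UNIV" if "i \<in> {1..N}" for i
  proof (rule measurable_compose[OF measurable_fst])
    have "(\<lambda>x. x i) \<in> state_space N \<rightarrow>\<^sub>M count_space UNIV"
      using that by (rule measurable_component_singleton)
    then show "(\<lambda>x. x i) \<in> \<pi> \<rightarrow>\<^sub>M count_space UNIV"
      by (simp only: measurable_cong_sets[OF \<pi>(2) refl])
  qed
  have q_meas: "q i t \<in> ?E \<rightarrow>\<^sub>M count_space UNIV" if "i \<in> {1..N}" "0 \<le> t" for i t
    unfolding q_def
    by (intro reflected_measurable ncount_measurable fst_meas[OF that(1)] that(2)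
        poisson_random_measure_measurable[OF driving_noiseD(2)[OF noiseE that(1)]]
        poisson_random_measure_measurable[OF driving_noiseD(3)[OF noiseE that(1)]])
      (auto simp: sets_arrival_intensity intro!: Times_in_sets_departure)
  have q0: "q i 0 \<omega> = fst \<omega> i" for i \<omega>
    unfolding q_def by (rule reflected_0) (simp_all add: ncount_def)
  have state0: "queue_state N q 0 \<omega> = fst \<omega>" if "\<omega> \<in> space ?E" for \<omega>
    using that by (auto simp: queue_state_def q0 space_pair_measure space_\<pi> PiE_def extensional_restrict)
  have path: "AE \<omega> in ?E. \<forall>i\<in>{1..N}. queue_path (?A i \<omega>) (?D i \<omega>) (\<lambda>_. r) (\<lambda>t. q i t \<omega>)"
    unfolding q_def using AE_reflected_queue_path[OF noiseE _ pos(1) r(1)]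
    by (intro AE_finite_allI) auto
  have indep: "indep_set {queue_state N q 0 -` S \<inter> space ?E | S. S \<in> sets (state_space N)} (noise_events ?E N lam ?A ?D)"
    by (rule initial_indep_noise[OF \<pi>(1) noise state0]) (simp_all add: \<pi>(2))
  have distr0: "distr ?E (state_space N) (queue_state N q 0) = \<pi>"
  proof -
    have "distr ?E (state_space N) (queue_state N q 0) = distr ?E \<pi> fst"
      using \<pi>(2) state0 by (intro distr_cong) auto
    also have "\<dots> = \<pi>"
      by (rule M.distr_pair_fst)
    finally show ?thesis .
  qed
  have state_meas: "queue_state N q t \<in> ?E \<rightarrow>\<^sub>M state_space N" if "0 \<le> t" for t
    using that by (intro queue_state_measurable q_meas)
  have init: "prob {\<omega>\<in>space ?E. queue_state N q 0 \<omega> \<in> S} = measure_pmf.prob (geometric_states N x) S"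
    if S: "S \<in> sets (state_space N)" for S
  proof -
    have "measure \<pi> S = measure (distr ?E (state_space N) (queue_state N q 0)) S" by (simp only: distr0)
    also have "\<dots> = prob (queue_state N q 0 -` S \<inter> space ?E)"
      using state_meas[of 0] S by (intro measure_distr) auto
    also have "queue_state N q 0 -` S \<inter> space ?E = {\<omega>\<in>space ?E. queue_state N q 0 \<omega> \<in> S}" by auto
    finally show ?thesis using law[OF S] by simp
  qed
  have busy: "prob {\<omega>\<in>space ?E. 0 < q 1 t \<omega>} = x" if t: "0 \<le> t" for t
  proof -
    let ?S = "{y\<in>PiE {1..N} (\<lambda>_. UNIV :: nat set). 0 < y 1}"
    let ?G = "geometric_states N x"
    have S: "?S \<in> sets (state_space N)" unfolding sets_state_space by blast
    have "prob {\<omega>\<in>space ?E. queue_state N q t \<omega> \<in> ?S} = measure_pmf.prob ?G ?S"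
    proof (cases "t = 0")
      case False
      with t have t: "0 < t" by simp
      have "\<bar>prob {\<omega>\<in>space ?E. queue_state N q t \<omega> \<in> ?S} - measure_pmf.prob ?G ?S\<bar>
          \<le> N * ((lam + r) * t)\<^sup>2 / real n + 0" if n: "0 < n" for n
      proof -
        have "\<bar>prob {\<omega>\<in>space ?E. queue_state N q t \<omega> \<in> ?S}
            - measure_pmf.prob (walk_law N n (lam * t / n) (r * t / n) ?G) ?S\<bar>
          \<le> N * (((lam + r) * t)\<^sup>2 / n + 2 * 0 * (t - t))"
        proof (rule law_close_to_walk_law[OF noiseE pos(1) r(1) t n N order_refl q_meas indep _ _ path _ _ _ _ _ _ S])
          show "y \<in> PiE {1..N} (\<lambda>_. UNIV)" if "y \<in> set_pmf ?G" for y
            using that set_geometric_states[of N x] by blast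
          show "prob {\<omega>\<in>space ?E. queue_state N q 0 \<omega> = y} = pmf ?G y" if "y \<in> set_pmf ?G" for y
          proof -
            have "{y} \<in> sets (state_space N)"
              unfolding sets_state_space using that set_geometric_states[of N x] by blast
            from init[OF this] show ?thesis by (simp add: measure_pmf_single)
          qed
        qed (use t in auto)
        then show ?thesis
          using walk_law_geometric_states_grid[OF pos(1) t n r(1) x(2) r(2), of N] by simp
      qed
      then have "\<bar>prob {\<omega>\<in>space ?E. queue_state N q t \<omega> \<in> ?S} - measure_pmf.prob ?G ?S\<bar> \<le> 0"
        by (rule le_of_le_add_inverse_nat)
      then show ?thesis by simp
    qed (use init[OF S] in simp)
    also have "measure_pmf.prob ?G ?S = x" by (rule geometric_states_busy[OF N x(1,2)])
    also have "{\<omega>\<in>space ?E. queue_state N q t \<omega> \<in> ?S} = {\<omega>\<in>space ?E. 0 < q 1 t \<omega>}"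
      using N by (auto simp: queue_state_def)
    finally show ?thesis .
  qed
  have rate: "mf_rate ?E B \<xi> q z = r" if "0 \<le> z" for z
    by (simp only: mf_rate_eq_service_rate busy[OF that] r_def)
  have left: "left_lim (mf_rate ?E B \<xi> q) = (\<lambda>_. r)"
  proof
    fix z :: real
    show "left_lim (mf_rate ?E B \<xi> q) z = r"
    proof (cases "0 < z")
      case True
      have "\<forall>\<^sub>F y in at_left z. mf_rate ?E B \<xi> q y = r"
        unfolding eventually_at_left_field using True rate by (intro exI[of _ 0]) auto
      from tendsto_eventually[OF this] tendsto_Lim[of "at_left z" "mf_rate ?E B \<xi> q" r]
      show ?thesis using True by (simp add: left_lim_def)
    qed (simp add: left_lim_def rate)
  qed
  have "MF1_solution ?E N lam B \<xi> ?A ?D q"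
    unfolding MF1_solution_def MF1_equation_def left
    using noiseE q_meas indep path \<pi>(3) distr0 unfolding queue_path_def by simp
  with distr0 show ?thesis by blast
qed

section \<open>Stationary distributions\<close>

text \<open>The state space is countable.\<close>

lemma ex_pmf_of_state_law:
  assumes "prob_space \<pi>" "sets \<pi> = sets (state_space N)"
  shows "\<exists>p. set_pmf p \<subseteq> PiE {1..N} (\<lambda>_. UNIV) \<and>
    (\<forall>S\<in>sets (state_space N). measure \<pi> S = measure_pmf.prob p S)"
proof -
  interpret P: prob_space \<pi> by fact
  let ?X = "PiE {1..N} (\<lambda>_. UNIV :: nat set)"
  have sets: "sets \<pi> = Pow ?X" using assms(2) by (simp only: sets_state_space)
  have space: "space \<pi> = ?X" using sets_eq_imp_space_eq[OF assms(2)] by (simp add: space_PiM)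
  define \<mu> where "\<mu> = distr \<pi> (count_space UNIV) (\<lambda>x. x)"
  have m: "(\<lambda>x. x) \<in> \<pi> \<rightarrow>\<^sub>M count_space UNIV"
    unfolding measurable_def by (auto simp only: sets space Pow_iff space_count_space Pi_UNIV UNIV_I Int_lower2)
  interpret mu: prob_space \<mu> unfolding \<mu>_def by (rule P.prob_space_distr[OF m])
  have em: "measure \<mu> S = measure \<pi> (S \<inter> ?X)" for S
    unfolding \<mu>_def using measure_distr[OF m, of S] by (simp add: space)
  have sets_mu: "sets \<mu> = UNIV" by (simp add: \<mu>_def)
  have AE_X: "AE x in \<mu>. x \<in> ?X"
    unfolding \<mu>_def using AE_space[of \<pi>] by (subst AE_distr_iff[OF m]) (simp_all add: space)
  have "AE x in \<mu>. measure \<mu> {x} \<noteq> 0"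
    using mu.AE_support_countable[OF sets_mu] AE_X countable_states by blast
  with mu.prob_space_axioms sets_mu have "measure_pmf (Abs_pmf \<mu>) = \<mu>"
    by (intro Abs_pmf_inverse) simp
  then have prob: "measure_pmf.prob (Abs_pmf \<mu>) S = measure \<pi> (S \<inter> ?X)" for S by (simp add: em)
  show ?thesis
  proof (intro exI[of _ "Abs_pmf \<mu>"] conjI ballI)
    show "set_pmf (Abs_pmf \<mu>) \<subseteq> ?X"
    proof
      fix x assume "x \<in> set_pmf (Abs_pmf \<mu>)"
      then have "measure \<pi> ({x} \<inter> ?X) \<noteq> 0"
        unfolding prob[symmetric] by (simp add: measure_pmf_single set_pmf_iff)
      then show "x \<in> ?X" by (cases "x \<in> ?X") auto
    qed
    fix S assume "S \<in> sets (state_space N)"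
    then have "S \<inter> ?X = S" unfolding sets_state_space by blast
    then show "measure \<pi> S = measure_pmf.prob (Abs_pmf \<mu>) S" by (simp only: prob)
  qed
qed

lemma geom_product_facts:
  assumes "0 < x" "x < 1"
  shows "prob_space (geom_product N x)" "sets (geom_product N x) = sets (state_space N)"
    "translation_invariant N (geom_product N x)"
    "\<And>S. S \<in> sets (state_space N) \<Longrightarrow> measure (geom_product N x) S = measure_pmf.prob (geometric_states N x) S"
proof -
  let ?g = "measure_pmf (geometric_pmf (1 - x))"
  show prob: "prob_space (geom_product N x)"
    unfolding geom_product_def by (intro prob_space_PiM measure_pmf.prob_space_axioms)
  show sets: "sets (geom_product N x) = sets (state_space N)"
    unfolding geom_product_def by (intro sets_PiM_cong) auto
  show "translation_invariant N (geom_product N x)"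
    unfolding translation_invariant_def
  proof
    fix k
    let ?f = "\<lambda>i. (i - 1 + k) mod N + 1"
    have inj: "inj_on ?f {1..N}"
    proof (rule inj_onI)
      have le: "i = j" if "1 \<le> i" "i \<le> j" "j \<le> N" "?f j = ?f i" for i j
      proof -
        have "N dvd (j - 1 + k) - (i - 1 + k)"
          using that by (subst mod_eq_dvd_iff_nat[symmetric]) simp_all
        also have "(j - 1 + k) - (i - 1 + k) = j - i" using that by simp
        finally have "N dvd j - i" .
        moreover have "j - i < N" using that by simp
        ultimately have "j - i = 0" by (meson dvd_imp_le not_less zero_less_iff_neq_zero)
        with that show ?thesis by simp
      qed
      fix i j assume "i \<in> {1..N}" "j \<in> {1..N}" "?f i = ?f j"
      then show "i = j" using le[of i j] le[of j i] by (cases "i \<le> j") simp_all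
    qed
    have into: "?f \<in> {1..N} \<rightarrow> {1..N}"
    proof
      fix i assume "i \<in> {1..N}"
      then have "(i - 1 + k) mod N < N" by (intro mod_less_divisor) auto
      then show "?f i \<in> {1..N}" by simp
    qed
    have "distr (Pi\<^sub>M {1..N} (\<lambda>_. ?g)) (Pi\<^sub>M {1..N} (\<lambda>_. ?g)) (\<lambda>\<omega>. \<lambda>n\<in>{1..N}. \<omega> (?f n)) = Pi\<^sub>M {1..N} (\<lambda>_. ?g)"
      by (rule distr_PiM_reindex[OF _ inj into]) (rule measure_pmf.prob_space_axioms)
    moreover have "distr (geom_product N x) (state_space N) (translate N k)
        = distr (Pi\<^sub>M {1..N} (\<lambda>_. ?g)) (Pi\<^sub>M {1..N} (\<lambda>_. ?g)) (\<lambda>\<omega>. \<lambda>n\<in>{1..N}. \<omega> (?f n))"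
      unfolding geom_product_def using sets by (intro distr_cong) (auto simp: geom_product_def translate_def)
    ultimately show "distr (geom_product N x) (state_space N) (translate N k) = geom_product N x"
      by (simp add: geom_product_def)
  qed
  from ex_pmf_of_state_law[OF prob sets] obtain p where p: "set_pmf p \<subseteq> PiE {1..N} (\<lambda>_. UNIV)"
      "\<And>S. S \<in> sets (state_space N) \<Longrightarrow> measure (geom_product N x) S = measure_pmf.prob p S" by blast
  have "p = geometric_states N x"
  proof (rule pmf_eqI)
    fix y
    show "pmf p y = pmf (geometric_states N x) y"
    proof (cases "y \<in> PiE {1..N} (\<lambda>_. UNIV)")
      case True
      then have "{y} \<in> sets (state_space N)" unfolding sets_state_space by blast
      from p(2)[OF this] have "pmf p y = measure (geom_product N x) {y}" by (simp add: measure_pmf_single)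
      also have "{y} = PiE {1..N} (\<lambda>i. {y i})" using True by (intro PiE_singleton[symmetric]) (auto simp: PiE_def)
      also have "measure (geom_product N x) \<dots> = (\<Prod>i\<in>{1..N}. measure ?g {y i})"
      proof -
        interpret fin: finite_product_prob_space "\<lambda>_. ?g" "{1..N}"
          by unfold_locales auto
        show ?thesis unfolding geom_product_def by (rule fin.finite_measure_PiM_emb) simp
      qed
      also have "\<dots> = (\<Prod>i\<in>{1..N}. pmf (geometric_pmf (1 - x)) (y i))" by (simp only: measure_pmf_single)
      also have "\<dots> = pmf (geometric_states N x) y"
        using True by (subst pmf_Pi') (auto simp: PiE_def extensional_def)
      finally show ?thesis .
    next
      case False
      then have "y \<notin> set_pmf p" "y \<notin> set_pmf (geometric_states N x)"
        using p(1) set_geometric_states[of N x] by blast+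
      then show ?thesis by (simp add: set_pmf_iff)
    qed
  qed
  with p(2) show "\<And>S. S \<in> sets (state_space N) \<Longrightarrow> measure (geom_product N x) S = measure_pmf.prob (geometric_states N x) S"
    by simp
qed

lemma distr_state_prob:
  assumes "queue_state N q t \<in> M \<rightarrow>\<^sub>M state_space N" "S \<in> sets (state_space N)"
  shows "measure (distr M (state_space N) (queue_state N q t)) S = measure M {\<omega>\<in>space M. queue_state N q t \<omega> \<in> S}"
  using measure_distr[OF assms] by (simp add: vimage_def Int_def conj_commute)

lemma state_law_eqI:
  assumes "prob_space \<pi>" "prob_space \<pi>'" "sets \<pi> = sets (state_space N)" "sets \<pi>' = sets (state_space N)"
    and "\<And>S. S \<in> sets (state_space N) \<Longrightarrow> measure \<pi> S = measure \<pi>' S"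
  shows "\<pi> = \<pi>'"
proof (rule measure_eqI)
  interpret P: prob_space \<pi> by fact
  interpret P': prob_space \<pi>' by fact
  fix S assume "S \<in> sets \<pi>"
  then show "emeasure \<pi> S = emeasure \<pi>' S"
    using assms(3,5) by (simp add: P.emeasure_eq_measure P'.emeasure_eq_measure)
qed (simp add: assms(3,4))

lemma geom_product_stationary:
  assumes noise: "driving_noise M N lam A D" and N: "1 \<le> N" and pos: "0 < lam" "0 < B" "0 \<le> \<xi>"
    and x: "0 < x" "x < 1" "x * service_rate B \<xi> x = lam"
  shows "MF1_stationary M N lam B \<xi> A D (geom_product N x)"
proof -
  let ?\<pi> = "geom_product N x"
  let ?E = "?\<pi> \<Otimes>\<^sub>M M" and ?A = "\<lambda>i \<omega>. A i (snd \<omega>)" and ?D = "\<lambda>i \<omega>. D i (snd \<omega>)"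
  note \<pi> = geom_product_facts[where N = N, OF x(1,2)]
  have ex: "\<exists>q. MF1_solution ?E N lam B \<xi> ?A ?D q \<and> distr ?E (state_space N) (queue_state N q 0) = ?\<pi>"
    by (rule MF1_solution_exists[OF \<pi> noise N pos x])
  have all: "distr ?E (state_space N) (queue_state N q t) = ?\<pi>"
    if sol: "MF1_solution ?E N lam B \<xi> ?A ?D q" and init: "distr ?E (state_space N) (queue_state N q 0) = ?\<pi>"
      and t: "0 \<le> t" for q t
  proof -
    interpret S: mf_solution ?E N lam B \<xi> ?A ?D q
      using sol N pos by unfold_locales
    have meas: "queue_state N q s \<in> ?E \<rightarrow>\<^sub>M state_space N" if "0 \<le> s" for s
      using that by (intro queue_state_measurable S.queue_measurable)
    have i: "S.prob {\<omega>\<in>space ?E. queue_state N q 0 \<omega> \<in> S} = measure_pmf.prob (geometric_states N x) S"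
      if "S \<in> sets (state_space N)" for S
      using distr_state_prob[OF meas[OF order_refl] that] unfolding init \<pi>(4)[OF that] by simp
    show ?thesis
    proof (rule state_law_eqI[OF S.prob_space_distr[OF meas[OF t]] \<pi>(1) _ \<pi>(2)])
      fix S assume S: "S \<in> sets (state_space N)"
      show "measure (distr ?E (state_space N) (queue_state N q t)) S = measure ?\<pi> S"
        unfolding distr_state_prob[OF meas[OF t] S] \<pi>(4)[OF S]
        by (rule S.geometric_law_preserved[OF x i t S])
    qed simp
  qed
  show ?thesis
    unfolding MF1_stationary_def Let_def using \<pi>(1-3) ex all by blast
qed

text \<open>The busy probability of a stationary solution lies in \<open>[0, 1]\<close>, so its constant rate is at least \<open>service_rate B \<xi> 1 > lam\<close>
  and the queues are stable.\<close>

lemma stationary_unique: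
  assumes N: "1 \<le> N" and pos: "0 < lam" "0 < B" "0 \<le> \<xi>"
    and stable: "lam < service_rate B \<xi> 1" and stat: "MF1_stationary M N lam B \<xi> A D \<pi>"
  shows "\<exists>x. 0 < x \<and> x < 1 \<and> x * service_rate B \<xi> x = lam \<and> \<pi> = geom_product N x"
proof -
  let ?E = "\<pi> \<Otimes>\<^sub>M M" and ?A = "\<lambda>i \<omega>. A i (snd \<omega>)" and ?D = "\<lambda>i \<omega>. D i (snd \<omega>)"
  have \<pi>: "prob_space \<pi>" "sets \<pi> = sets (state_space N)"
    using stat by (auto simp only: MF1_stationary_def)
  obtain q where sol: "MF1_solution ?E N lam B \<xi> ?A ?D q"
    and law: "\<And>t. 0 \<le> t \<Longrightarrow> distr ?E (state_space N) (queue_state N q t) = \<pi>"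
    using stat unfolding MF1_stationary_def Let_def by blast
  interpret S: mf_solution ?E N lam B \<xi> ?A ?D q
    using sol N pos by unfold_locales
  obtain p where p: "set_pmf p \<subseteq> PiE {1..N} (\<lambda>_. UNIV)"
      "\<And>S. S \<in> sets (state_space N) \<Longrightarrow> measure \<pi> S = measure_pmf.prob p S"
    using ex_pmf_of_state_law[OF \<pi>] by blast
  have meas: "queue_state N q s \<in> ?E \<rightarrow>\<^sub>M state_space N" if "0 \<le> s" for s
    using that by (intro queue_state_measurable S.queue_measurable)
  have pt: "S.prob {\<omega>\<in>space ?E. queue_state N q t \<omega> \<in> S} = measure_pmf.prob p S"
    if "S \<in> sets (state_space N)" "0 \<le> t" for S t
    using distr_state_prob[OF meas[OF that(2)] that(1)] unfolding law[OF that(2)] p(2)[OF that(1)] by simp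
  let ?c = "S.busy 0"
  define r where "r = service_rate B \<xi> ?c"
  have c: "0 \<le> ?c" "?c \<le> 1" by auto
  have r: "lam < r" unfolding r_def
    using service_rate_antimono[OF pos(2,3) c] stable by linarith
  define x where "x = lam / r"
  have x: "0 < x" "x < 1" "x * r = lam" using r pos by (auto simp: x_def)
  note geo = S.stationary_law_geometric[OF p(1) pt, folded r_def, OF _ _ r, folded x_def]
  let ?S = "{y\<in>PiE {1..N} (\<lambda>_. UNIV :: nat set). 0 < y 1}"
  have S: "?S \<in> sets (state_space N)" unfolding sets_state_space by blast
  have "?c = measure_pmf.prob p ?S" unfolding S.busy_eq_event by (rule pt[OF S order_refl])
  also have "\<dots> = measure_pmf.prob (geometric_states N x) ?S" by (rule geo[OF _ _ S])
  also have "\<dots> = x" by (rule geometric_states_busy[OF N x(1,2)])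
  finally have cx: "?c = x" .
  have "x * service_rate B \<xi> x = lam" using x(3) unfolding r_def cx .
  moreover have "\<pi> = geom_product N x"
  proof (rule state_law_eqI[OF \<pi>(1) geom_product_facts(1)[OF x(1,2)] \<pi>(2) geom_product_facts(2)[OF x(1,2)]])
    fix S assume S: "S \<in> sets (state_space N)"
    show "measure \<pi> S = measure (geom_product N x) S"
      unfolding p(2)[OF S] geom_product_facts(4)[OF x(1,2) S] by (rule geo[OF _ _ S])
  qed
  ultimately show ?thesis using x by blast
qed

theorem theorem3p16:
  fixes M :: "'w measure" and N :: nat and B lam :: real and l :: "real \<Rightarrow> real"
    and A :: "nat \<Rightarrow> 'w \<Rightarrow> real measure"
    and D :: "nat \<Rightarrow> 'w \<Rightarrow> (real \<times> real) measure"
  assumes "N \<ge> 2" and "B > 0" and "path_loss l"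
    and "driving_noise M N lam A D"
    and "0 < lam" and "lam < B * log 2 (1 + 1 / (1 + xi l N))"
  shows "(\<exists>!x. x \<in> {0..1} \<and> load_equation lam B (xi l N) x)
       \<and> (\<exists>!\<pi>. MF1_stationary M N lam B (xi l N) A D \<pi>)
       \<and> MF1_stationary M N lam B (xi l N) A D (geom_product N (x_star lam B (xi l N)))"
proof -
  let ?\<xi> = "xi l N"
  let ?x = "x_star lam B ?\<xi>"
  have xi: "0 \<le> ?\<xi>" using assms(3) by (rule xi_nonneg)
  have N: "1 \<le> N" using assms(1) by simp
  have stable: "lam < service_rate B ?\<xi> 1" using assms(6) by (simp add: service_rate_def)
  have ex1: "\<exists>!x. x \<in> {0..1} \<and> load_equation lam B ?\<xi> x"
    by (rule ex1_load_equation[OF assms(2) xi assms(5) stable])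
  have star: "?x \<in> {0..1} \<and> load_equation lam B ?\<xi> ?x"
    unfolding x_star_def by (rule theI'[OF ex1])
  then have load: "0 \<le> ?x" "?x \<le> 1" "?x * service_rate B ?\<xi> ?x = lam"
    by (auto simp: load_equation_iff[OF assms(2) xi assms(5)])
  have x: "0 < ?x" "?x < 1"
  proof -
    show "0 < ?x" using load assms(5) by (cases "?x = 0") auto
    show "?x < 1" using load stable by (cases "?x = 1") auto
  qed
  have stat: "MF1_stationary M N lam B ?\<xi> A D (geom_product N ?x)"
    by (rule geom_product_stationary[OF assms(4) N assms(5,2) xi x load(3)])
  have unique: "\<pi> = geom_product N ?x" if st: "MF1_stationary M N lam B ?\<xi> A D \<pi>" for \<pi>
  proof -
    obtain y where y: "0 < y" "y < 1" "y * service_rate B ?\<xi> y = lam" "\<pi> = geom_product N y"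
      using stationary_unique[OF N assms(5,2) xi stable st] by blast
    then have "y \<in> {0..1} \<and> load_equation lam B ?\<xi> y"
      by (simp add: load_equation_iff[OF assms(2) xi assms(5)])
    with star ex1 have "y = ?x" by blast
    with y(4) show ?thesis by simp
  qed
  show ?thesis using ex1 stat unique by blast
qed

end
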